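(* Let $\mathbb{K}$ be a field of characteristic $0$, let $N\ge 1$, let $R=\mathbb{K}[x_0,\ldots,x_N]$, and let $I=\bigcap_{i=1}^s I(P_i)\subset R$ be the ideal of $s\geq 1$ distinct points $P_1,\ldots,P_s$ in $\mathbb{P}^N_{\mathbb{K}}$. Then: (1) $\left(I^{(t)}\right)^{(Nm-N+1)}\subseteq \left(I^{(t)}\right)^m$ for all integers $m\geq 1$ and $t\geq 2$. (2) $\rho\left(I^{(t)}\right)\leq \frac{t+N-1}{t}$ for every integer $t\geq 1$. (3) $\lim_{t\to\infty}\rho\left(I^{(t)}\right)=1$.
   Context: For a point $P\in\mathbb{P}^N_{\mathbb{K}}$ ($\mathbb{K}$-rational, i.e. given by homogeneous coordinates in $\mathbb{K}$), $I(P)\subset R$ is the ideal generated by all homogeneous polynomials vanishing at $P$. For a fat points ideal $J=\bigcap_{i=1}^s I(P_i)^{a_i}$ with distinct points $P_i$ and integers $a_i\ge 1$, the $m$-th symbolic power is $J^{(m)}=\bigcap_{i=1}^s I(P_i)^{a_i m}$. In particular, for $I=\bigcap_{i=1}^s I(P_i)$ one has $I^{(t)}=\bigcap_{i=1}^s I(P_i)^t$ and $\left(I^{(t)}\right)^{(m)}=I^{(tm)}=\bigcap_{i=1}^s I(P_i)^{tm}$. The notation $J^r$ without parentheses is the ordinary $r$-th power. The resurgence $\rho(J)$ of such an ideal is the supremum of all ratios $m/r$ over pairs of positive integers $m,r$ such that $J^{(m)}\not\subseteq J^r$. *)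

theory Defs
  imports "HOL-Analysis.Analysis" "HOL-Library.Poly_Mapping"
begin

text \<open>
  The polynomial ring in variables indexed by the finite type \<open>'n\<close>; the ring
  \<open>K[x_0, ..., x_N]\<close> is the case where \<open>'n\<close> has \<open>N + 1\<close> elements.
\<close>

type_synonym ('k, 'n) mpoly = "('n \<Rightarrow>\<^sub>0 nat) \<Rightarrow>\<^sub>0 'k"

definition poly_eval :: "('k::comm_semiring_1, 'n::finite) mpoly \<Rightarrow> 'k ^ 'n \<Rightarrow> 'k" where
  "poly_eval f v = (\<Sum>u\<in>Poly_Mapping.keys f.
     Poly_Mapping.lookup f u * (\<Prod>i\<in>UNIV. (v $ i) ^ Poly_Mapping.lookup u i))"

definition homogeneous_poly :: "nat \<Rightarrow> ('k::zero, 'n::finite) mpoly \<Rightarrow> bool" where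
  "homogeneous_poly d f \<longleftrightarrow>
     (\<forall>u\<in>Poly_Mapping.keys f. (\<Sum>i\<in>UNIV. Poly_Mapping.lookup u i) = d)"

text \<open>
  A point of projective space is the set of all its vectors of homogeneous coordinates,
  that is, an orbit of the nonzero scalars on the nonzero vectors.
\<close>

definition proj_rel :: "(('k::field ^ 'n::finite) \<times> ('k ^ 'n)) set" where
  "proj_rel = {(v, w). v \<noteq> 0 \<and> w \<noteq> 0 \<and> (\<exists>c. c \<noteq> 0 \<and> w = c *s v)}"

definition proj_space :: "('k::field ^ 'n::finite) set set" where
  "proj_space = (UNIV - {0}) // proj_rel"

text \<open>
  Ideals of a commutative ring are its submodules, so the ideal generated by a set is
  its span over the ring acting on itself.
\<close>

abbreviation ideal_gen :: "'r::comm_ring_1 set \<Rightarrow> 'r set" where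
  "ideal_gen \<equiv> module.span (*)"

definition ideal_mult :: "'r::comm_ring_1 set \<Rightarrow> 'r set \<Rightarrow> 'r set" where
  "ideal_mult A B = ideal_gen {a * b | a b. a \<in> A \<and> b \<in> B}"

primrec ideal_power :: "'r::comm_ring_1 set \<Rightarrow> nat \<Rightarrow> 'r set" where
  "ideal_power A 0 = UNIV"
| "ideal_power A (Suc n) = ideal_mult A (ideal_power A n)"

definition point_ideal :: "('k::field ^ 'n::finite) set \<Rightarrow> ('k, 'n) mpoly set" where
  "point_ideal p = ideal_gen {f. (\<exists>d. homogeneous_poly d f) \<and> (\<forall>v\<in>p. poly_eval f v = 0)}"

text \<open>
  A fat points ideal is given by a finite set \<open>X\<close> of points and a multiplicity \<open>a p\<close>
  for each point \<open>p\<close> of \<open>X\<close>. Its symbolic powers, and hence its resurgence, are defined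
  from these data.
\<close>

definition fat_points_ideal ::
    "('k::field ^ 'n::finite) set set \<Rightarrow> (('k ^ 'n) set \<Rightarrow> nat) \<Rightarrow> ('k, 'n) mpoly set" where
  "fat_points_ideal X a = (\<Inter>p\<in>X. ideal_power (point_ideal p) (a p))"

definition symbolic_power ::
    "('k::field ^ 'n::finite) set set \<Rightarrow> (('k ^ 'n) set \<Rightarrow> nat) \<Rightarrow> nat \<Rightarrow> ('k, 'n) mpoly set" where
  "symbolic_power X a m = fat_points_ideal X (\<lambda>p. a p * m)"

text \<open>
  The supremum is taken in the extended reals, so that it is meaningful without
  knowing beforehand that the set of ratios is bounded and nonempty.
\<close>

definition resurgence ::
    "('k::field ^ 'n::finite) set set \<Rightarrow> (('k ^ 'n) set \<Rightarrow> nat) \<Rightarrow> ereal" where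
  "resurgence X a = Sup {ereal (real m / real r) | m r. m \<ge> 1 \<and> r \<ge> 1 \<and>
     \<not> symbolic_power X a m \<subseteq> ideal_power (fat_points_ideal X a) r}"

text \<open>
  The ideal of a set of points is the fat points ideal with all multiplicities \<open>1\<close>. Its
  \<open>t\<close>-th symbolic power is the fat points ideal with all multiplicities \<open>t\<close>, and it is
  with respect to these multiplicities that symbolic powers of that ideal are formed.
\<close>

lemma module_ring_mult: "module ((*) :: 'r::comm_ring_1 \<Rightarrow> 'r \<Rightarrow> 'r)"
  by unfold_locales (auto simp: algebra_simps)

lemma ideal_power_1: "ideal_power (ideal_gen S) 1 = ideal_gen S"
proof -
  interpret module "(*) :: 'a \<Rightarrow> 'a \<Rightarrow> 'a" by (rule module_ring_mult)
  have "{a * b | a b. a \<in> span S \<and> b \<in> UNIV} = span S"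
  proof (intro subset_antisym subsetI)
    fix x assume "x \<in> {a * b | a b. a \<in> span S \<and> b \<in> UNIV}"
    then obtain a b where x: "x = b * a" and a: "a \<in> span S"
      by (auto simp: mult.commute)
    show "x \<in> span S" unfolding x by (rule span_scale[OF a])
  next
    fix x assume "x \<in> span S"
    then show "x \<in> {a * b | a b. a \<in> span S \<and> b \<in> UNIV}"
      by (intro CollectI exI[of _ x] exI[of _ 1]) simp
  qed
  then show ?thesis
    by (simp add: ideal_mult_def span_span)
qed

lemma fat_points_ideal_1: "fat_points_ideal X (\<lambda>_. 1) = (\<Inter>p\<in>X. point_ideal p)"
  by (simp only: fat_points_ideal_def point_ideal_def ideal_power_1)

lemma symbolic_power_points: "symbolic_power X (\<lambda>_. 1) t = fat_points_ideal X (\<lambda>_. t)"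
  by (simp add: symbolic_power_def)

lemma symbolic_power_symbolic_power:
  "symbolic_power X (\<lambda>_. t) m = symbolic_power X (\<lambda>_. 1) (t * m)"
  by (simp add: symbolic_power_def)

end

theory Submission
  imports Defs "HOL-Library.Function_Algebras"
begin

text \<open>
  Everything but the lower bound of the resurgence follows from the containment of the symbolic
  power \<open>I^(m(N+t-1))\<close> in the \<open>m\<close>-th power of \<open>I^(t)\<close>, which is proved by reduction modulo a prime.
  In characteristic \<open>p\<close> and for \<open>q\<close> a power of \<open>p\<close>, the pigeonhole principle shows that
  \<open>I^(q(N+t-1))\<close> lies in the \<open>q\<close>-th Frobenius power of \<open>I^(t)\<close>, and the argument of Hochster and
  Huneke applies, which multiplies \<open>q\<close>-th powers of the given polynomial by a fixed nonzero
  polynomial; since the polynomial ring is free over its \<open>q\<close>-th powers, it can be carried out with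
  explicit coordinate functionals. A failure of the containment in characteristic zero is witnessed
  by finitely many elements of the field. They generate a ring in which almost no prime is
  invertible, so the failure survives in a residue field of positive characteristic. For the lower
  bound, a product of linear forms, one through each point, has powers that vanish at one of the
  points to exactly the expected order, so that \<open>I^(tm)\<close> is not contained in the \<open>(m+1)\<close>-st power
  of \<open>I^(t)\<close>.
\<close>

subsection \<open>Polynomials as sums of monomials\<close>

text \<open>In bounded degree, membership in a symbolic power means finitely many linear conditions:
  certain coefficients of \<open>shear v j f\<close> vanish. Their matrix has entries that are
  integer polynomials in the coordinates of the points. The obstacle to reduction is that its rank
  may drop: reduced polynomials may then vanish to the right order without coming from such
  polynomials, and a non-membership could be lost. So the witnesses include an identity id = G + H
  C, with C the conditions; as an equation it survives, and forces the reduced \<open>G u\<close> to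
  span the kernel of the reduced conditions. Non-membership is kept by a functional with values 0
  and 1. Both see only degrees up to a bound \<open>D\<close>, which is why the target
  \<open>W\<close> in positive characteristic is closed under addition only. The number N + t - 1 is
  what the pigeonhole principle needs: N remainders modulo q account for at most N (q - 1) of the
  order q (N + t - 1), leaving more than q (t - 1). Then (2) is immediate, and (1) for m >= 2
  follows from t (N m - N + 1) - m (N + t - 1) = (N - 1) ((m - 1) (t - 1) - 1).\<close>

lemma poly_mapping_eq_sum_single:
  fixes f :: "'a \<Rightarrow>\<^sub>0 'b::comm_monoid_add"
  assumes "finite T" "Poly_Mapping.keys f \<subseteq> T"
  shows "f = (\<Sum>u\<in>T. Poly_Mapping.single u (Poly_Mapping.lookup f u))"
proof (rule poly_mapping_eqI)
  fix w
  have "Poly_Mapping.lookup (\<Sum>u\<in>T. Poly_Mapping.single u (Poly_Mapping.lookup f u)) w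
      = (\<Sum>u\<in>T. if u = w then Poly_Mapping.lookup f u else 0)"
    by (auto simp: lookup_sum lookup_single when_def intro!: sum.cong)
  also have "\<dots> = Poly_Mapping.lookup f w"
    using assms by (auto simp: not_in_keys_iff_lookup_eq_zero[symmetric] sum.delta)
  finally show "Poly_Mapping.lookup f w
      = Poly_Mapping.lookup (\<Sum>u\<in>T. Poly_Mapping.single u (Poly_Mapping.lookup f u)) w" ..
qed

abbreviation scalar :: "'k::comm_ring_1 \<Rightarrow> ('k, 'n) mpoly" where
  "scalar c \<equiv> Poly_Mapping.single 0 c"

abbreviation mon :: "('n \<Rightarrow>\<^sub>0 nat) \<Rightarrow> ('k::comm_ring_1, 'n) mpoly" where
  "mon u \<equiv> Poly_Mapping.single u 1"

definition Var :: "'n \<Rightarrow> ('k::comm_ring_1, 'n) mpoly" where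
  "Var i = mon (Poly_Mapping.single i 1)"

lemma scalar_mult_single: "scalar c * Poly_Mapping.single u d = Poly_Mapping.single u (c * d)"
  by (simp add: mult_single)

lemma lookup_scalar_mult [simp]:
  "Poly_Mapping.lookup (scalar c * f) u = c * Poly_Mapping.lookup f u"
  for f :: "('k::comm_ring_1, 'n) mpoly"
proof -
  have "scalar c * f = (\<Sum>w\<in>Poly_Mapping.keys f. Poly_Mapping.single w (c * Poly_Mapping.lookup f w))"
    by (subst poly_mapping_eq_sum_single[of "Poly_Mapping.keys f" f])
       (auto simp: sum_distrib_left scalar_mult_single)
  then have "Poly_Mapping.lookup (scalar c * f) u
      = (\<Sum>w\<in>Poly_Mapping.keys f. if w = u then c * Poly_Mapping.lookup f w else 0)"
    by (auto simp: lookup_sum lookup_single when_def intro!: sum.cong)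
  then show ?thesis
    by (auto simp: not_in_keys_iff_lookup_eq_zero sum.delta)
qed

lemma mon_eq_prod_Var: "mon u = (\<Prod>i\<in>UNIV. Var i ^ Poly_Mapping.lookup u i)"
  for u :: "'n::finite \<Rightarrow>\<^sub>0 nat"
proof -
  have Var_power: "Var i ^ k = mon (Poly_Mapping.single i k)" for i :: 'n and k
    by (induction k) (simp_all add: Var_def mult_single single_add[symmetric])
  have prod: "(\<Prod>i\<in>I. mon (w i)) = mon (\<Sum>i\<in>I. w i)"
    for I :: "'n set" and w :: "'n \<Rightarrow> 'n \<Rightarrow>\<^sub>0 nat"
    by (induction I rule: infinite_finite_induct) (simp_all add: mult_single)
  show ?thesis
    unfolding Var_power prod by (subst poly_mapping_eq_sum_single[of UNIV u]) auto
qed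

subsection \<open>Evaluation homomorphisms\<close>

text \<open>The universal property of the polynomial ring. Evaluation at a point,
  \<open>shear\<close>, \<open>reduce\<close> and restriction to a line are all instances, so that
  their multiplicativity is proved once.\<close>

definition mpoly_eval ::
    "('k::comm_ring_1 \<Rightarrow> 'r::comm_ring_1) \<Rightarrow> ('n::finite \<Rightarrow> 'r) \<Rightarrow> ('k, 'n) mpoly \<Rightarrow> 'r" where
  "mpoly_eval h x f =
     (\<Sum>u\<in>Poly_Mapping.keys f. h (Poly_Mapping.lookup f u) * (\<Prod>i\<in>UNIV. x i ^ Poly_Mapping.lookup u i))"

definition subring :: "'r::comm_ring_1 set \<Rightarrow> bool" where
  "subring A \<longleftrightarrow> 1 \<in> A \<and> (\<forall>a\<in>A. \<forall>b\<in>A. a - b \<in> A \<and> a * b \<in> A)"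

text \<open>Relative to a set, because the residue map respects the operations only on a subring of
  the field, and that subring is not a type.\<close>

definition ring_hom_on :: "'r::comm_ring_1 set \<Rightarrow> ('r \<Rightarrow> 's::comm_ring_1) \<Rightarrow> bool" where
  "ring_hom_on A h \<longleftrightarrow> subring A \<and> h 1 = 1 \<and>
     (\<forall>a\<in>A. \<forall>b\<in>A. h (a + b) = h a + h b \<and> h (a * b) = h a * h b)"

abbreviation "coeffs_in A f \<equiv> (\<forall>u. Poly_Mapping.lookup f u \<in> A)"

lemma subring_closed:
  assumes "subring A"
  shows subring_1: "1 \<in> A" and subring_0: "0 \<in> A"
    and subring_diff: "\<And>a b. a \<in> A \<Longrightarrow> b \<in> A \<Longrightarrow> a - b \<in> A"
    and subring_uminus: "\<And>a. a \<in> A \<Longrightarrow> - a \<in> A"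
    and subring_add: "\<And>a b. a \<in> A \<Longrightarrow> b \<in> A \<Longrightarrow> a + b \<in> A"
    and subring_mult: "\<And>a b. a \<in> A \<Longrightarrow> b \<in> A \<Longrightarrow> a * b \<in> A"
proof -
  show 1: "1 \<in> A" and diff: "\<And>a b. a \<in> A \<Longrightarrow> b \<in> A \<Longrightarrow> a - b \<in> A"
    and "\<And>a b. a \<in> A \<Longrightarrow> b \<in> A \<Longrightarrow> a * b \<in> A"
    using assms by (auto simp: subring_def)
  show 0: "0 \<in> A" using diff[OF 1 1] by simp
  show neg: "- a \<in> A" if "a \<in> A" for a using diff[OF 0 that] by simp
  show "a + b \<in> A" if "a \<in> A" "b \<in> A" for a b using diff[OF that(1) neg[OF that(2)]] by simp
qed

lemma subring_sum: "subring A \<Longrightarrow> (\<And>i. i \<in> I \<Longrightarrow> f i \<in> A) \<Longrightarrow> sum f I \<in> A"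
  by (induction I rule: infinite_finite_induct) (auto intro: subring_0 subring_add)

lemma subring_power: "subring A \<Longrightarrow> a \<in> A \<Longrightarrow> a ^ n \<in> A"
  by (induction n) (auto intro: subring_1 subring_mult)

lemma subring_prod: "subring A \<Longrightarrow> (\<And>i. i \<in> I \<Longrightarrow> f i \<in> A) \<Longrightarrow> prod f I \<in> A"
  by (induction I rule: infinite_finite_induct) (auto intro: subring_1 subring_mult)

lemma subring_UNIV [simp]: "subring UNIV"
  by (simp add: subring_def)

lemma ring_hom_on_add: "ring_hom_on A h \<Longrightarrow> a \<in> A \<Longrightarrow> b \<in> A \<Longrightarrow> h (a + b) = h a + h b"
  and ring_hom_on_mult: "ring_hom_on A h \<Longrightarrow> a \<in> A \<Longrightarrow> b \<in> A \<Longrightarrow> h (a * b) = h a * h b"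
  by (simp_all add: ring_hom_on_def)

lemma ring_hom_on_0: "ring_hom_on A h \<Longrightarrow> h 0 = 0"
proof -
  assume h: "ring_hom_on A h"
  then have "0 \<in> A" by (simp add: ring_hom_on_def subring_0)
  with h have "h (0 + 0) = h 0 + h 0" unfolding ring_hom_on_def by blast
  then show ?thesis by simp
qed

lemma ring_hom_on_sum:
  assumes "ring_hom_on A h" "\<And>i. i \<in> I \<Longrightarrow> f i \<in> A"
  shows "h (sum f I) = (\<Sum>i\<in>I. h (f i))"
  using assms(2)
proof (induction I rule: infinite_finite_induct)
  case (insert i I)
  have "f i \<in> A" "sum f I \<in> A"
    using insert.prems assms(1) by (auto simp: ring_hom_on_def intro: subring_sum)
  then show ?case using insert assms(1) by (simp add: ring_hom_on_def)
qed (auto simp: ring_hom_on_0[OF assms(1)])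

lemma ring_hom_on_power:
  assumes h: "ring_hom_on A h" and a: "a \<in> A"
  shows "h (a ^ n) = h a ^ n"
proof (induction n)
  case (Suc n)
  have "a ^ n \<in> A" using h a by (auto simp: ring_hom_on_def intro: subring_power)
  then show ?case using Suc h a by (simp add: ring_hom_on_def)
qed (use h in \<open>simp add: ring_hom_on_def\<close>)

lemma ring_hom_on_prod:
  assumes h: "ring_hom_on A h" and f: "\<And>i. i \<in> I \<Longrightarrow> f i \<in> A"
  shows "h (prod f I) = (\<Prod>i\<in>I. h (f i))"
  using f
proof (induction I rule: infinite_finite_induct)
  case (insert i I)
  have "f i \<in> A" "prod f I \<in> A"
    using insert.prems h by (auto simp: ring_hom_on_def intro: subring_prod)
  then show ?case using insert h by (simp add: ring_hom_on_def)
qed (use h in \<open>simp_all add: ring_hom_on_def\<close>)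

lemma ring_hom_on_scalar: "ring_hom_on UNIV (scalar :: 'k \<Rightarrow> ('k::comm_ring_1, 'n) mpoly)"
  by (auto simp: ring_hom_on_def single_add mult_single)

lemma subring_coeffs_in:
  fixes A :: "'k::comm_ring_1 set"
  assumes A: "subring A"
  shows "subring {f :: ('k, 'n) mpoly. coeffs_in A f}"
proof -
  have "coeffs_in A (f * g)" if f: "coeffs_in A f" and g: "coeffs_in A g"
    for f g :: "('k, 'n) mpoly"
  proof
    fix w
    have "f * g = (\<Sum>u\<in>Poly_Mapping.keys f. \<Sum>v\<in>Poly_Mapping.keys g.
        Poly_Mapping.single (u + v) (Poly_Mapping.lookup f u * Poly_Mapping.lookup g v))"
      by (subst poly_mapping_eq_sum_single[of _ f, OF _ order_refl],
          simp, subst poly_mapping_eq_sum_single[of _ g, OF _ order_refl], simp)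
         (simp add: sum_product mult_single)
    then have "Poly_Mapping.lookup (f * g) w = (\<Sum>u\<in>Poly_Mapping.keys f. \<Sum>v\<in>Poly_Mapping.keys g.
        Poly_Mapping.lookup f u * Poly_Mapping.lookup g v when u + v = w)"
      by (simp add: lookup_sum lookup_single)
    then show "Poly_Mapping.lookup (f * g) w \<in> A"
      using f g A by (auto simp: when_def intro!: subring_sum subring_mult subring_0)
  qed
  then show ?thesis
    using A by (auto simp: subring_def lookup_minus lookup_one when_def intro: subring_0)
qed

lemma mpoly_eval_superset:
  assumes "h 0 = 0" "finite T" "Poly_Mapping.keys f \<subseteq> T"
  shows "mpoly_eval h x f =
    (\<Sum>u\<in>T. h (Poly_Mapping.lookup f u) * (\<Prod>i\<in>UNIV. x i ^ Poly_Mapping.lookup u i))"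
  unfolding mpoly_eval_def using assms
  by (intro sum.mono_neutral_left) (auto simp: not_in_keys_iff_lookup_eq_zero)

lemma mpoly_eval_single:
  assumes "h 0 = 0"
  shows "mpoly_eval h x (Poly_Mapping.single u c) = h c * (\<Prod>i\<in>UNIV. x i ^ Poly_Mapping.lookup u i)"
  by (subst mpoly_eval_superset[of h "{u}"]) (use assms in auto)

lemma mpoly_eval_hom:
  fixes h :: "'k::comm_ring_1 \<Rightarrow> 'r::comm_ring_1" and x :: "'n::finite \<Rightarrow> 'r"
  assumes h: "ring_hom_on A h"
  shows "ring_hom_on {f. coeffs_in A f} (mpoly_eval h x)"
proof -
  note h0 = ring_hom_on_0[OF h]
  have A: "subring A" using h by (simp add: ring_hom_on_def)
  note B = subring_coeffs_in[OF A]
  let ?P = "\<lambda>u. \<Prod>i\<in>UNIV. x i ^ Poly_Mapping.lookup u i"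
  have add: "mpoly_eval h x (f + g) = mpoly_eval h x f + mpoly_eval h x g"
    if "coeffs_in A f" "coeffs_in A g" for f g
  proof -
    let ?T = "Poly_Mapping.keys f \<union> Poly_Mapping.keys g"
    have "finite ?T" "Poly_Mapping.keys (f + g) \<subseteq> ?T"
      using keys_add[of f g] by auto
    then show ?thesis
      using that h
      by (subst (1 2 3) mpoly_eval_superset[of h ?T, OF h0])
         (auto simp: lookup_add sum.distrib[symmetric] ring_hom_on_def algebra_simps)
  qed
  have sum: "mpoly_eval h x (sum F I) = (\<Sum>i\<in>I. mpoly_eval h x (F i))"
    if "\<And>i. i \<in> I \<Longrightarrow> coeffs_in A (F i)" for I :: "'i set" and F
    using that
  proof (induction I rule: infinite_finite_induct)
    case (insert i I)
    have "sum F I \<in> {f. coeffs_in A f}" using insert.prems by (intro subring_sum B) auto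
    then show ?case using insert by (subst sum.insert) (auto simp: add)
  qed (auto simp: mpoly_eval_def)
  have mult: "mpoly_eval h x (f * g) = mpoly_eval h x f * mpoly_eval h x g"
    if f: "coeffs_in A f" and g: "coeffs_in A g" for f g
  proof -
    let ?S = "\<lambda>u v. Poly_Mapping.single (u + v) (Poly_Mapping.lookup f u * Poly_Mapping.lookup g v)"
    have S: "?S u v \<in> {f. coeffs_in A f}" for u v
      using f g A by (auto simp: lookup_single when_def intro: subring_mult subring_0)
    have S': "(\<Sum>v\<in>Poly_Mapping.keys g. ?S u v) \<in> {f. coeffs_in A f}" for u
      by (rule subring_sum[OF B S])
    have "f * g = (\<Sum>u\<in>Poly_Mapping.keys f. \<Sum>v\<in>Poly_Mapping.keys g. ?S u v)"
      by (subst poly_mapping_eq_sum_single[of _ f, OF _ order_refl],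
          simp, subst poly_mapping_eq_sum_single[of _ g, OF _ order_refl], simp)
         (simp add: sum_product mult_single)
    also have "mpoly_eval h x \<dots> = (\<Sum>u\<in>Poly_Mapping.keys f. mpoly_eval h x (\<Sum>v\<in>Poly_Mapping.keys g. ?S u v))"
      by (rule sum) (use S' in auto)
    also have "\<dots> = (\<Sum>u\<in>Poly_Mapping.keys f. \<Sum>v\<in>Poly_Mapping.keys g. mpoly_eval h x (?S u v))"
      using S by (intro sum.cong refl sum) auto
    also have "\<dots> = (\<Sum>u\<in>Poly_Mapping.keys f. \<Sum>v\<in>Poly_Mapping.keys g.
        (h (Poly_Mapping.lookup f u) * ?P u) * (h (Poly_Mapping.lookup g v) * ?P v))"
      using f g h by (intro sum.cong refl, subst mpoly_eval_single[of h, OF h0])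
        (auto simp: ring_hom_on_def lookup_add power_add prod.distrib algebra_simps)
    also have "\<dots> = mpoly_eval h x f * mpoly_eval h x g"
      by (simp add: mpoly_eval_def sum_product)
    finally show ?thesis .
  qed
  have "mpoly_eval h x 1 = 1"
    using mpoly_eval_single[of h x 0 1, OF h0] h by (simp add: ring_hom_on_def)
  with add mult B show ?thesis
    by (simp add: ring_hom_on_def)
qed

lemma mpoly_eval_hom': "ring_hom_on UNIV h \<Longrightarrow> ring_hom_on UNIV (mpoly_eval h x)"
  using mpoly_eval_hom[of UNIV h x] by simp

text \<open>A homomorphism on polynomials is determined by scalars and variables. The commutation
  rules of \<open>shear\<close> with its inverse, with evaluation and with reduction are all
  obtained by comparing these values.\<close>

lemma mpoly_eval_comp:
  assumes g: "ring_hom_on A g" and h: "\<And>u. h (Poly_Mapping.lookup f u) \<in> A" and x: "\<And>i. x i \<in> A"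
  shows "g (mpoly_eval h x f) = mpoly_eval (\<lambda>c. g (h c)) (\<lambda>i. g (x i)) f"
proof -
  have A: "subring A" using g by (simp add: ring_hom_on_def)
  have pow: "x i ^ n \<in> A" for i n
    using A x by (rule subring_power)
  have P: "(\<Prod>i\<in>UNIV. x i ^ Poly_Mapping.lookup u i) \<in> A" for u
    by (intro subring_prod A pow)
  have "g (h (Poly_Mapping.lookup f u) * (\<Prod>i\<in>UNIV. x i ^ Poly_Mapping.lookup u i))
      = g (h (Poly_Mapping.lookup f u)) * (\<Prod>i\<in>UNIV. g (x i) ^ Poly_Mapping.lookup u i)" for u
    using g h P by (simp add: ring_hom_on_def ring_hom_on_prod[OF g pow] ring_hom_on_power[OF g x])
  moreover have "h (Poly_Mapping.lookup f u) * (\<Prod>i\<in>UNIV. x i ^ Poly_Mapping.lookup u i) \<in> A" for u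
    using h P by (rule subring_mult[OF A])
  ultimately show ?thesis
    by (simp add: mpoly_eval_def ring_hom_on_sum[OF g])
qed

lemma mpoly_eval_Var [simp]: "h 0 = 0 \<Longrightarrow> h 1 = 1 \<Longrightarrow> mpoly_eval h x (Var i) = x i"
proof -
  assume h: "h 0 = 0" "h 1 = 1"
  have "(\<Prod>k\<in>UNIV. x k ^ Poly_Mapping.lookup (Poly_Mapping.single i 1) k) = (\<Prod>k\<in>UNIV. if k = i then x k else 1)"
    by (intro prod.cong) (auto simp: lookup_single when_def)
  then show ?thesis
    using h by (simp add: Var_def mpoly_eval_single)
qed

lemma mpoly_eval_scalar [simp]: "h 0 = 0 \<Longrightarrow> mpoly_eval h x (scalar c) = h c"
  by (simp add: mpoly_eval_single)

lemma mpoly_eval_id: "mpoly_eval scalar Var f = f"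
proof -
  have "mpoly_eval scalar Var f = (\<Sum>u\<in>Poly_Mapping.keys f. Poly_Mapping.single u (Poly_Mapping.lookup f u))"
    unfolding mpoly_eval_def by (simp add: mon_eq_prod_Var[symmetric] mult_single)
  then show ?thesis
    by (simp add: poly_mapping_eq_sum_single[symmetric])
qed

lemma poly_eval_eq_mpoly_eval: "poly_eval f v = mpoly_eval (\<lambda>c. c) (\<lambda>i. v $ i) f"
  by (simp add: poly_eval_def mpoly_eval_def)

subsection \<open>Homogeneous parts\<close>

definition total_degree :: "('n::finite \<Rightarrow>\<^sub>0 nat) \<Rightarrow> nat" where
  "total_degree u = (\<Sum>i\<in>UNIV. Poly_Mapping.lookup u i)"

lemma homogeneous_poly_iff:
  "homogeneous_poly d f \<longleftrightarrow> (\<forall>u. Poly_Mapping.lookup f u \<noteq> 0 \<longrightarrow> total_degree u = d)"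
  by (auto simp: homogeneous_poly_def total_degree_def in_keys_iff)

lemma total_degree_add: "total_degree (u + v) = total_degree u + total_degree v"
  by (simp add: total_degree_def lookup_add sum.distrib)

lemma finite_total_degree_le: "finite {u :: 'n::finite \<Rightarrow>\<^sub>0 nat. total_degree u \<le> D}"
proof -
  have bound: "Poly_Mapping.lookup u i \<le> D" if "total_degree u \<le> D" for u :: "'n \<Rightarrow>\<^sub>0 nat" and i
    using that member_le_sum[of i UNIV "Poly_Mapping.lookup u"] by (simp add: total_degree_def)
  have "Poly_Mapping.lookup ` {u :: 'n \<Rightarrow>\<^sub>0 nat. total_degree u \<le> D} \<subseteq> (UNIV \<rightarrow>\<^sub>E {..D})"
    using bound by (auto intro!: PiE_I)
  moreover have "finite ((UNIV :: 'n set) \<rightarrow>\<^sub>E {..D})"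
    by (intro finite_PiE) auto
  ultimately have fin: "finite (Poly_Mapping.lookup ` {u :: 'n \<Rightarrow>\<^sub>0 nat. total_degree u \<le> D})"
    by (rule finite_subset)
  have inj: "inj_on Poly_Mapping.lookup {u :: 'n \<Rightarrow>\<^sub>0 nat. total_degree u \<le> D}"
    by (rule inj_onI, rule poly_mapping_eqI) (rule fun_cong)
  show ?thesis
    by (rule finite_imageD[OF fin inj])
qed

definition homogeneous_part :: "nat \<Rightarrow> ('k::comm_ring_1, 'n::finite) mpoly \<Rightarrow> ('k, 'n) mpoly" where
  "homogeneous_part d f =
     (\<Sum>u\<in>{u\<in>Poly_Mapping.keys f. total_degree u = d}. Poly_Mapping.single u (Poly_Mapping.lookup f u))"

lemma lookup_homogeneous_part:
  "Poly_Mapping.lookup (homogeneous_part d f) u = (if total_degree u = d then Poly_Mapping.lookup f u else 0)"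
proof -
  have "Poly_Mapping.lookup (homogeneous_part d f) u
    = (\<Sum>w\<in>{w\<in>Poly_Mapping.keys f. total_degree w = d}. if w = u then Poly_Mapping.lookup f w else 0)"
    by (auto simp: homogeneous_part_def lookup_sum lookup_single when_def intro!: sum.cong)
  then show ?thesis by (auto simp: sum.delta not_in_keys_iff_lookup_eq_zero)
qed

lemma homogeneous_part_sum: "homogeneous_part d (sum f I) = (\<Sum>i\<in>I. homogeneous_part d (f i))"
  by (rule poly_mapping_eqI) (simp add: lookup_homogeneous_part lookup_sum)

lemma homogeneous_poly_homogeneous_part: "homogeneous_poly d (homogeneous_part d f)"
  by (auto simp: homogeneous_poly_iff lookup_homogeneous_part split: if_splits)

lemma homogeneous_part_homogeneous:
  "homogeneous_poly e f \<Longrightarrow> homogeneous_part d f = (if d = e then f else 0)"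
  by (rule poly_mapping_eqI) (auto simp: lookup_homogeneous_part homogeneous_poly_iff)

lemma sum_homogeneous_part:
  assumes "\<And>u. u \<in> Poly_Mapping.keys f \<Longrightarrow> total_degree u \<le> D"
  shows "f = (\<Sum>d\<le>D. homogeneous_part d f)"
proof (rule poly_mapping_eqI)
  fix u
  show "Poly_Mapping.lookup f u = Poly_Mapping.lookup (\<Sum>d\<le>D. homogeneous_part d f) u"
    using assms[of u]
    by (auto simp: lookup_sum lookup_homogeneous_part in_keys_iff)
qed

lemma total_degree_bound:
  obtains D where "\<And>u. u \<in> Poly_Mapping.keys f \<Longrightarrow> total_degree u \<le> D"
  by (rule that[of "Max (total_degree ` Poly_Mapping.keys f)"]) simp

lemma homogeneous_poly_add:
  "homogeneous_poly d f \<Longrightarrow> homogeneous_poly d g \<Longrightarrow> homogeneous_poly d (f + g)"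
  unfolding homogeneous_poly_def using keys_add[of f g] by blast

lemma homogeneous_poly_sum:
  "(\<And>i. i \<in> I \<Longrightarrow> homogeneous_poly d (f i)) \<Longrightarrow> homogeneous_poly d (sum f I)"
  by (induction I rule: infinite_finite_induct)
     (simp_all add: homogeneous_poly_add, simp_all add: homogeneous_poly_iff)

lemma homogeneous_poly_mult:
  assumes "homogeneous_poly d f" "homogeneous_poly e g"
  shows "homogeneous_poly (d + e) (f * g)"
  unfolding homogeneous_poly_def total_degree_def[symmetric]
proof
  fix u assume "u \<in> Poly_Mapping.keys (f * g)"
  then obtain a b where "u = a + b" "a \<in> Poly_Mapping.keys f" "b \<in> Poly_Mapping.keys g"
    using keys_mult[of f g] by blast
  then show "total_degree u = d + e"
    using assms by (simp add: total_degree_add homogeneous_poly_iff in_keys_iff)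
qed

lemma homogeneous_poly_1: "homogeneous_poly 0 1"
  by (auto simp: homogeneous_poly_iff lookup_one total_degree_def when_def)

lemma homogeneous_poly_power: "homogeneous_poly d f \<Longrightarrow> homogeneous_poly (n * d) (f ^ n)"
  by (induction n) (auto intro: homogeneous_poly_1 homogeneous_poly_mult)

lemma homogeneous_poly_prod:
  "(\<And>i. i \<in> I \<Longrightarrow> homogeneous_poly (d i) (f i)) \<Longrightarrow> homogeneous_poly (sum d I) (prod f I)"
  by (induction I rule: infinite_finite_induct) (auto intro: homogeneous_poly_1 homogeneous_poly_mult)

lemma homogeneous_poly_scalar_mult: "homogeneous_poly d f \<Longrightarrow> homogeneous_poly d (scalar c * f)"
  by (auto simp: homogeneous_poly_iff) (metis mult_zero_right)

lemma homogeneous_poly_Var: "homogeneous_poly (Suc 0) (Var i)"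
  by (auto simp: homogeneous_poly_iff Var_def lookup_single total_degree_def when_def)

lemma homogeneous_poly_mpoly_eval:
  assumes "\<And>i. homogeneous_poly (Suc 0) (x i)" "homogeneous_poly d f"
  shows "homogeneous_poly d (mpoly_eval scalar x f)"
  unfolding mpoly_eval_def
proof (intro homogeneous_poly_sum homogeneous_poly_scalar_mult)
  fix u assume "u \<in> Poly_Mapping.keys f"
  then have d: "d = (\<Sum>i\<in>UNIV. Poly_Mapping.lookup u i * Suc 0)"
    using assms(2) by (simp add: homogeneous_poly_iff in_keys_iff total_degree_def)
  show "homogeneous_poly d (\<Prod>i\<in>UNIV. x i ^ Poly_Mapping.lookup u i)"
    unfolding d by (intro homogeneous_poly_prod homogeneous_poly_power assms(1))
qed

lemma homogeneous_part_mpoly_eval: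
  assumes "\<And>i. homogeneous_poly (Suc 0) (x i)"
  shows "homogeneous_part d (mpoly_eval scalar x f) = mpoly_eval scalar x (homogeneous_part d f)"
proof -
  obtain D where D: "\<And>u. u \<in> Poly_Mapping.keys f \<Longrightarrow> total_degree u \<le> D"
    using total_degree_bound[of f] by blast
  have hom: "ring_hom_on UNIV (mpoly_eval scalar x)"
    by (intro mpoly_eval_hom' ring_hom_on_scalar)
  have "mpoly_eval scalar x f = (\<Sum>e\<le>D. mpoly_eval scalar x (homogeneous_part e f))"
    by (subst sum_homogeneous_part[OF D]) (simp_all add: ring_hom_on_sum[OF hom])
  then have "homogeneous_part d (mpoly_eval scalar x f)
      = (\<Sum>e\<le>D. homogeneous_part d (mpoly_eval scalar x (homogeneous_part e f)))"
    by (simp add: homogeneous_part_sum)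
  also have "\<dots> = (\<Sum>e\<le>D. if d = e then mpoly_eval scalar x (homogeneous_part e f) else 0)"
    by (intro sum.cong refl homogeneous_part_homogeneous homogeneous_poly_mpoly_eval assms
        homogeneous_poly_homogeneous_part)
  also have "\<dots> = mpoly_eval scalar x (homogeneous_part d f)"
  proof (cases "d \<le> D")
    case False
    then have "homogeneous_part d f = 0"
      using D by (intro poly_mapping_eqI) (force simp: lookup_homogeneous_part in_keys_iff)
    then show ?thesis using False by (auto simp: ring_hom_on_0[OF hom])
  qed simp
  finally show ?thesis .
qed

lemma homogeneous_part_mult:
  "homogeneous_part d (f * g) = (\<Sum>i\<le>d. homogeneous_part i f * homogeneous_part (d - i) g)"
proof -
  obtain D1 D2 where D1: "\<And>u. u \<in> Poly_Mapping.keys f \<Longrightarrow> total_degree u \<le> D1"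
    and D2: "\<And>u. u \<in> Poly_Mapping.keys g \<Longrightarrow> total_degree u \<le> D2"
    by (metis total_degree_bound)
  define B where "B = D1 + D2 + d"
  have "f = (\<Sum>i\<le>B. homogeneous_part i f)" "g = (\<Sum>i\<le>B. homogeneous_part i g)"
    by (rule sum_homogeneous_part; use D1 D2 in \<open>fastforce simp: B_def\<close>)+
  then have "f * g = (\<Sum>i\<le>B. \<Sum>k\<le>B. homogeneous_part i f * homogeneous_part k g)"
    by (metis sum_product)
  then have "homogeneous_part d (f * g)
      = (\<Sum>i\<le>B. \<Sum>k\<le>B. homogeneous_part d (homogeneous_part i f * homogeneous_part k g))"
    by (simp add: homogeneous_part_sum)
  also have "\<dots> = (\<Sum>i\<le>B. \<Sum>k\<le>B. if d = i + k then homogeneous_part i f * homogeneous_part k g else 0)"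
    by (intro sum.cong refl homogeneous_part_homogeneous homogeneous_poly_mult
        homogeneous_poly_homogeneous_part)
  also have "\<dots> = (\<Sum>i\<le>B. if i \<le> d then homogeneous_part i f * homogeneous_part (d - i) g else 0)"
  proof (intro sum.cong refl)
    fix i
    have "(\<Sum>k\<le>B. if d = i + k then homogeneous_part i f * homogeneous_part k g else 0)
      = (\<Sum>k\<le>B. if k = d - i then if i \<le> d then homogeneous_part i f * homogeneous_part k g else 0 else 0)"
      by (intro sum.cong refl) auto
    then show "(\<Sum>k\<le>B. if d = i + k then homogeneous_part i f * homogeneous_part k g else 0)
      = (if i \<le> d then homogeneous_part i f * homogeneous_part (d - i) g else 0)"
      by (auto simp: B_def)
  qed
  also have "\<dots> = (\<Sum>i\<le>d. homogeneous_part i f * homogeneous_part (d - i) g)"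
    by (rule sum.mono_neutral_cong_right) (auto simp: B_def)
  finally show ?thesis .
qed

subsection \<open>Vanishing to given order along a line\<close>

definition shear :: "'k ^ 'n \<Rightarrow> 'n \<Rightarrow> ('k::comm_ring_1, 'n::finite) mpoly \<Rightarrow> ('k, 'n) mpoly" where
  "shear v j = mpoly_eval scalar (\<lambda>i. if i = j then Var j else Var i + scalar (v $ i) * Var j)"

definition codegree :: "'n::finite \<Rightarrow> ('n \<Rightarrow>\<^sub>0 nat) \<Rightarrow> nat" where
  "codegree j u = (\<Sum>i\<in>UNIV - {j}. Poly_Mapping.lookup u i)"

text \<open>
  If \<open>v $ j = 1\<close>, the ideal of the point represented by \<open>v\<close> is generated by the forms
  \<open>x_i - v_i x_j\<close>, and \<open>shear v j\<close> is the change of coordinates that maps them to \<open>x_i\<close>. Its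
  \<open>M\<close>-th power is therefore \<open>vanishing v j M\<close>.
\<close>

definition vanishing :: "'k ^ 'n \<Rightarrow> 'n \<Rightarrow> nat \<Rightarrow> ('k::comm_ring_1, 'n::finite) mpoly set" where
  "vanishing v j M = {f. \<forall>u\<in>Poly_Mapping.keys (shear v j f). M \<le> codegree j u}"

lemma shear_hom: "ring_hom_on UNIV (shear v j)"
  unfolding shear_def by (intro mpoly_eval_hom' ring_hom_on_scalar)

lemmas shear_0 = ring_hom_on_0[OF shear_hom]
  and shear_sum = ring_hom_on_sum[OF shear_hom, simplified]
  and shear_prod = ring_hom_on_prod[OF shear_hom, simplified]
  and shear_power = ring_hom_on_power[OF shear_hom, simplified]

lemma shear_add: "shear v j (f + g) = shear v j f + shear v j g"
  and shear_mult: "shear v j (f * g) = shear v j f * shear v j g"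
  using shear_hom[of v j] by (auto simp: ring_hom_on_def)

lemma shear_scalar: "shear v j (scalar c) = scalar c"
  by (simp add: shear_def)

lemma shear_Var: "shear v j (Var i) = (if i = j then Var j else Var i + scalar (v $ i) * Var j)"
  by (simp add: shear_def)

lemma shear_shear_uminus:
  fixes f :: "('k::comm_ring_1, 'n::finite) mpoly"
  shows "shear (- v) j (shear v j f) = f"
proof -
  have "shear (- v) j (shear v j f)
    = mpoly_eval (\<lambda>c. shear (- v) j (scalar c))
       (\<lambda>i. shear (- v) j (if i = j then Var j else Var i + scalar (v $ i) * Var j)) f"
    unfolding shear_def[of v] by (rule mpoly_eval_comp[OF shear_hom]) simp_all
  also have "\<dots> = mpoly_eval scalar Var f"
  proof (rule arg_cong2[where f = "\<lambda>a b. mpoly_eval a b f"])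
    have "scalar (- (v $ i)) * Var j + scalar (v $ i) * Var j = (0 :: ('k, 'n) mpoly)" for i
      by (simp add: distrib_right[symmetric] single_add[symmetric])
    then show "(\<lambda>i. shear (- v) j (if i = j then Var j else Var i + scalar (v $ i) * Var j)) = Var"
      by (auto simp: shear_add shear_mult shear_scalar shear_Var add.assoc)
  qed (simp add: shear_scalar)
  finally show ?thesis by (simp add: mpoly_eval_id)
qed

lemma shear_uminus_shear: "shear v j (shear (- v) j f) = f"
  using shear_shear_uminus[of "- v" j f] by simp

lemma codegree_add: "codegree j (u + w) = codegree j u + codegree j w"
  by (simp add: codegree_def lookup_add sum.distrib)

lemma vanishing_0: "0 \<in> vanishing v j M"
  by (simp add: vanishing_def shear_0)

lemma vanishing_add: "f \<in> vanishing v j M \<Longrightarrow> g \<in> vanishing v j M \<Longrightarrow> f + g \<in> vanishing v j M"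
  using keys_add[of "shear v j f" "shear v j g"] by (auto simp: vanishing_def shear_add)

lemma vanishing_sum: "(\<And>i. i \<in> I \<Longrightarrow> f i \<in> vanishing v j M) \<Longrightarrow> sum f I \<in> vanishing v j M"
  by (induction I rule: infinite_finite_induct) (auto intro: vanishing_0 vanishing_add)

lemma vanishing_mult:
  assumes "f \<in> vanishing v j M" "g \<in> vanishing v j L"
  shows "f * g \<in> vanishing v j (M + L)"
  unfolding vanishing_def mem_Collect_eq shear_mult
proof
  fix u assume "u \<in> Poly_Mapping.keys (shear v j f * shear v j g)"
  then obtain a b where "u = a + b" "a \<in> Poly_Mapping.keys (shear v j f)"
      "b \<in> Poly_Mapping.keys (shear v j g)"
    using keys_mult[of "shear v j f" "shear v j g"] by blast
  then show "M + L \<le> codegree j u"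
    using assms by (auto simp: codegree_add vanishing_def intro: add_mono)
qed

lemma vanishing_UNIV: "vanishing v j 0 = UNIV"
  by (simp add: vanishing_def)

lemma vanishing_mult_left: "f \<in> vanishing v j M \<Longrightarrow> r * f \<in> vanishing v j M"
  using vanishing_mult[of r v j 0 f M] by (simp add: vanishing_UNIV)

lemma vanishing_power: "f \<in> vanishing v j M \<Longrightarrow> f ^ n \<in> vanishing v j (n * M)"
  by (induction n) (auto simp: vanishing_UNIV intro: vanishing_mult)

lemma vanishing_antimono: "M \<le> L \<Longrightarrow> vanishing v j L \<subseteq> vanishing v j M"
  by (auto simp: vanishing_def)

lemma homogeneous_part_shear: "homogeneous_part d (shear v j f) = shear v j (homogeneous_part d f)"
  unfolding shear_def
  by (rule homogeneous_part_mpoly_eval)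
     (auto intro!: homogeneous_poly_Var homogeneous_poly_add homogeneous_poly_scalar_mult)

text \<open>The substitution \<open>shear v j\<close> is linear and so respects degrees; hence
  vanishing to order \<open>M\<close> is a condition on each homogeneous part. This makes truncation
  at a degree bound possible later.\<close>

lemma vanishing_homogeneous_part:
  assumes "f \<in> vanishing v j M"
  shows "homogeneous_part d f \<in> vanishing v j M"
proof -
  have "Poly_Mapping.keys (shear v j (homogeneous_part d f)) \<subseteq> Poly_Mapping.keys (shear v j f)"
    by (metis (no_types, lifting) homogeneous_part_shear in_keys_iff lookup_homogeneous_part subsetI)
  with assms show ?thesis by (auto simp: vanishing_def)
qed

subsection \<open>Frobenius contractions\<close>

lemma CHAR_mpoly: "CHAR(('k::comm_ring_1, 'n) mpoly) = CHAR('k)"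
proof (rule CHAR_eqI)
  show "of_nat CHAR('k) = (0 :: ('k, 'n) mpoly)"
    by (simp add: single_of_nat[symmetric] del: single_of_nat)
  show "CHAR('k) dvd n" if "of_nat n = (0 :: ('k, 'n) mpoly)" for n
  proof -
    have "Poly_Mapping.lookup (of_nat n :: ('k, 'n) mpoly) 0 = 0"
      using that by simp
    then show ?thesis by (simp add: lookup_of_nat of_nat_eq_0_iff_char_dvd)
  qed
qed

definition exp_scale :: "nat \<Rightarrow> ('n \<Rightarrow>\<^sub>0 nat) \<Rightarrow> ('n \<Rightarrow>\<^sub>0 nat)" where
  "exp_scale q u = Poly_Mapping.map (\<lambda>k. q * k) u"

definition exp_div :: "nat \<Rightarrow> ('n \<Rightarrow>\<^sub>0 nat) \<Rightarrow> ('n \<Rightarrow>\<^sub>0 nat)" where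
  "exp_div q u = Poly_Mapping.map (\<lambda>k. k div q) u"

definition exp_mod :: "nat \<Rightarrow> ('n \<Rightarrow>\<^sub>0 nat) \<Rightarrow> ('n \<Rightarrow>\<^sub>0 nat)" where
  "exp_mod q u = Poly_Mapping.map (\<lambda>k. k mod q) u"

lemma lookup_exp [simp]:
  "Poly_Mapping.lookup (exp_scale q u) i = q * Poly_Mapping.lookup u i"
  "Poly_Mapping.lookup (exp_div q u) i = Poly_Mapping.lookup u i div q"
  "Poly_Mapping.lookup (exp_mod q u) i = Poly_Mapping.lookup u i mod q"
  by (auto simp: exp_scale_def exp_div_def exp_mod_def Poly_Mapping.map.rep_eq when_def)

lemma exp_scale_div_add_mod: "exp_scale q (exp_div q u) + exp_mod q u = u"
  by (rule poly_mapping_eqI) (simp add: lookup_add)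

lemma single_power: "Poly_Mapping.single u c ^ q = Poly_Mapping.single (exp_scale q u) (c ^ q)"
proof (induction q)
  case 0
  have "exp_scale 0 u = 0" by (rule poly_mapping_eqI) simp
  then show ?case by simp
next
  case (Suc q)
  have "u + exp_scale q u = exp_scale (Suc q) u" by (rule poly_mapping_eqI) (simp add: lookup_add)
  then show ?case using Suc by (simp add: mult_single)
qed

locale frobenius =
  fixes q e :: nat and field_type :: "'k::field itself"
  assumes q: "q = CHAR('k) ^ e" and CHAR_pos: "CHAR('k) > 0"
begin

lemma prime_CHAR: "prime CHAR('k)"
  using CHAR_pos by (rule prime_CHAR_semidom)

lemma q_pos: "q > 0"
  using CHAR_pos by (simp add: q)

lemma power_add_q: "(a + b :: 'k) ^ q = a ^ q + b ^ q"
  using prime_CHAR q by (rule freshmans_dream')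

lemma power_sum_q: "sum (f :: _ \<Rightarrow> ('k, 'n) mpoly) I ^ q = (\<Sum>i\<in>I. f i ^ q)"
  by (rule freshmans_dream_sum'[of q e]) (simp_all add: CHAR_mpoly prime_CHAR q)

lemma mpoly_power_q:
  fixes f :: "('k, 'n) mpoly"
  shows "f ^ q = (\<Sum>u\<in>Poly_Mapping.keys f.
      Poly_Mapping.single (exp_scale q u) (Poly_Mapping.lookup f u ^ q))"
  by (subst poly_mapping_eq_sum_single[of _ f, OF _ order_refl], simp)
     (simp add: power_sum_q single_power)

text \<open>Maps that are linear over the inverse of the \<open>q\<close>-th power map, as in
  Cartier operators.\<close>

definition twisted :: "('k \<Rightarrow> 'k) \<Rightarrow> bool" where
  "twisted \<phi> \<longleftrightarrow> (\<forall>a b. \<phi> (a + b) = \<phi> a + \<phi> b) \<and> (\<forall>c a. \<phi> (c ^ q * a) = c * \<phi> a)"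

lemma twisted_0: "twisted \<phi> \<Longrightarrow> \<phi> 0 = 0"
  using add_cancel_right_right[of "\<phi> 0" "\<phi> 0"] by (metis add.right_neutral twisted_def)

text \<open>
  The functionals are the coordinates with respect to a basis of the field over its
  subfield of \<open>q\<close>-th powers.
\<close>

lemma twisted_basis:
  obtains \<phi> :: "'k \<Rightarrow> 'k \<Rightarrow> 'k" where "\<And>b. twisted (\<phi> b)"
    and "\<And>c. finite {b. \<phi> b c \<noteq> 0}"
    and "\<And>B c. finite B \<Longrightarrow> {b. \<phi> b c \<noteq> 0} \<subseteq> B \<Longrightarrow> (\<Sum>b\<in>B. b * \<phi> b c ^ q) = c"
proof -
  \<comment> \<open>Scalars act through the \<open>q\<close>-th power map, so coordinates with
    respect to any basis are twisted. The dimension may be infinite; each element still has only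
    finitely many nonzero coordinates.\<close>
  interpret vector_space "\<lambda>c a :: 'k. c ^ q * a"
    by unfold_locales (simp_all add: algebra_simps power_add_q power_mult_distrib)
  obtain B where B: "independent B" "span B = UNIV"
    using independent_extend_basis[OF independent_empty] by (metis extend_basis_superset span_extend_basis independent_extend_basis independent_empty)
  let ?\<phi> = "\<lambda>b c. representation B c b"
  show thesis
  proof
    show "twisted (?\<phi> b)" for b
      using B by (simp add: twisted_def representation_add representation_scale)
    show fin: "finite {b. ?\<phi> b c \<noteq> 0}" for c
      by (rule finite_representation)
    fix B' c assume B': "finite B'" "{b. ?\<phi> b c \<noteq> 0} \<subseteq> B'"
    then have "(\<Sum>b\<in>B'. b * ?\<phi> b c ^ q) = (\<Sum>b | ?\<phi> b c \<noteq> 0. ?\<phi> b c ^ q * b)"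
      using q_pos by (intro sum.mono_neutral_cong_right) auto
    also have "\<dots> = c"
      using B by (intro sum_nonzero_representation_eq) auto
    finally show "(\<Sum>b\<in>B'. b * ?\<phi> b c ^ q) = c" .
  qed
qed

text \<open>If \<open>\<phi>\<close> is the coordinate at a basis element \<open>b\<close> of the
  field, this is the \<open>q\<close>-th root of the coordinate at \<open>b\<close> times the
  monomial \<open>\<mu>\<close>, for the polynomial ring as a free module over its
  \<open>q\<close>-th powers.\<close>

definition contract :: "('k \<Rightarrow> 'k) \<Rightarrow> ('n \<Rightarrow>\<^sub>0 nat) \<Rightarrow> ('k, 'n) mpoly \<Rightarrow> ('k, 'n) mpoly" where
  "contract \<phi> \<mu> f = (\<Sum>u\<in>Poly_Mapping.keys f.
     if exp_mod q u = \<mu> then Poly_Mapping.single (exp_div q u) (\<phi> (Poly_Mapping.lookup f u)) else 0)"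

context
  fixes \<phi> :: "'k \<Rightarrow> 'k"
  assumes \<phi>: "twisted \<phi>"
begin

lemma contract_superset:
  assumes "finite T" "Poly_Mapping.keys f \<subseteq> T"
  shows "contract \<phi> \<mu> f = (\<Sum>u\<in>T.
     if exp_mod q u = \<mu> then Poly_Mapping.single (exp_div q u) (\<phi> (Poly_Mapping.lookup f u)) else 0)"
  unfolding contract_def using assms
  by (intro sum.mono_neutral_left) (auto simp: not_in_keys_iff_lookup_eq_zero twisted_0[OF \<phi>])

lemma contract_single:
  "contract \<phi> \<mu> (Poly_Mapping.single u c) =
    (if exp_mod q u = \<mu> then Poly_Mapping.single (exp_div q u) (\<phi> c) else 0)"
  by (subst contract_superset[of "{u}"]) auto

lemma contract_add: "contract \<phi> \<mu> (f + g) = contract \<phi> \<mu> f + contract \<phi> \<mu> g"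
proof -
  let ?T = "Poly_Mapping.keys f \<union> Poly_Mapping.keys g"
  have "finite ?T" "Poly_Mapping.keys (f + g) \<subseteq> ?T"
    using keys_add[of f g] by auto
  then show ?thesis
    using \<phi> by (subst (1 2 3) contract_superset[of ?T])
      (auto simp: lookup_add twisted_def single_add sum.distrib[symmetric] intro!: sum.cong)
qed

lemma contract_sum: "contract \<phi> \<mu> (sum f I) = (\<Sum>i\<in>I. contract \<phi> \<mu> (f i))"
proof (induction I rule: infinite_finite_induct)
  case empty
  show ?case by (simp add: contract_def)
qed (simp_all add: contract_add, simp add: contract_def)

lemma contract_single_power_mult:
  "contract \<phi> \<mu> (Poly_Mapping.single u c ^ q * Poly_Mapping.single w d)
    = Poly_Mapping.single u c * contract \<phi> \<mu> (Poly_Mapping.single w d)"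
proof -
  have "exp_mod q (exp_scale q u + w) = exp_mod q w" "exp_div q (exp_scale q u + w) = u + exp_div q w"
    using q_pos by (auto intro!: poly_mapping_eqI simp: lookup_add)
  then show ?thesis
    using \<phi> by (simp add: single_power mult_single contract_single twisted_def)
qed

text \<open>The \<open>q\<close>-th power map is additive, so it suffices to treat single terms;
  there the factor adds \<open>exp_scale q u\<close> to the exponent, which keeps the remainders and
  adds \<open>u\<close> to the quotients.\<close>

lemma contract_power_mult: "contract \<phi> \<mu> (h ^ q * g) = h * contract \<phi> \<mu> g"
proof -
  let ?h = "\<lambda>u. Poly_Mapping.single u (Poly_Mapping.lookup h u)"
    and ?g = "\<lambda>u. Poly_Mapping.single u (Poly_Mapping.lookup g u)"
  have h: "h = (\<Sum>u\<in>Poly_Mapping.keys h. ?h u)" and g: "g = (\<Sum>w\<in>Poly_Mapping.keys g. ?g w)"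
    by (rule poly_mapping_eq_sum_single; simp)+
  have "h ^ q = (\<Sum>u\<in>Poly_Mapping.keys h. ?h u) ^ q"
    by (rule arg_cong[of _ _ "\<lambda>x. x ^ q", OF h])
  also have "\<dots> = (\<Sum>u\<in>Poly_Mapping.keys h. ?h u ^ q)"
    by (rule power_sum_q)
  finally have "h ^ q * g = (\<Sum>u\<in>Poly_Mapping.keys h. ?h u ^ q) * (\<Sum>w\<in>Poly_Mapping.keys g. ?g w)"
    by (rule arg_cong2[of _ _ _ _ "(*)", OF _ g])
  also have "\<dots> = (\<Sum>u\<in>Poly_Mapping.keys h. \<Sum>w\<in>Poly_Mapping.keys g. ?h u ^ q * ?g w)"
    by (rule sum_product)
  finally have "contract \<phi> \<mu> (h ^ q * g) = (\<Sum>u\<in>Poly_Mapping.keys h. ?h u) *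
      (\<Sum>w\<in>Poly_Mapping.keys g. contract \<phi> \<mu> (?g w))"
    by (simp add: contract_sum contract_single_power_mult sum_product)
  also have "(\<Sum>w\<in>Poly_Mapping.keys g. contract \<phi> \<mu> (?g w)) = contract \<phi> \<mu> g"
    unfolding contract_sum[symmetric] g[symmetric] ..
  finally show ?thesis unfolding h[symmetric] .
qed

text \<open>
  By the pigeonhole principle the monomials occurring in a polynomial that vanishes to order
  \<open>q (h + k)\<close>, where \<open>h\<close> is the codimension, are divisible by \<open>q\<close>-th powers of
  monomials of codegree \<open>k + 1\<close>.
\<close>

lemma contract_vanishing:
  fixes g :: "('k, 'n::finite) mpoly"
  assumes g: "g \<in> vanishing v j (q * (CARD('n) - 1 + k))" and n: "CARD('n) > 1"
  shows "contract \<phi> \<mu> g \<in> vanishing v j (k + 1)"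
proof -
  define S where "S = shear v j g"
  let ?c = "\<lambda>u. Poly_Mapping.lookup S u"
  let ?s = "shear (- v) j"
  \<comment> \<open>Contraction need not commute with \<open>shear\<close>. So \<open>g\<close> is
    expanded in the sheared coordinates and each term is carried back separately: its
    \<open>q\<close>-th power part remains a \<open>q\<close>-th power and can leave the
    contraction.\<close>
  have S: "S = (\<Sum>u\<in>Poly_Mapping.keys S. mon (exp_div q u) ^ q * Poly_Mapping.single (exp_mod q u) (?c u))"
    by (subst poly_mapping_eq_sum_single[of _ S, OF _ order_refl])
       (simp_all add: single_power mult_single exp_scale_div_add_mod)
  have "g = ?s S"
    by (simp add: S_def shear_shear_uminus)
  also have "\<dots> = (\<Sum>u\<in>Poly_Mapping.keys S.
      ?s (mon (exp_div q u)) ^ q * ?s (Poly_Mapping.single (exp_mod q u) (?c u)))"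
    by (subst S) (simp add: shear_sum shear_mult shear_power)
  finally have "contract \<phi> \<mu> g = (\<Sum>u\<in>Poly_Mapping.keys S.
      ?s (mon (exp_div q u)) * contract \<phi> \<mu> (?s (Poly_Mapping.single (exp_mod q u) (?c u))))"
    by (simp add: contract_sum contract_power_mult)
  also have "\<dots> \<in> vanishing v j (k + 1)"
  proof (rule vanishing_sum)
    fix u assume "u \<in> Poly_Mapping.keys S"
    then have u: "q * (CARD('n) - 1 + k) \<le> codegree j u"
      using g by (auto simp: vanishing_def S_def)
    have "k + 1 \<le> codegree j (exp_div q u)"
    proof (rule ccontr)
      assume "\<not> ?thesis"
      then have k: "codegree j (exp_div q u) \<le> k" by simp
      have "codegree j u \<le> (\<Sum>i\<in>UNIV - {j}. q * (Poly_Mapping.lookup u i div q) + (q - 1))"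
        unfolding codegree_def
      proof (rule sum_mono)
        fix i
        have "Poly_Mapping.lookup u i mod q \<le> q - 1"
          using q_pos by (metis Suc_pred' less_Suc_eq_le mod_less_divisor)
        then show "Poly_Mapping.lookup u i \<le> q * (Poly_Mapping.lookup u i div q) + (q - 1)"
          by (metis add_left_mono mult_div_mod_eq)
      qed
      also have "\<dots> = q * codegree j (exp_div q u) + (CARD('n) - 1) * (q - 1)"
        by (simp add: codegree_def sum.distrib sum_distrib_left)
      also have "\<dots> \<le> q * k + (CARD('n) - 1) * (q - 1)"
        using k by simp
      \<comment> \<open>Strict because there is a variable other than the one indexed by
        \<open>j\<close>.\<close>
      also have "\<dots> < q * k + (CARD('n) - 1) * q"
        using n q_pos by simp
      finally show False using u by (simp add: algebra_simps)
    qed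
    then have "?s (mon (exp_div q u)) \<in> vanishing v j (k + 1)"
      by (simp add: vanishing_def shear_uminus_shear)
    then show "?s (mon (exp_div q u)) * contract \<phi> \<mu> (?s (Poly_Mapping.single (exp_mod q u) (?c u)))
        \<in> vanishing v j (k + 1)"
      by (metis mult.commute vanishing_mult_left)
  qed
  finally show ?thesis .
qed

end

text \<open>Expansion in the basis over the \<open>q\<close>-th powers; only finitely many
  remainders and basis elements occur. Hence \<open>g\<close> lies in the \<open>q\<close>-th
  Frobenius power of every ideal that contains its contractions.\<close>

lemma contract_decomposition:
  fixes g :: "('k, 'n) mpoly"
  obtains I :: "(('n \<Rightarrow>\<^sub>0 nat) \<times> 'k) set" and \<phi> where "finite I" "\<And>b. twisted (\<phi> b)"
    and "g = (\<Sum>(\<mu>, b)\<in>I. Poly_Mapping.single \<mu> b * contract (\<phi> b) \<mu> g ^ q)"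
proof -
  obtain \<phi> :: "'k \<Rightarrow> 'k \<Rightarrow> 'k" where tw: "\<And>b. twisted (\<phi> b)"
    and fin: "\<And>c. finite {b. \<phi> b c \<noteq> 0}"
    and repr: "\<And>B c. finite B \<Longrightarrow> {b. \<phi> b c \<noteq> 0} \<subseteq> B \<Longrightarrow> (\<Sum>b\<in>B. b * \<phi> b c ^ q) = c"
    using twisted_basis by blast
  let ?K = "Poly_Mapping.keys g" and ?c = "Poly_Mapping.lookup g"
  define M where "M = exp_mod q ` ?K"
  define B where "B = (\<Union>u\<in>?K. {b. \<phi> b (?c u) \<noteq> 0})"
  have finMB: "finite M" "finite B" using fin by (auto simp: M_def B_def)
  have "(\<Sum>\<mu>\<in>M. \<Sum>b\<in>B. Poly_Mapping.single \<mu> b * contract (\<phi> b) \<mu> g ^ q)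
      = (\<Sum>\<mu>\<in>M. \<Sum>b\<in>B. \<Sum>u\<in>?K. if exp_mod q u = \<mu> then Poly_Mapping.single u (b * \<phi> b (?c u) ^ q) else 0)"
  proof (intro sum.cong refl)
    fix \<mu> b
    have "contract (\<phi> b) \<mu> g ^ q = (\<Sum>u\<in>?K. if exp_mod q u = \<mu> then
        Poly_Mapping.single (exp_scale q (exp_div q u)) (\<phi> b (?c u) ^ q) else 0)"
      using q_pos by (auto simp: contract_def power_sum_q single_power power_0_left intro!: sum.cong)
    then show "Poly_Mapping.single \<mu> b * contract (\<phi> b) \<mu> g ^ q
        = (\<Sum>u\<in>?K. if exp_mod q u = \<mu> then Poly_Mapping.single u (b * \<phi> b (?c u) ^ q) else 0)"
      by (auto simp: sum_distrib_left mult_single exp_scale_div_add_mod add.commute[of "exp_mod _ _"]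
          intro!: sum.cong)
  qed
  also have "\<dots> = (\<Sum>u\<in>?K. \<Sum>\<mu>\<in>M. \<Sum>b\<in>B. if exp_mod q u = \<mu> then Poly_Mapping.single u (b * \<phi> b (?c u) ^ q) else 0)"
    by (subst sum.swap[of _ ?K B], subst sum.swap[of _ ?K M]) (rule refl)
  also have "\<dots> = (\<Sum>u\<in>?K. \<Sum>b\<in>B. Poly_Mapping.single u (b * \<phi> b (?c u) ^ q))"
  proof (intro sum.cong refl)
    fix u assume "u \<in> ?K"
    then have "exp_mod q u \<in> M" by (simp add: M_def)
    then show "(\<Sum>\<mu>\<in>M. \<Sum>b\<in>B. if exp_mod q u = \<mu> then Poly_Mapping.single u (b * \<phi> b (?c u) ^ q) else 0)
        = (\<Sum>b\<in>B. Poly_Mapping.single u (b * \<phi> b (?c u) ^ q))"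
      using finMB by (subst sum.swap) simp
  qed
  also have "\<dots> = (\<Sum>u\<in>?K. Poly_Mapping.single u (\<Sum>b\<in>B. b * \<phi> b (?c u) ^ q))"
    by (intro sum.cong refl poly_mapping_eqI) (simp add: lookup_sum lookup_single when_def)
  also have "\<dots> = (\<Sum>u\<in>?K. Poly_Mapping.single u (?c u))"
    using finMB by (intro sum.cong refl arg_cong[where f = "Poly_Mapping.single _"] repr) (auto simp: B_def)
  also have "\<dots> = g"
    by (rule poly_mapping_eq_sum_single[symmetric]) auto
  finally have "g = (\<Sum>(\<mu>, b)\<in>M \<times> B. Poly_Mapping.single \<mu> b * contract (\<phi> b) \<mu> g ^ q)"
    by (rule trans[OF sym sum.cartesian_product])
  with finite_cartesian_product[OF finMB] tw show ?thesis
    by (rule that)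
qed

end

subsection \<open>The containment in positive characteristic\<close>

text \<open>The bare set of \<open>m\<close>-fold products: it is finite when \<open>A\<close> is,
  so that finitely many conditions say that a functional kills it.\<close>

primrec products :: "'r::comm_ring_1 set \<Rightarrow> nat \<Rightarrow> 'r set" where
  "products A 0 = {1}"
| "products A (Suc m) = {a * b | a b. a \<in> A \<and> b \<in> products A m}"

definition vanishing_on :: "(('k ^ 'n) \<times> 'n) set \<Rightarrow> nat \<Rightarrow> ('k::comm_ring_1, 'n::finite) mpoly set" where
  "vanishing_on X M = (\<Inter>(v, j)\<in>X. vanishing v j M)"

lemma vanishing_onI: "(\<And>v j. (v, j) \<in> X \<Longrightarrow> f \<in> vanishing v j M) \<Longrightarrow> f \<in> vanishing_on X M"
  by (auto simp: vanishing_on_def)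

lemma vanishing_onD: "f \<in> vanishing_on X M \<Longrightarrow> (v, j) \<in> X \<Longrightarrow> f \<in> vanishing v j M"
  by (auto simp: vanishing_on_def)

context frobenius
begin

text \<open>Expanding one factor \<open>g\<close> releases one \<open>h i\<close> from the
  contraction; \<open>z\<close> collects these, and \<open>y\<close> stands for the contraction that
  remains at the end. Only sums are formed on the way, so \<open>W\<close> need not be an
  ideal.\<close>

lemma contract_power_in:
  fixes g :: "('k, 'n) mpoly"
  assumes I: "finite I" "g = (\<Sum>i\<in>I. s i * h i ^ q)" "\<And>i. i \<in> I \<Longrightarrow> h i \<in> J"
    and \<phi>: "twisted \<phi>" and W: "0 \<in> W" "\<And>a b. a \<in> W \<Longrightarrow> b \<in> W \<Longrightarrow> a + b \<in> W"
    and prods: "\<And>x y. x \<in> products J m \<Longrightarrow> z * x * y \<in> W"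
  shows "z * contract \<phi> \<mu> (g ^ m * r) \<in> W"
  using prods
proof (induction m arbitrary: z r)
  case 0
  from 0[of 1 "contract \<phi> \<mu> r"] show ?case by simp
next
  case (Suc m)
  have sum: "(\<And>i. i \<in> I \<Longrightarrow> f i \<in> W) \<Longrightarrow> sum f I \<in> W" for f
    using W by (induction I rule: infinite_finite_induct) auto
  have "g ^ Suc m * r = g * (g ^ m * r)"
    by (simp add: mult_ac)
  also have "\<dots> = (\<Sum>i\<in>I. s i * h i ^ q) * (g ^ m * r)"
    by (rule arg_cong[OF I(2)])
  also have "\<dots> = (\<Sum>i\<in>I. h i ^ q * (g ^ m * (s i * r)))"
    by (simp add: sum_distrib_right) (simp add: mult_ac)
  finally have "z * contract \<phi> \<mu> (g ^ Suc m * r) = (\<Sum>i\<in>I. (z * h i) * contract \<phi> \<mu> (g ^ m * (s i * r)))"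
    by (simp only: contract_sum[OF \<phi>] contract_power_mult[OF \<phi>] sum_distrib_left mult.assoc)
  also have "\<dots> \<in> W"
  proof (rule sum, rule Suc.IH)
    fix i x y assume "i \<in> I" "x \<in> products J m"
    then have "h i * x \<in> products J (Suc m)" using I(3) by auto
    from Suc.prems[OF this, of y] show "z * h i * x * y \<in> W" by (simp add: mult_ac)
  qed
  finally show ?case .
qed

end

text \<open>
  With \<open>q\<close> and \<open>Q \<ge> m\<close> powers of the characteristic, \<open>f ^ (Q + q)\<close> is a multiple of
  the \<open>m\<close>-th power of \<open>f ^ A\<close> with \<open>A = \<lceil>q / m\<rceil>\<close>, which lies in the Frobenius power of
  the ideal \<open>J\<close>. If \<open>q\<close> exceeds all exponents of \<open>f ^ Q\<close>, a suitable contraction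
  turns \<open>f ^ (Q + q)\<close> back into \<open>f\<close>.
\<close>

theorem vanishing_on_subset_products_positive_char:
  fixes f :: "('k::field, 'n::finite) mpoly"
  assumes CHAR_pos: "CHAR('k) > 0" and n: "CARD('n) > 1" and m: "m > 0"
    and f: "f \<in> vanishing_on X (m * (CARD('n) - 1 + k))"
    and W: "0 \<in> W" "\<And>a b. a \<in> W \<Longrightarrow> b \<in> W \<Longrightarrow> a + b \<in> W" "products (vanishing_on X (k + 1)) m \<subseteq> W"
  shows "f \<in> W"
proof (cases "f = 0")
  case True
  then show ?thesis using W(1) by simp
next
  case False
  let ?J = "vanishing_on X (k + 1)"
  have p: "CHAR('k) > 1"
    using CHAR_pos by (metis prime_CHAR_semidom prime_gt_1_nat)
  \<comment> \<open>\<open>Q\<close> is a power of the characteristic so that \<open>f ^ Q\<close>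
    is seen to be nonzero from one coefficient: distinct monomials of \<open>f\<close> give distinct
    monomials of \<open>f ^ Q\<close>, without cancellation.\<close>
  define Q where "Q = CHAR('k) ^ m"
  have Q: "m \<le> Q"
    unfolding Q_def using p by (simp add: less_imp_le power_gt_expt)
  interpret Q: frobenius Q m "TYPE('k)"
    by unfold_locales (simp_all add: Q_def CHAR_pos)
  obtain u where u: "u \<in> Poly_Mapping.keys f"
    using False by (metis in_keys_iff lookup_zero poly_mapping_eqI)
  define w where "w = exp_scale Q u"
  have inj: "exp_scale Q a = exp_scale Q b \<longleftrightarrow> a = b" for a b :: "'n \<Rightarrow>\<^sub>0 nat"
    using Q.q_pos by (auto simp: poly_mapping_eq_iff fun_eq_iff)
  have "Poly_Mapping.lookup (f ^ Q) w
      = (\<Sum>a\<in>Poly_Mapping.keys f. if a = u then Poly_Mapping.lookup f a ^ Q else 0)"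
    unfolding Q.mpoly_power_q w_def by (auto simp: lookup_sum lookup_single when_def inj intro!: sum.cong)
  also have "\<dots> = Poly_Mapping.lookup f u ^ Q"
    using u by simp
  finally have lookup_w: "Poly_Mapping.lookup (f ^ Q) w \<noteq> 0"
    using u by (simp add: in_keys_iff)
  obtain D where D: "\<And>a. a \<in> Poly_Mapping.keys (f ^ Q) \<Longrightarrow> total_degree a \<le> D"
    using total_degree_bound[of "f ^ Q"] by blast
  define q where "q = CHAR('k) ^ D"
  have Dq: "D < q"
    unfolding q_def using p by (simp add: power_gt_expt)
  interpret q: frobenius q D "TYPE('k)"
    by unfold_locales (simp_all add: q_def CHAR_pos)
  obtain \<psi> :: "'k \<Rightarrow> 'k \<Rightarrow> 'k" where tw: "\<And>b. q.twisted (\<psi> b)"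
    and fin: "\<And>c. finite {b. \<psi> b c \<noteq> 0}"
    and repr: "\<And>B c. finite B \<Longrightarrow> {b. \<psi> b c \<noteq> 0} \<subseteq> B \<Longrightarrow> (\<Sum>b\<in>B. b * \<psi> b c ^ q) = c"
    using q.twisted_basis by blast
  let ?c = "Poly_Mapping.lookup (f ^ Q) w"
  obtain b where b: "\<psi> b ?c \<noteq> 0"
    using repr[of "{}" ?c] lookup_w by auto
  \<comment> \<open>Rescaling keeps the functional twisted and makes the contraction of
    \<open>f ^ Q\<close> exactly 1.\<close>
  define \<phi> where "\<phi> x = \<psi> b x / \<psi> b ?c" for x
  have \<phi>: "q.twisted \<phi>"
    using tw[of b] unfolding q.twisted_def \<phi>_def by (simp add: add_divide_distrib)
  have small: "exp_mod q a = a" "exp_div q a = 0" if "a \<in> Poly_Mapping.keys (f ^ Q)" for a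
  proof -
    have "Poly_Mapping.lookup a i < q" for i
      using D[OF that] Dq member_le_sum[of i UNIV "Poly_Mapping.lookup a"]
      by (simp add: total_degree_def)
    then show "exp_mod q a = a" "exp_div q a = 0"
      by (auto intro!: poly_mapping_eqI)
  qed
  have "q.contract \<phi> w (f ^ Q)
      = (\<Sum>a\<in>Poly_Mapping.keys (f ^ Q). if a = w then scalar (\<phi> (Poly_Mapping.lookup (f ^ Q) a)) else 0)"
    unfolding q.contract_def by (intro sum.cong) (auto simp: small)
  also have "\<dots> = 1"
    using lookup_w b by (simp add: in_keys_iff \<phi>_def)
  finally have contract_Q: "q.contract \<phi> w (f ^ Q) = 1" .
  define A where "A = (q + m - 1) div m"
  have A: "q \<le> A * m" "A * m \<le> q + Q"
  proof -
    have "(q + m - 1) mod m \<le> m - 1"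
      using m by (metis Suc_pred' less_Suc_eq_le mod_less_divisor)
    moreover have "A * m + (q + m - 1) mod m = q + m - 1"
      unfolding A_def by simp
    ultimately show "q \<le> A * m" "A * m \<le> q + Q" using m Q by linarith+
  qed
  define r where "r = f ^ (q + Q - A * m)"
  have "(f ^ A) ^ m * r = f ^ q * f ^ Q"
    using A by (simp add: r_def flip: power_mult power_add)
  then have f_eq: "f = 1 * q.contract \<phi> w ((f ^ A) ^ m * r)"
    by (simp add: q.contract_power_mult[OF \<phi>] contract_Q)
  obtain I :: "(('n \<Rightarrow>\<^sub>0 nat) \<times> 'k) set" and \<theta> where I: "finite I" and \<theta>: "\<And>b. q.twisted (\<theta> b)"
    and decomp: "f ^ A = (\<Sum>(\<mu>, b)\<in>I. Poly_Mapping.single \<mu> b * q.contract (\<theta> b) \<mu> (f ^ A) ^ q)"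
    using q.contract_decomposition[of "f ^ A"] by blast
  have "f ^ A \<in> vanishing v j (q * (CARD('n) - 1 + k))" if "(v, j) \<in> X" for v j
  proof -
    have "q * (CARD('n) - 1 + k) \<le> A * (m * (CARD('n) - 1 + k))"
      using A(1) by (simp flip: mult.assoc)
    then show ?thesis
      using vanishing_power[OF vanishing_onD[OF f that], of A] vanishing_antimono by blast
  qed
  then have in_J: "q.contract (\<theta> b) \<mu> (f ^ A) \<in> ?J" for b \<mu>
    using q.contract_vanishing[OF \<theta> _ n] by (blast intro: vanishing_onI)
  show ?thesis
  proof (subst f_eq, rule q.contract_power_in[OF I decomp[unfolded case_prod_unfold] in_J \<phi> W(1,2)])
    fix x y assume "x \<in> products ?J m"
    moreover from m obtain m' where "m = Suc m'" by (cases m) auto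
    ultimately obtain a c where x: "x = a * c" "a \<in> ?J" "c \<in> products ?J m'" by auto
    \<comment> \<open>The leftover factor \<open>y\<close> is absorbed by the first of the
      \<open>m\<close> factors; this is where \<open>m > 0\<close> and the ideal property
      enter.\<close>
    have "y * a \<in> ?J"
      using x(2) by (auto simp: vanishing_on_def intro: vanishing_mult_left)
    then have "(y * a) * c \<in> products ?J m"
      using x(3) \<open>m = Suc m'\<close> by auto
    then show "1 * x * y \<in> W"
      using W(3) x(1) by (auto simp: mult_ac)
  qed
qed

subsection \<open>Finitely generated rings have residue fields of positive characteristic\<close>

abbreviation "coeffs_over A h \<equiv> (\<forall>i. poly.coeff h i \<in> A)"

lemma subring_coeffs_over:
  assumes A: "subring A"
  shows "subring {h. coeffs_over A h}"
  using A unfolding subring_def[of "{h. _ h}"]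
  by (auto simp: coeff_mult coeff_1 intro: subring_1 subring_0 subring_diff subring_mult intro!: subring_sum)

definition adjoin :: "'r::comm_ring_1 set \<Rightarrow> 'r \<Rightarrow> 'r set" where
  "adjoin A x = {poly h x | h. coeffs_over A h}"

lemma adjoinI: "coeffs_over A h \<Longrightarrow> poly h x \<in> adjoin A x"
  by (auto simp: adjoin_def)

lemma subring_adjoin:
  assumes A: "subring A"
  shows "subring (adjoin A x)"
proof -
  note H = subring_coeffs_over[OF A]
  have "1 \<in> adjoin A x"
    using adjoinI[of 1 A x] subring_1[OF H] by simp
  moreover have "a - b \<in> adjoin A x \<and> a * b \<in> adjoin A x" if "a \<in> adjoin A x" "b \<in> adjoin A x" for a b
  proof -
    from that obtain f g where "a = poly f x" "coeffs_over A f" "b = poly g x" "coeffs_over A g"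
      by (auto simp: adjoin_def)
    then show ?thesis
      using adjoinI[of "f - g" A x] adjoinI[of "f * g" A x] subring_diff[OF H, of f g] subring_mult[OF H, of f g]
      by simp
  qed
  ultimately show ?thesis by (simp add: subring_def)
qed

lemma adjoin_superset: "subring A \<Longrightarrow> insert x A \<subseteq> adjoin A x"
proof (intro insert_subsetI subsetI)
  assume A: "subring A"
  show "x \<in> adjoin A x"
    using adjoinI[of "[:0, 1:]" A x] subring_0[OF A] subring_1[OF A] by (auto simp: coeff_pCons split: nat.splits)
  show "a \<in> adjoin A x" if "a \<in> A" for a
    using adjoinI[of "[:a:]" A x] subring_0[OF A] that by (auto simp: coeff_pCons split: nat.splits)
qed

text \<open>Division with remainder without denominators: every cancellation of a leading term costs
  one factor \<open>lead_coeff r\<close>.\<close>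

lemma pseudo_division_over:
  fixes r g :: "'k::field poly"
  assumes A: "subring A" and r: "coeffs_over A r" "r \<noteq> 0" and g: "coeffs_over A g"
  shows "\<exists>l q s. coeffs_over A q \<and> coeffs_over A s \<and> smult (lead_coeff r ^ l) g = q * r + s \<and>
    (s = 0 \<or> degree s < degree r)"
  using g
\<comment> \<open>The measure places the zero polynomial below the nonzero constants, whose degree
  is 0 too.\<close>
proof (induction "if g = 0 then 0 else Suc (degree g)" arbitrary: g rule: less_induct)
  case less
  note H = subring_coeffs_over[OF A]
  show ?case
  proof (cases "g = 0 \<or> degree g < degree r")
    case True
    then show ?thesis
      using less.prems subring_0[OF H] by (intro exI[of _ 0] exI[of _ 0] exI[of _ g]) auto
  next
    case False
    let ?c = "lead_coeff r"
    let ?m = "monom (lead_coeff g) (degree g - degree r)"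
    define g' where "g' = smult ?c g - ?m * r"
    have m: "coeffs_over A ?m"
      using less.prems subring_0[OF A] by (auto simp: coeff_monom)
    have g': "coeffs_over A g'"
      using subring_diff[OF H, of "smult ?c g" "?m * r"] subring_mult[OF H, of ?m r] m r less.prems A
      by (simp add: g'_def subring_mult)
    have "degree (?m * r) \<le> degree g"
      using False degree_mult_le[of ?m r] degree_monom_le[of "lead_coeff g" "degree g - degree r"] by linarith
    then have "degree g' \<le> degree g"
      unfolding g'_def by (intro degree_diff_le) simp_all
    moreover have "poly.coeff g' (degree g) = 0"
      using False by (simp add: g'_def coeff_monom_mult)
    ultimately have "g' = 0 \<or> degree g' < degree g"
      by (metis leading_coeff_0_iff le_neq_implies_less)
    then have "\<exists>l q s. coeffs_over A q \<and> coeffs_over A s \<and> smult (?c ^ l) g' = q * r + s \<and>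
        (s = 0 \<or> degree s < degree r)"
      by (intro less.hyps g') (use False in auto)
    then obtain l q s where qs: "coeffs_over A q" "coeffs_over A s" "smult (?c ^ l) g' = q * r + s"
      "s = 0 \<or> degree s < degree r"
      by blast
    have cl: "?c ^ l \<in> A"
      using r A by (intro subring_power) auto
    have "smult (?c ^ Suc l) g = smult (?c ^ l) g' + smult (?c ^ l) ?m * r"
      by (simp add: g'_def smult_diff_right mult.commute)
    also have "\<dots> = (q + smult (?c ^ l) ?m) * r + s"
      using qs(3) by (simp add: algebra_simps)
    finally have "smult (?c ^ Suc l) g = (q + smult (?c ^ l) ?m) * r + s" .
    moreover have "coeffs_over A (q + smult (?c ^ l) ?m)"
    proof -
      have "coeffs_over A (smult (?c ^ l) ?m)"
        using subring_mult[OF A cl] m by (metis coeff_smult)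
      then show ?thesis
        using subring_add[OF H, of q "smult (?c ^ l) ?m"] qs(1) by blast
    qed
    ultimately show ?thesis using qs by blast
  qed
qed

text \<open>For nonzero \<open>b\<close>, the primes that become invertible in A[1/b]. For
  \<open>b = 1\<close> they are the primes invertible in \<open>A\<close>.\<close>

definition bad_primes :: "'k::field_char_0 set \<Rightarrow> 'k \<Rightarrow> nat set" where
  "bad_primes A b = {p. prime p \<and> (\<exists>k. \<exists>y\<in>A. b ^ k = of_nat p * y)}"

text \<open>Elements of A[x] determine their polynomials, so a relation
  \<open>b ^ k = of_nat p * y\<close> is one between polynomials. Its leading coefficients give a
  relation of the same kind in \<open>A\<close>, with \<open>a\<close> the leading coefficient of
  \<open>b\<close>.\<close>

lemma bad_primes_adjoin_transcendental:
  assumes A: "subring A" and b: "b \<in> adjoin A x" "b \<noteq> 0"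
    and x: "\<And>h. coeffs_over A h \<Longrightarrow> poly h x = 0 \<Longrightarrow> h = 0"
  shows "\<exists>a\<in>A. a \<noteq> 0 \<and> bad_primes (adjoin A x) b \<subseteq> bad_primes A a"
proof -
  note H = subring_coeffs_over[OF A]
  obtain h where h: "b = poly h x" "coeffs_over A h"
    using b(1) by (auto simp: adjoin_def)
  have "bad_primes (adjoin A x) b \<subseteq> bad_primes A (lead_coeff h)"
  proof
    fix p assume "p \<in> bad_primes (adjoin A x) b"
    then obtain k g where p: "prime p" and g: "coeffs_over A g" "b ^ k = of_nat p * poly g x"
      by (auto simp: bad_primes_def adjoin_def)
    have "of_nat p \<in> A"
      using A by (induction p) (auto intro: subring_0 subring_1 subring_add)
    then have "coeffs_over A (smult (of_nat p) g)"
      using g A by (auto intro: subring_mult)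
    then have "coeffs_over A (h ^ k - smult (of_nat p) g)"
      using subring_diff[OF H, of "h ^ k" "smult (of_nat p) g"] subring_power[OF H, of h k] h(2) by simp
    moreover have "poly (h ^ k - smult (of_nat p) g) x = 0"
      using g h by simp
    ultimately have "h ^ k = smult (of_nat p) g"
      using x by fastforce
    then have "lead_coeff h ^ k = of_nat p * poly.coeff g (degree (h ^ k))"
      by (metis coeff_smult lead_coeff_power)
    then show "p \<in> bad_primes A (lead_coeff h)"
      using p g by (auto simp: bad_primes_def)
  qed
  moreover have "lead_coeff h \<in> A" "lead_coeff h \<noteq> 0"
    using h b by auto
  ultimately show ?thesis by blast
qed

text \<open>
  If \<open>x\<close> is a root of \<open>\<mu>\<close> of minimal degree \<open>d\<close>, then \<open>1, x, \<dots>, x ^ (d - 1)\<close> is a basis of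
  \<open>A[x]\<close> over \<open>A\<close> once the leading coefficient \<open>c\<close> of \<open>\<mu>\<close> is inverted. A nonzero multiple \<open>e\<close> of
  \<open>b\<close> in \<open>A\<close> is found as a multiple of minimal degree in \<open>x\<close>, and one takes \<open>a = c e\<close>.
\<close>

lemma bad_primes_adjoin_algebraic:
  assumes A: "subring A" and b: "b \<in> adjoin A x" "b \<noteq> 0"
    and h: "coeffs_over A h" "poly h x = 0" "h \<noteq> 0"
  shows "\<exists>a\<in>A. a \<noteq> 0 \<and> bad_primes (adjoin A x) b \<subseteq> bad_primes A a"
proof -
  note H = subring_coeffs_over[OF A] and B = subring_adjoin[OF A, of x]
  let ?R = "\<lambda>h. coeffs_over A h \<and> poly h x = 0 \<and> h \<noteq> 0"
  obtain \<mu> where \<mu>: "?R \<mu>" and min: "\<And>g. ?R g \<Longrightarrow> degree \<mu> \<le> degree g"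
    using ex_has_least_nat[of ?R h degree] h by blast
  define c where "c = lead_coeff \<mu>"
  have c: "c \<in> A" "c \<noteq> 0" using \<mu> by (auto simp: c_def)
  have deg_\<mu>: "degree \<mu> > 0"
    using \<mu> by (cases "degree \<mu> = 0") (auto elim!: degree_eq_zeroE)
  have reduce: "\<exists>l r. coeffs_over A r \<and> c ^ l * poly g x = poly r x \<and> degree r < degree \<mu>"
    if g: "coeffs_over A g" for g
  proof -
    obtain l q s where "coeffs_over A s" "smult (c ^ l) g = q * \<mu> + s" "s = 0 \<or> degree s < degree \<mu>"
      using pseudo_division_over[OF A _ _ g, of \<mu>] \<mu> unfolding c_def by blast
    moreover from this have "c ^ l * poly g x = poly s x"
      using \<mu> by (metis add_cancel_left_left mult_zero_right poly_add poly_mult poly_smult)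
    moreover from calculation have "degree s < degree \<mu>" using deg_\<mu> by auto
    ultimately show ?thesis by blast
  qed
  \<comment> \<open>Polynomials over \<open>A\<close> whose value at \<open>x\<close> is a nonzero
    multiple of \<open>b\<close>; one of minimal degree will turn out to be constant.\<close>
  let ?M = "\<lambda>r. coeffs_over A r \<and> poly r x \<noteq> 0 \<and> (\<exists>z\<in>adjoin A x. poly r x = b * z)"
  obtain r0 where "coeffs_over A r0" "poly r0 x = b" using b(1) by (auto simp: adjoin_def)
  then have "?M r0" using b(2) subring_1[OF B] by (auto intro!: bexI[of _ 1])
  then obtain r where r: "?M r" and min_r: "\<And>g. ?M g \<Longrightarrow> degree r \<le> degree g"
    using ex_has_least_nat[of ?M r0 degree] by blast
  have deg_r: "degree r < degree \<mu>"
  proof -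
    obtain l s where s: "coeffs_over A s" "c ^ l * poly r x = poly s x" "degree s < degree \<mu>"
      using reduce r by blast
    obtain z where z: "z \<in> adjoin A x" "poly r x = b * z" using r by blast
    have "c ^ l * z \<in> adjoin A x"
      using adjoin_superset[OF A, of x] c(1) z(1) by (intro subring_mult[OF B] subring_power[OF B]) auto
    then have "?M s"
      using s z r c(2) by (auto intro!: bexI[of _ "c ^ l * z"] simp: mult_ac simp flip: s(2))
    then show ?thesis using min_r s(3) by fastforce
  qed
  \<comment> \<open>Otherwise divide \<open>\<mu>\<close> by \<open>r\<close>. At \<open>x\<close>
    the remainder equals minus \<open>poly q x * poly r x\<close>, a multiple of \<open>b\<close>
    that is nonzero because \<open>q\<close> has smaller degree than \<open>\<mu>\<close>; so the
    remainder contradicts the choice of \<open>r\<close>.\<close>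
  have "degree r = 0"
  proof (rule ccontr)
    assume "degree r \<noteq> 0"
    have "r \<noteq> 0" using r by auto
    obtain l q s where qs: "coeffs_over A q" "coeffs_over A s" "smult (lead_coeff r ^ l) \<mu> = q * r + s"
      "s = 0 \<or> degree s < degree r"
      using pseudo_division_over[OF A conjunct1[OF r] \<open>r \<noteq> 0\<close> conjunct1[OF \<mu>]] by blast
    have lr: "lead_coeff r ^ l \<noteq> 0" using r by auto
    then have deg_eq: "degree (q * r + s) = degree \<mu>"
      by (metis qs(3) degree_smult_eq)
    have "q \<noteq> 0"
      using deg_eq deg_r qs(4) deg_\<mu> by auto
    have "degree (q * r) = degree \<mu>"
    proof (rule ccontr)
      assume neq: "degree (q * r) \<noteq> degree \<mu>"
      have "degree (q * r) \<ge> degree r"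
        using \<open>q \<noteq> 0\<close> \<open>r \<noteq> 0\<close> by (simp add: degree_mult_eq)
      then have "degree (q * r + s) = degree (q * r)"
        using qs(4) by (auto intro: degree_add_eq_left)
      with neq deg_eq show False by simp
    qed
    then have "degree q < degree \<mu>"
      using \<open>q \<noteq> 0\<close> \<open>r \<noteq> 0\<close> \<open>degree r \<noteq> 0\<close> by (simp add: degree_mult_eq)
    then have qx: "poly q x \<noteq> 0"
      using min[of q] qs(1) \<open>q \<noteq> 0\<close> by force
    have "poly (q * r + s) x = 0"
      using \<mu> by (metis qs(3) mult_zero_right poly_smult)
    then have sx: "poly s x = - (poly q x * poly r x)"
      by (simp add: eq_neg_iff_add_eq_0 add.commute)
    then have "poly s x \<noteq> 0" using qx r by simp
    obtain z where z: "z \<in> adjoin A x" "poly r x = b * z" using r by blast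
    have "- (poly q x * z) \<in> adjoin A x"
      using adjoinI[OF qs(1)] z(1) by (intro subring_uminus[OF B] subring_mult[OF B])
    then have "?M s"
      using qs(2) \<open>poly s x \<noteq> 0\<close> sx z(2) by (auto intro!: bexI[of _ "- (poly q x * z)"])
    then have "degree r \<le> degree s" by (rule min_r)
    moreover have "s \<noteq> 0" using \<open>poly s x \<noteq> 0\<close> by auto
    ultimately show False using qs(4) by simp
  qed
  then obtain e where e: "r = [:e:]" by (auto elim: degree_eq_zeroE)
  have e_A: "e \<in> A" "e \<noteq> 0" using r by (auto simp: e dest: spec[of _ 0])
  obtain z where z: "z \<in> adjoin A x" "e = b * z" using r e by auto
  have "bad_primes (adjoin A x) b \<subseteq> bad_primes A (c * e)"
  proof
    fix p assume "p \<in> bad_primes (adjoin A x) b"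
    then obtain k y where p: "prime p" and y: "y \<in> adjoin A x" "b ^ k = of_nat p * y"
      by (auto simp: bad_primes_def)
    have "y * z ^ k \<in> adjoin A x"
      using y z by (intro subring_mult[OF B] subring_power[OF B])
    then obtain g where g: "coeffs_over A g" "y * z ^ k = poly g x"
      by (auto simp: adjoin_def)
    obtain l s where s: "coeffs_over A s" "c ^ l * poly g x = poly s x" "degree s < degree \<mu>"
      using reduce[OF g(1)] by blast
    \<comment> \<open>Both sides are values at \<open>x\<close> of polynomials of degree below that
      of \<open>\<mu>\<close>, which therefore coincide; their constant coefficients give a relation
      in \<open>A\<close>.\<close>
    have "c ^ l * e ^ k = of_nat p * poly s x"
      using y(2) g(2) by (simp add: z(2) power_mult_distrib mult_ac flip: s(2))
    then have "poly ([:c ^ l * e ^ k:] - smult (of_nat p) s) x = 0"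
      by simp
    moreover have "coeffs_over A ([:c ^ l * e ^ k:] - smult (of_nat p) s)"
    proof -
      have "of_nat p \<in> A"
        using A by (induction p) (auto intro: subring_0 subring_1 subring_add)
      then have "coeffs_over A (smult (of_nat p) s)"
        using s A by (auto intro: subring_mult)
      moreover have "c ^ l * e ^ k \<in> A"
        using c e_A A by (intro subring_mult subring_power)
      then have "coeffs_over A [:c ^ l * e ^ k:]"
        using subring_0[OF A] by (auto simp: coeff_pCons split: nat.splits)
      ultimately show ?thesis
        using subring_diff[OF H, of "[:c ^ l * e ^ k:]" "smult (of_nat p) s"] by simp
    qed
    moreover have "degree ([:c ^ l * e ^ k:] - smult (of_nat p) s) < degree \<mu>"
      using s(3) deg_\<mu> by (intro degree_diff_less) simp_all
    ultimately have "[:c ^ l * e ^ k:] - smult (of_nat p) s = 0"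
      using min[of "[:c ^ l * e ^ k:] - smult (of_nat p) s"] by fastforce
    then have "poly.coeff ([:c ^ l * e ^ k:] - smult (of_nat p) s) 0 = 0" by simp
    then have eq: "c ^ l * e ^ k = of_nat p * poly.coeff s 0" by simp
    \<comment> \<open>Multiplying by \<open>c ^ k * e ^ l\<close> makes both exponents equal to
      \<open>l + k\<close>.\<close>
    have "(c * e) ^ (l + k) = of_nat p * (c ^ k * e ^ l * poly.coeff s 0)"
      using eq by (simp add: power_mult_distrib power_add mult_ac)
    moreover have "c ^ k * e ^ l * poly.coeff s 0 \<in> A"
      using c e_A s(1) A by (intro subring_mult subring_power) auto
    ultimately show "p \<in> bad_primes A (c * e)"
      using p unfolding bad_primes_def by blast
  qed
  then show ?thesis
    using c e_A A by (intro bexI[of _ "c * e"]) (auto intro: subring_mult)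
qed

text \<open>Only \<open>b = 1\<close> is needed in the end, but adjoining an element trades
  \<open>b\<close> for another nonzero \<open>a\<close> in the smaller ring, so the induction has to
  cover all nonzero elements. It starts from the integers, where the bad primes are prime
  divisors.\<close>

lemma subring_with_finite_bad_primes:
  fixes S :: "'k::field_char_0 set"
  assumes "finite S"
  shows "\<exists>A. subring A \<and> S \<subseteq> A \<and> (\<forall>b\<in>A. b \<noteq> 0 \<longrightarrow> finite (bad_primes A b))"
  using assms
proof (induction S)
  case empty
  have "finite (bad_primes \<int> b)" if b: "b \<in> \<int>" "b \<noteq> (0 :: 'k)" for b
  proof -
    from b(1) obtain z where z: "b = of_int z" by (rule Ints_cases)
    have "bad_primes \<int> b \<subseteq> {..nat \<bar>z\<bar>}"
    proof
      fix p assume "p \<in> bad_primes \<int> b"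
      then obtain k y where p: "prime p" and "(of_int z :: 'k) ^ k = of_nat p * of_int y"
        by (auto simp: bad_primes_def z elim!: Ints_cases)
      then have "(of_int (z ^ k) :: 'k) = of_int (int p * y)" by simp
      then have "z ^ k = int p * y" by (simp only: of_int_eq_iff)
      then have "int p dvd z ^ k" by simp
      moreover have "prime (int p)" using p by simp
      ultimately have "int p dvd z" using prime_dvd_power by blast
      then have "int p \<le> \<bar>z\<bar>" using b z dvd_imp_le_int[of z "int p"] by auto
      then show "p \<in> {..nat \<bar>z\<bar>}" by simp
    qed
    then show ?thesis by (rule finite_subset) simp
  qed
  moreover have "subring (\<int> :: 'k set)" by (simp add: subring_def)
  ultimately show ?case
    by (intro exI[of _ \<int>] conjI ballI impI) simp_all
next
  case (insert x S)
  from insert.IH obtain A where A: "subring A" "S \<subseteq> A"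
    and fin: "\<forall>b\<in>A. b \<noteq> 0 \<longrightarrow> finite (bad_primes A b)"
    by (elim exE conjE)
  have "finite (bad_primes (adjoin A x) b)" if "b \<in> adjoin A x" "b \<noteq> 0" for b
  proof -
    have "\<exists>a\<in>A. a \<noteq> 0 \<and> bad_primes (adjoin A x) b \<subseteq> bad_primes A a"
    proof (cases "\<exists>h. coeffs_over A h \<and> poly h x = 0 \<and> h \<noteq> 0")
      case True
      then show ?thesis using bad_primes_adjoin_algebraic[OF A(1) that] by metis
    next
      case False
      then show ?thesis by (intro bad_primes_adjoin_transcendental[OF A(1) that]) metis
    qed
    then show ?thesis using fin by (auto intro: finite_subset)
  qed
  moreover have "insert x S \<subseteq> adjoin A x"
    using adjoin_superset[OF A(1), of x] A(2) by blast
  ultimately show ?case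
    using subring_adjoin[OF A(1), of x] by (intro exI[of _ "adjoin A x"]) auto
qed

text \<open>Maximality is expressed by inverses modulo \<open>m\<close>, the form in which the
  residue field uses it.\<close>

definition maximal_ideal_of :: "'r::comm_ring_1 set \<Rightarrow> 'r set \<Rightarrow> bool" where
  "maximal_ideal_of A m \<longleftrightarrow> subring A \<and> m \<subseteq> A \<and> 0 \<in> m \<and> 1 \<notin> m \<and>
     (\<forall>a\<in>m. \<forall>b\<in>m. a + b \<in> m) \<and> (\<forall>a\<in>m. \<forall>r\<in>A. r * a \<in> m) \<and>
     (\<forall>a\<in>A - m. \<exists>b\<in>A. a * b - 1 \<in> m)"

lemma exists_maximal_ideal_of:
  assumes A: "subring A" and x: "x \<in> A" "\<And>y. y \<in> A \<Longrightarrow> x * y \<noteq> 1"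
  shows "\<exists>m. maximal_ideal_of A m \<and> x \<in> m"
proof -
  define ideal where "ideal I \<longleftrightarrow> I \<subseteq> A \<and> 0 \<in> I \<and> 1 \<notin> I \<and>
     (\<forall>a\<in>I. \<forall>b\<in>I. a + b \<in> I) \<and> (\<forall>a\<in>I. \<forall>r\<in>A. r * a \<in> I)" for I
  let ?F = "{I. ideal I \<and> x \<in> I}"
  note closed = subring_0[OF A] subring_1[OF A] subring_add[OF A] subring_mult[OF A]
  \<comment> \<open>Used twice: with \<open>{0}\<close> and \<open>x\<close> for the principal ideal
    that starts Zorn's lemma, and with the maximal element and some \<open>a\<close> outside
    it.\<close>
  have ideal_sum: "ideal {u + a * s | u s. u \<in> I \<and> s \<in> A}"
    if I: "ideal I \<or> I = {0}" and a: "a \<in> A" and not1: "\<And>u s. u \<in> I \<Longrightarrow> s \<in> A \<Longrightarrow> u + a * s \<noteq> 1" for I a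
    unfolding ideal_def
  proof (intro conjI ballI)
    have I0: "I \<subseteq> A" "0 \<in> I" "\<And>u v. u \<in> I \<Longrightarrow> v \<in> I \<Longrightarrow> u + v \<in> I" "\<And>u r. u \<in> I \<Longrightarrow> r \<in> A \<Longrightarrow> r * u \<in> I"
      using I closed by (auto simp: ideal_def)
    show "{u + a * s | u s. u \<in> I \<and> s \<in> A} \<subseteq> A"
      using I0(1) a by (auto intro!: closed)
    show "0 \<in> {u + a * s | u s. u \<in> I \<and> s \<in> A}"
      using I0(2) closed(1) by (intro CollectI exI[of _ 0]) simp
    show "1 \<notin> {u + a * s | u s. u \<in> I \<and> s \<in> A}" using not1 by force
    fix b assume "b \<in> {u + a * s | u s. u \<in> I \<and> s \<in> A}"
    then obtain u s where b: "b = u + a * s" "u \<in> I" "s \<in> A" by blast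
    show "b + b' \<in> {u + a * s | u s. u \<in> I \<and> s \<in> A}" if "b' \<in> {u + a * s | u s. u \<in> I \<and> s \<in> A}" for b'
    proof -
      from that obtain u' s' where b': "b' = u' + a * s'" "u' \<in> I" "s' \<in> A" by blast
      have "b + b' = (u + u') + a * (s + s')" by (simp add: b b' algebra_simps)
      moreover have "u + u' \<in> I" "s + s' \<in> A"
        using b b' I0(3) closed(3) by auto
      ultimately show ?thesis by blast
    qed
    show "r * b \<in> {u + a * s | u s. u \<in> I \<and> s \<in> A}" if "r \<in> A" for r
    proof -
      have "r * b = r * u + a * (r * s)" by (simp add: b algebra_simps)
      moreover have "r * u \<in> I" "r * s \<in> A"
        using b that I0(4) closed(4) by auto
      ultimately show ?thesis by blast
    qed
  qed
  have "{0 + x * s | s. s \<in> A} \<in> ?F"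
    using ideal_sum[of "{0}" x] x closed by force
  then have ne: "?F \<noteq> {}" by blast
  have "\<Union> C \<in> ?F" if C: "C \<noteq> {}" "subset.chain ?F C" for C
  proof -
    have mem: "\<And>I. I \<in> C \<Longrightarrow> ideal I \<and> x \<in> I"
      and total: "\<And>I K. I \<in> C \<Longrightarrow> K \<in> C \<Longrightarrow> I \<subseteq> K \<or> K \<subseteq> I"
      using C(2) by (auto simp: subset.chain_def)
    have add: "a + b \<in> \<Union> C" if "a \<in> \<Union> C" "b \<in> \<Union> C" for a b
    proof -
      from that obtain I K where "I \<in> C" "K \<in> C" "a \<in> I" "b \<in> K" by blast
      with total[of I K] obtain L where "L \<in> C" "a \<in> L" "b \<in> L" by blast
      then show ?thesis using mem[of L] by (auto simp: ideal_def)
    qed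
    show "\<Union> C \<in> ?F"
      using mem C(1) add unfolding mem_Collect_eq ideal_def by blast
  qed
  with ne have "\<exists>m\<in>?F. \<forall>I\<in>?F. m \<subseteq> I \<longrightarrow> I = m"
    by (rule subset_Zorn_nonempty)
  then obtain m where m: "ideal m" "x \<in> m" and max: "\<forall>I. ideal I \<longrightarrow> x \<in> I \<longrightarrow> m \<subseteq> I \<longrightarrow> I = m"
    by auto
  have "\<exists>b\<in>A. a * b - 1 \<in> m" if a: "a \<in> A - m" for a
  proof (rule ccontr)
    assume no: "\<not> ?thesis"
    let ?I = "{u + a * s | u s. u \<in> m \<and> s \<in> A}"
    have neg: "- u \<in> m" if "u \<in> m" for u
      using that m(1) subring_uminus[OF A] closed(2) by (metis ideal_def minus_mult_left mult_1)
    have "u + a * s \<noteq> 1" if "u \<in> m" "s \<in> A" for u s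
    proof
      assume "u + a * s = 1"
      then have "a * s - 1 = - u" by (simp add: algebra_simps)
      then show False using no neg that by metis
    qed
    then have "ideal ?I" using ideal_sum[of m a] m(1) a by blast
    moreover have sub: "m \<subseteq> ?I"
    proof
      fix u assume "u \<in> m"
      then show "u \<in> ?I" using closed(1) by (intro CollectI exI[of _ u] exI[of _ 0]) simp
    qed
    ultimately have "?I = m" using max m(2) by blast
    moreover have "a \<in> ?I"
      using m(1) closed(2) by (intro CollectI exI[of _ 0] exI[of _ 1]) (simp add: ideal_def)
    ultimately show False using a by blast
  qed
  then have "maximal_ideal_of A m"
    using m(1) A by (simp add: maximal_ideal_of_def ideal_def)
  then show ?thesis using m(2) by blast
qed

lemma exists_residue_field_positive_char:
  fixes S :: "'k::field_char_0 set"
  assumes "finite S"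
  shows "\<exists>A m p. S \<subseteq> A \<and> maximal_ideal_of A m \<and> p > 0 \<and> of_nat p \<in> m"
proof -
  obtain A where A: "subring A" "S \<subseteq> A" and fin: "\<forall>b\<in>A. b \<noteq> 0 \<longrightarrow> finite (bad_primes A b)"
    using subring_with_finite_bad_primes[OF assms] by (elim exE conjE)
  have "finite (bad_primes A 1)" using fin subring_1[OF A(1)] by simp
  then have "\<not> {p :: nat. prime p} \<subseteq> bad_primes A 1"
    using primes_infinite finite_subset by blast
  then obtain p :: nat where p: "prime p" "p \<notin> bad_primes A 1" by blast
  have "of_nat p \<in> A"
    using A(1) by (induction p) (auto intro: subring_0 subring_1 subring_add)
  moreover have "of_nat p * y \<noteq> 1" if "y \<in> A" for y
    using p that by (auto simp: bad_primes_def)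
  ultimately obtain m where "maximal_ideal_of A m" "of_nat p \<in> m"
    using exists_maximal_ideal_of[OF A(1), of "of_nat p"] by blast
  then show ?thesis using A(2) p(1) prime_gt_0_nat by blast
qed

subsection \<open>Reduction modulo a prime\<close>

text \<open>A linear functional given by its values on monomials, so that it can be reduced by
  applying the residue map to these values.\<close>

definition pairing :: "(('n \<Rightarrow>\<^sub>0 nat) \<Rightarrow> 'k) \<Rightarrow> ('k::comm_ring_1, 'n) mpoly \<Rightarrow> 'k" where
  "pairing l f = (\<Sum>u\<in>Poly_Mapping.keys f. Poly_Mapping.lookup f u * l u)"

lemma pairing_superset:
  "finite T \<Longrightarrow> Poly_Mapping.keys f \<subseteq> T \<Longrightarrow> pairing l f = (\<Sum>u\<in>T. Poly_Mapping.lookup f u * l u)"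
  unfolding pairing_def
  by (intro sum.mono_neutral_left) (auto simp: not_in_keys_iff_lookup_eq_zero)

lemma pairing_add: "pairing l (f + g) = pairing l f + pairing l g"
proof -
  let ?T = "Poly_Mapping.keys f \<union> Poly_Mapping.keys g"
  have "finite ?T" "Poly_Mapping.keys (f + g) \<subseteq> ?T"
    using keys_add[of f g] by auto
  then show ?thesis
    by (subst (1 2 3) pairing_superset[of ?T]) (auto simp: lookup_add algebra_simps sum.distrib)
qed

lemma pairing_scalar_mult: "pairing l (scalar c * f) = c * pairing l f"
proof -
  have "Poly_Mapping.keys (scalar c * f) \<subseteq> Poly_Mapping.keys f"
    by (auto simp: in_keys_iff)
  then have "pairing l (scalar c * f) = (\<Sum>u\<in>Poly_Mapping.keys f. c * Poly_Mapping.lookup f u * l u)"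
    by (subst pairing_superset[of "Poly_Mapping.keys f"]) auto
  then show ?thesis by (simp add: pairing_def sum_distrib_left mult.assoc)
qed

abbreviation mpoly_scale :: "'k::field \<Rightarrow> ('k, 'n) mpoly \<Rightarrow> ('k, 'n) mpoly" where
  "mpoly_scale c f \<equiv> scalar c * f"

lemma vector_space_mpoly: "vector_space (mpoly_scale :: 'k::field \<Rightarrow> ('k, 'n) mpoly \<Rightarrow> _)"
  by unfold_locales (auto simp: algebra_simps single_add mult_single mult.assoc[symmetric])

text \<open>Spans over the field rather than ideals, because a linear functional can witness
  non-membership.\<close>

abbreviation linear_span :: "('k::field, 'n) mpoly set \<Rightarrow> ('k, 'n) mpoly set" where
  "linear_span \<equiv> module.span mpoly_scale"

lemma linear_span_mult:
  fixes a b :: "('k::field, 'n) mpoly"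
  assumes "a \<in> linear_span A" "b \<in> linear_span B"
  shows "a * b \<in> linear_span {x * y | x y. x \<in> A \<and> y \<in> B}"
proof -
  interpret vector_space "mpoly_scale :: 'k \<Rightarrow> ('k, 'n) mpoly \<Rightarrow> _"
    by (rule vector_space_mpoly)
  let ?C = "{x * y | x y. x \<in> A \<and> y \<in> B}"
  have one: "x * b \<in> span ?C" if "x \<in> A" for x
    using assms(2)
  proof (induction rule: span_induct_alt)
    case base
    show ?case by (simp add: span_zero)
  next
    case (step c y z)
    have "x * y \<in> span ?C" using step that by (intro span_base) blast
    then have "scalar c * (x * y) + x * z \<in> span ?C"
      using step by (intro span_add span_scale)
    then show ?case by (simp add: algebra_simps)
  qed
  show ?thesis
    using assms(1)
  proof (induction rule: span_induct_alt)
    case base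
    show ?case by (simp add: span_zero)
  next
    case (step c x z)
    then have "scalar c * (x * b) + z * b \<in> span ?C"
      using one by (intro span_add span_scale)
    then show ?case by (simp add: algebra_simps)
  qed
qed

text \<open>
  If \<open>f\<close> vanishes to order \<open>m (N + k)\<close> but is not in the span of the products of \<open>m\<close> polynomials
  vanishing to order \<open>k + 1\<close>, then this is witnessed by finitely many elements of the field.
  The polynomials \<open>G u\<close> and \<open>H\<close> witness that the \<open>G u\<close> span, also after
  reduction, all polynomials of degree at most \<open>D\<close> that vanish to order \<open>k + 1\<close>, and the functional
  \<open>l\<close> separates \<open>f\<close> from the products of \<open>m\<close> of the \<open>G u\<close>.
\<close>

definition counterexample_over ::
    "'k set \<Rightarrow> (('k::field ^ 'n::finite) \<times> 'n) set \<Rightarrow> nat \<Rightarrow> nat \<Rightarrow> nat \<Rightarrow> ('k, 'n) mpoly \<Rightarrow>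
     (('n \<Rightarrow>\<^sub>0 nat) \<Rightarrow> ('k, 'n) mpoly) \<Rightarrow> ('k ^ 'n \<Rightarrow> 'n \<Rightarrow> ('n \<Rightarrow>\<^sub>0 nat) \<Rightarrow> ('k, 'n) mpoly) \<Rightarrow>
     (('n \<Rightarrow>\<^sub>0 nat) \<Rightarrow> 'k) \<Rightarrow> bool" where
  "counterexample_over A X k m D f G H l \<longleftrightarrow>
     finite X \<and> m > 0 \<and> CARD('n) > 1 \<and>
     (\<forall>(v, j)\<in>X. \<forall>i. v $ i \<in> A) \<and> coeffs_in A f \<and> (\<forall>u. total_degree u \<le> D \<longrightarrow> coeffs_in A (G u)) \<and>
     (\<forall>(v, j)\<in>X. \<forall>w. total_degree w \<le> D \<longrightarrow> coeffs_in A (H v j w)) \<and> (\<forall>u. l u \<in> A) \<and>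
     f \<in> vanishing_on X (m * (CARD('n) - 1 + k)) \<and>
     (\<forall>u\<in>Poly_Mapping.keys f. total_degree u \<le> D) \<and>
     (\<forall>u. total_degree u \<le> D \<longrightarrow> G u \<in> vanishing_on X (k + 1)) \<and>
     (\<forall>u. total_degree u \<le> D \<longrightarrow> mon u = G u + (\<Sum>(v, j)\<in>X. \<Sum>w | total_degree w \<le> D \<and> codegree j w \<le> k.
        scalar (Poly_Mapping.lookup (shear v j (mon u)) w) * H v j w)) \<and>
     (\<forall>x\<in>products (G ` {u. total_degree u \<le> D}) m. pairing l x = 0) \<and> pairing l f = 1"

definition has_counterexample :: "('k::field \<times> 'n::finite) itself \<Rightarrow> 'k set \<Rightarrow> bool" where
  "has_counterexample T A \<longleftrightarrow>
     (\<exists>X k m D f G H l. counterexample_over A (X :: (('k ^ 'n) \<times> 'n) set) k m D f G H l)"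

lemma has_counterexample_mono:
  assumes "has_counterexample T A" "A \<subseteq> B"
  shows "has_counterexample T B"
proof -
  obtain X :: "(('a ^ 'b) \<times> 'b) set" and k m D f G H l where "counterexample_over A X k m D f G H l"
    using assms(1) unfolding has_counterexample_def by (elim exE)
  then have "counterexample_over B X k m D f G H l"
    using assms(2) unfolding counterexample_over_def by (fast dest: subsetD)
  then show ?thesis
    unfolding has_counterexample_def by (intro exI)
qed

text \<open>
  The residue field has to be a type, so the ring and the maximal ideal are constants that
  depend on the types of the coefficients and of the indices only. They are chosen to fit some
  counterexample, provided that there is one for these types.
\<close>

definition residue_data :: "('k::field_char_0 \<times> 'n::finite) itself \<Rightarrow> 'k set \<times> 'k set" where
  "residue_data T = (SOME (A, I). maximal_ideal_of A I \<and> (\<exists>p>0. of_nat p \<in> I) \<and>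
     ((\<exists>S. finite S \<and> has_counterexample T S) \<longrightarrow> has_counterexample T A))"

definition residue_ring :: "('k::field_char_0 \<times> 'n::finite) itself \<Rightarrow> 'k set" where
  "residue_ring T = fst (residue_data T)"

definition residue_ideal :: "('k::field_char_0 \<times> 'n::finite) itself \<Rightarrow> 'k set" where
  "residue_ideal T = snd (residue_data T)"

lemma residue_data:
  fixes T :: "('k::field_char_0 \<times> 'n::finite) itself"
  shows maximal_residue_ideal: "maximal_ideal_of (residue_ring T) (residue_ideal T)"
    and residue_ideal_char: "\<exists>p>0. of_nat p \<in> residue_ideal T"
    and residue_ring_counterexample:
      "finite S \<Longrightarrow> has_counterexample T S \<Longrightarrow> has_counterexample T (residue_ring T)"
proof -
  let ?C = "\<exists>S. finite S \<and> has_counterexample T S"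
  let ?P = "\<lambda>(A, I). maximal_ideal_of A I \<and> (\<exists>p>0. of_nat p \<in> I) \<and> (?C \<longrightarrow> has_counterexample T A)"
  obtain S' where S: "finite S'" "?C \<longrightarrow> has_counterexample T S'"
    by (cases ?C) auto
  obtain A I p where AI: "S' \<subseteq> A" "maximal_ideal_of A I" "p > 0" "of_nat p \<in> I"
    using exists_residue_field_positive_char[OF S(1)] by blast
  have "?C \<longrightarrow> has_counterexample T A"
    using S(2) has_counterexample_mono[OF _ AI(1)] by blast
  then have "?P (A, I)" using AI by blast
  then have "?P (residue_data T)"
    unfolding residue_data_def by (rule someI)
  then have *: "maximal_ideal_of (residue_ring T) (residue_ideal T)"
    "\<exists>p>0. of_nat p \<in> residue_ideal T" "?C \<longrightarrow> has_counterexample T (residue_ring T)"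
    by (auto simp: residue_ring_def residue_ideal_def split_beta)
  show "maximal_ideal_of (residue_ring T) (residue_ideal T)" "\<exists>p>0. of_nat p \<in> residue_ideal T"
    by (fact *)+
  show "has_counterexample T (residue_ring T)" if "finite S" "has_counterexample T S"
    using *(3) that by blast
qed

text \<open>Congruent elements have the same candidates \<open>b\<close>, hence the same chosen one.
  The chosen representatives thus form a copy of the quotient of the ring by the ideal.\<close>

definition residue_rep :: "('k::field_char_0 \<times> 'n::finite) itself \<Rightarrow> 'k \<Rightarrow> 'k" where
  "residue_rep T a = (SOME b. b \<in> residue_ring T \<and> b - a \<in> residue_ideal T)"

typedef (overloaded) ('k, 'n) residue =
    "residue_rep TYPE('k::field_char_0 \<times> 'n::finite) ` residue_ring TYPE('k \<times> 'n)"
proof -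
  have "0 \<in> residue_ring TYPE('k \<times> 'n)"
    using maximal_residue_ideal[of "TYPE('k \<times> 'n)"] unfolding maximal_ideal_of_def by blast
  then show ?thesis by blast
qed

definition residue_class :: "'k::field_char_0 \<Rightarrow> ('k, 'n::finite) residue" where
  "residue_class a = Abs_residue (residue_rep TYPE('k \<times> 'n) a)"

section \<open>Arithmetic of the residue field\<close>

context
  fixes T :: "('k::field_char_0 \<times> 'n::finite) itself" and A I :: "'k set"
  defines A_def: "A \<equiv> residue_ring T" and I_def: "I \<equiv> residue_ideal T"
begin

lemma residue_ring_facts:
  shows subring_residue_ring: "subring A"
    and residue_ideal_0: "0 \<in> I" and residue_ideal_1: "1 \<notin> I"
    and residue_ideal_add: "\<And>a b. a \<in> I \<Longrightarrow> b \<in> I \<Longrightarrow> a + b \<in> I"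
    and residue_ideal_mult: "\<And>a r. a \<in> I \<Longrightarrow> r \<in> A \<Longrightarrow> r * a \<in> I"
    and residue_ideal_inverse: "\<And>a. a \<in> A \<Longrightarrow> a \<notin> I \<Longrightarrow> \<exists>b\<in>A. a * b - 1 \<in> I"
  using maximal_residue_ideal[of T] unfolding maximal_ideal_of_def A_def I_def by auto

lemma residue_ideal_diff: "a \<in> I \<Longrightarrow> b \<in> I \<Longrightarrow> a - b \<in> I"
  using residue_ideal_add[of a "- 1 * b"] residue_ideal_mult[of b "- 1"]
    subring_uminus[OF subring_residue_ring] subring_1[OF subring_residue_ring] by simp

lemma residue_rep:
  assumes "a \<in> A"
  shows "residue_rep T a \<in> A" "residue_rep T a - a \<in> I"
proof -
  have "a \<in> residue_ring T \<and> a - a \<in> residue_ideal T"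
    using assms residue_ideal_0 by (simp add: A_def I_def)
  from someI[of "\<lambda>b. b \<in> residue_ring T \<and> b - a \<in> residue_ideal T", OF this]
  show "residue_rep T a \<in> A" "residue_rep T a - a \<in> I"
    unfolding residue_rep_def[symmetric] by (simp_all add: A_def I_def)
qed

lemma residue_rep_eq_iff:
  assumes "a \<in> A" "b \<in> A"
  shows "residue_rep T a = residue_rep T b \<longleftrightarrow> a - b \<in> I"
proof
  assume "residue_rep T a = residue_rep T b"
  then show "a - b \<in> I"
    using residue_ideal_diff[OF residue_rep(2)[OF assms(2)] residue_rep(2)[OF assms(1)]] by simp
next
  assume ab: "a - b \<in> I"
  have "c - a \<in> I \<longleftrightarrow> c - b \<in> I" for c
    using residue_ideal_add[OF _ ab, of "c - a"] residue_ideal_diff[OF _ ab, of "c - b"] by auto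
  then show "residue_rep T a = residue_rep T b"
    by (simp add: residue_rep_def I_def)
qed

end

lemma residue_class_eq_iff:
  assumes "a \<in> residue_ring TYPE('k \<times> 'n)" "b \<in> residue_ring TYPE('k \<times> 'n)"
  shows "(residue_class a :: ('k::field_char_0, 'n::finite) residue) = residue_class b
     \<longleftrightarrow> a - b \<in> residue_ideal TYPE('k \<times> 'n)"
  using assms residue_rep_eq_iff[of a "TYPE('k \<times> 'n)" b]
  by (simp add: residue_class_def Abs_residue_inject)

lemma residue_cases:
  obtains a where "a \<in> residue_ring TYPE('k \<times> 'n)" "(x :: ('k::field_char_0, 'n::finite) residue) = residue_class a"
  by (cases x) (auto simp: residue_class_def)

definition residue_lift :: "('k::field_char_0, 'n::finite) residue \<Rightarrow> 'k" where
  "residue_lift x = (SOME a. a \<in> residue_ring TYPE('k \<times> 'n) \<and> x = residue_class a)"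

lemma residue_lift:
  fixes x :: "('k::field_char_0, 'n::finite) residue"
  shows "residue_lift x \<in> residue_ring TYPE('k \<times> 'n)" "residue_class (residue_lift x) = x"
proof -
  obtain a where "a \<in> residue_ring TYPE('k \<times> 'n) \<and> x = residue_class a"
    by (metis residue_cases)
  from someI[of "\<lambda>a. a \<in> residue_ring TYPE('k \<times> 'n) \<and> x = residue_class a", OF this]
  show "residue_lift x \<in> residue_ring TYPE('k \<times> 'n)" "residue_class (residue_lift x) = x"
    unfolding residue_lift_def by auto
qed

instantiation residue :: (field_char_0, finite) field
begin

definition "0 = residue_class 0"
definition "1 = residue_class 1"
definition "x + y = residue_class (residue_lift x + residue_lift y)"
definition "x - y = residue_class (residue_lift x - residue_lift y)"
definition "- x = residue_class (- residue_lift x)"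
definition times_residue :: "('a::field_char_0, 'b::finite) residue \<Rightarrow> ('a, 'b) residue \<Rightarrow> ('a, 'b) residue" where
  "times_residue x y = residue_class (residue_lift x * residue_lift y)"
definition inverse_residue :: "('a::field_char_0, 'b::finite) residue \<Rightarrow> ('a, 'b) residue" where
  "inverse_residue x = (if x = 0 then 0 else SOME y. y * x = 1)"
definition divide_residue :: "('a::field_char_0, 'b::finite) residue \<Rightarrow> ('a, 'b) residue \<Rightarrow> ('a, 'b) residue" where
  "divide_residue x y = x * inverse y"

lemma residue_class_hom:
  assumes a: "a \<in> residue_ring TYPE('a \<times> 'b)" and b: "b \<in> residue_ring TYPE('a \<times> 'b)"
  shows residue_class_add: "residue_class a + residue_class b = (residue_class (a + b) :: ('a, 'b) residue)"
    and residue_class_diff: "residue_class a - residue_class b = (residue_class (a - b) :: ('a, 'b) residue)"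
    and residue_class_mult: "residue_class a * residue_class b = (residue_class (a * b) :: ('a, 'b) residue)"
    and residue_class_uminus: "- residue_class a = (residue_class (- a) :: ('a, 'b) residue)"
proof -
  let ?A = "residue_ring TYPE('a \<times> 'b)" and ?I = "residue_ideal TYPE('a \<times> 'b)"
  note A = subring_residue_ring[of "TYPE('a \<times> 'b)"]
  define a' b' where "a' = residue_lift (residue_class a :: ('a, 'b) residue)"
    and "b' = residue_lift (residue_class b :: ('a, 'b) residue)"
  have a': "a' \<in> ?A" "a' - a \<in> ?I" and b': "b' \<in> ?A" "b' - b \<in> ?I"
    using residue_lift[of "residue_class a :: ('a, 'b) residue"]
      residue_lift[of "residue_class b :: ('a, 'b) residue"] a b
    by (simp_all add: residue_class_eq_iff a'_def b'_def)
  have "a' + b' - (a + b) \<in> ?I"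
    using residue_ideal_add[OF a'(2) b'(2)] by (simp add: algebra_simps)
  then show "residue_class a + residue_class b = (residue_class (a + b) :: ('a, 'b) residue)"
    unfolding plus_residue_def a'_def[symmetric] b'_def[symmetric]
    using a b a' b' A by (subst residue_class_eq_iff) (auto intro: subring_add)
  have "a' - b' - (a - b) \<in> ?I"
    using residue_ideal_diff[OF a'(2) b'(2)] by (simp add: algebra_simps)
  then show "residue_class a - residue_class b = (residue_class (a - b) :: ('a, 'b) residue)"
    unfolding minus_residue_def a'_def[symmetric] b'_def[symmetric]
    using a b a' b' A by (subst residue_class_eq_iff) (auto intro: subring_diff)
  have "a' * b' - a * b \<in> ?I"
    using residue_ideal_add[OF residue_ideal_mult[OF a'(2) b'(1)] residue_ideal_mult[OF b'(2) a]]
    by (simp add: algebra_simps)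
  then show "residue_class a * residue_class b = (residue_class (a * b) :: ('a, 'b) residue)"
    unfolding times_residue_def a'_def[symmetric] b'_def[symmetric]
    using a b a' b' A by (subst residue_class_eq_iff) (auto intro: subring_mult)
  have "- a' - (- a) \<in> ?I"
    using residue_ideal_diff[OF residue_ideal_0 a'(2)] by simp
  then show "- residue_class a = (residue_class (- a) :: ('a, 'b) residue)"
    unfolding uminus_residue_def a'_def[symmetric]
    using a a' A by (subst residue_class_eq_iff) (auto intro: subring_uminus)
qed

instance
proof
  note A = subring_residue_ring[of "TYPE('a \<times> 'b)"]
  note hom = residue_class_add residue_class_diff residue_class_mult residue_class_uminus
    zero_residue_def one_residue_def subring_add[OF A] subring_diff[OF A] subring_mult[OF A]
    subring_uminus[OF A] subring_0[OF A] subring_1[OF A]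
  fix x y z :: "('a, 'b) residue"
  obtain a where a: "a \<in> residue_ring TYPE('a \<times> 'b)" "x = residue_class a" by (rule residue_cases)
  obtain b where b: "b \<in> residue_ring TYPE('a \<times> 'b)" "y = residue_class b" by (rule residue_cases)
  obtain c where c: "c \<in> residue_ring TYPE('a \<times> 'b)" "z = residue_class c" by (rule residue_cases)
  show "x + y + z = x + (y + z)" "x + y = y + x" "0 + x = x" "- x + x = 0" "x - y = x + - y"
    "x * y * z = x * (y * z)" "x * y = y * x" "1 * x = x" "(x + y) * z = x * z + y * z"
    using a b c by (simp_all add: hom algebra_simps)
  show "(0 :: ('a, 'b) residue) \<noteq> 1"
    unfolding zero_residue_def one_residue_def using residue_ideal_1[of "TYPE('a \<times> 'b)"]
      residue_ideal_diff[OF residue_ideal_0, of "- 1" "TYPE('a \<times> 'b)"]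
    by (subst residue_class_eq_iff) (auto simp: hom)
  show "inverse x * x = 1" if "x \<noteq> 0"
  proof -
    have "a \<notin> residue_ideal TYPE('a \<times> 'b)"
      using that a by (auto simp: zero_residue_def residue_class_eq_iff hom)
    then obtain b where "b \<in> residue_ring TYPE('a \<times> 'b)" "a * b - 1 \<in> residue_ideal TYPE('a \<times> 'b)"
      using residue_ideal_inverse a(1) by blast
    then have "residue_class b * x = 1"
      using a by (auto simp: hom residue_class_eq_iff mult.commute)
    then have "(SOME y. y * x = 1) * x = 1" by (rule someI)
    then show ?thesis using that by (simp add: inverse_residue_def)
  qed
  show "x div y = x * inverse y" by (simp add: divide_residue_def)
  show "inverse (0 :: ('a, 'b) residue) = 0" by (simp add: inverse_residue_def)
qed

end

lemma residue_class_ring_hom: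
  "ring_hom_on (residue_ring TYPE('k \<times> 'n)) (residue_class :: 'k \<Rightarrow> ('k::field_char_0, 'n::finite) residue)"
  using subring_residue_ring[of "TYPE('k \<times> 'n)"]
  by (simp add: ring_hom_on_def residue_class_add residue_class_mult one_residue_def)

lemma CHAR_residue: "CHAR(('k::field_char_0, 'n::finite) residue) > 0"
proof -
  obtain p where p: "p > 0" "of_nat p \<in> residue_ideal TYPE('k \<times> 'n)"
    using residue_ideal_char by blast
  note A = subring_residue_ring[of "TYPE('k \<times> 'n)"]
  have "of_nat q \<in> residue_ring TYPE('k \<times> 'n) \<and> of_nat q = (residue_class (of_nat q) :: ('k, 'n) residue)" for q
    by (induction q) (auto simp: zero_residue_def one_residue_def residue_class_add
        subring_0[OF A] subring_1[OF A] subring_add[OF A])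
  then have "of_nat p = (0 :: ('k, 'n) residue)"
    using p(2) by (simp add: zero_residue_def residue_class_eq_iff subring_0[OF A])
  then show ?thesis
    using p(1) by (metis dvd_pos_nat of_nat_eq_0_iff_char_dvd)
qed

section \<open>Coefficientwise reduction of polynomials\<close>

definition reduce :: "('k::comm_ring_1 \<Rightarrow> 'f::comm_ring_1) \<Rightarrow> ('k, 'n::finite) mpoly \<Rightarrow> ('f, 'n) mpoly" where
  "reduce h f = mpoly_eval (\<lambda>c. scalar (h c)) Var f"

context
  fixes A :: "'k::comm_ring_1 set" and h :: "'k \<Rightarrow> 'f::comm_ring_1"
  assumes h: "ring_hom_on A h"
begin

lemma subring_A: "subring A"
  using h by (simp add: ring_hom_on_def)

lemma ring_hom_on_scalar_comp: "ring_hom_on A (\<lambda>c. scalar (h c) :: ('f, 'n) mpoly)"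
  using h by (auto simp: ring_hom_on_def single_add mult_single)

lemma reduce_hom: "ring_hom_on {f :: ('k, 'n::finite) mpoly. coeffs_in A f} (reduce h)"
  using mpoly_eval_hom[OF ring_hom_on_scalar_comp, of Var] by (simp add: reduce_def[abs_def])

lemma lookup_reduce: "Poly_Mapping.lookup (reduce h f) u = h (Poly_Mapping.lookup f u)"
proof -
  have "reduce h f = (\<Sum>w\<in>Poly_Mapping.keys f. Poly_Mapping.single w (h (Poly_Mapping.lookup f w)))"
    by (simp add: reduce_def mpoly_eval_def mon_eq_prod_Var[symmetric] mult_single)
  then have "Poly_Mapping.lookup (reduce h f) u
      = (\<Sum>w\<in>Poly_Mapping.keys f. if w = u then h (Poly_Mapping.lookup f w) else 0)"
    by (auto simp: lookup_sum lookup_single when_def intro!: sum.cong)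
  then show ?thesis
    using ring_hom_on_0[OF h] by (auto simp: not_in_keys_iff_lookup_eq_zero sum.delta)
qed

lemma keys_reduce: "Poly_Mapping.keys (reduce h f) \<subseteq> Poly_Mapping.keys f"
  using ring_hom_on_0[OF h] by (auto simp: in_keys_iff lookup_reduce)

lemma reduce_mon: "reduce h (mon u) = mon u"
  using h ring_hom_on_0[OF h]
  by (intro poly_mapping_eqI) (auto simp: lookup_reduce lookup_single when_def ring_hom_on_def)

lemma reduce_scalar: "reduce h (scalar c) = scalar (h c)"
  using ring_hom_on_0[OF h] by (simp add: reduce_def)

lemma coeffs_in_scalar: "c \<in> A \<Longrightarrow> coeffs_in A (scalar c :: ('k, 'n) mpoly)"
  using subring_0[OF subring_A] by (simp add: lookup_single when_def)

lemma coeffs_in_shear_Var: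
  assumes "\<And>i. v $ i \<in> A"
  shows "(if i = j then Var j else Var i + scalar (v $ i) * Var j) \<in> {f :: ('k, 'n::finite) mpoly. coeffs_in A f}"
proof -
  note B = subring_coeffs_in[OF subring_A]
  have "Var i \<in> {f :: ('k, 'n) mpoly. coeffs_in A f}" for i
    using subring_0[OF subring_A] subring_1[OF subring_A] by (simp add: Var_def lookup_single when_def)
  moreover have "scalar (v $ i) \<in> {f :: ('k, 'n) mpoly. coeffs_in A f}"
    using coeffs_in_scalar[OF assms] by simp
  ultimately show ?thesis
    by (simp del: mem_Collect_eq add: subring_add[OF B] subring_mult[OF B])
qed

lemma coeffs_in_shear:
  fixes f :: "('k, 'n::finite) mpoly"
  assumes v: "\<And>i. v $ i \<in> A" and f: "coeffs_in A f"
  shows "coeffs_in A (shear v j f)"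
proof -
  note B = subring_coeffs_in[OF subring_A]
  have "scalar (Poly_Mapping.lookup f u) \<in> {f :: ('k, 'n) mpoly. coeffs_in A f}" for u
    by (rule CollectI, rule coeffs_in_scalar) (use f in blast)
  then have "shear v j f \<in> {f. coeffs_in A f}"
    unfolding shear_def mpoly_eval_def
    by (intro subring_sum[OF B] subring_mult[OF B] subring_prod[OF B] subring_power[OF B]
        coeffs_in_shear_Var v)
  then show ?thesis by simp
qed

text \<open>Both sides are evaluations of \<open>f\<close> and agree on scalars and variables, since
  the substituted forms are built from the entries of \<open>v\<close> by ring operations.\<close>

lemma shear_reduce:
  fixes f :: "('k, 'n::finite) mpoly"
  assumes v: "\<And>i. v $ i \<in> A" and f: "coeffs_in A f"
  shows "shear (\<chi> i. h (v $ i)) j (reduce h f) = reduce h (shear v j f)"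
proof -
  let ?x = "\<lambda>i. if i = j then Var j else Var i + scalar (v $ i) * Var j :: ('k, 'n) mpoly"
  let ?y = "\<lambda>i. if i = j then Var j else Var i + scalar (h (v $ i)) * Var j :: ('f, 'n) mpoly"
  have "reduce h (shear v j f) = mpoly_eval (\<lambda>c. reduce h (scalar c)) (\<lambda>i. reduce h (?x i)) f"
    unfolding shear_def
    by (intro mpoly_eval_comp[OF reduce_hom] coeffs_in_shear_Var v CollectI coeffs_in_scalar spec[OF f])
  also have "(\<lambda>i. reduce h (?x i)) = ?y"
  proof
    fix i
    have V: "coeffs_in A (Var i :: ('k, 'n) mpoly)" "reduce h (Var i :: ('k, 'n) mpoly) = Var i" for i
      using subring_0[OF subring_A] subring_1[OF subring_A]
      by (simp_all add: Var_def lookup_single when_def reduce_mon)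
    have sc: "coeffs_in A (scalar (v $ i) :: ('k, 'n) mpoly)"
      by (rule coeffs_in_scalar[OF v])
    then have "coeffs_in A (scalar (v $ i) * Var j :: ('k, 'n) mpoly)"
      using V(1) subring_mult[OF subring_coeffs_in[OF subring_A]] by blast
    with V sc show "reduce h (?x i) = ?y i"
      using reduce_hom[where 'n = 'n] by (simp add: ring_hom_on_def reduce_scalar)
  qed
  also have "(\<lambda>c. reduce h (scalar c)) = (\<lambda>c. scalar (h c))"
    by (simp add: reduce_scalar)
  finally have 1: "reduce h (shear v j f) = mpoly_eval (\<lambda>c. scalar (h c)) ?y f" .
  have "shear (\<chi> i. h (v $ i)) j (reduce h f)
      = mpoly_eval (\<lambda>c. shear (\<chi> i. h (v $ i)) j (scalar (h c))) (\<lambda>i. shear (\<chi> i. h (v $ i)) j (Var i)) f"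
    unfolding reduce_def by (rule mpoly_eval_comp[OF shear_hom]) simp_all
  also have "\<dots> = mpoly_eval (\<lambda>c. scalar (h c)) ?y f"
    by (simp add: shear_scalar shear_Var cong: if_cong)
  finally show ?thesis using 1 by simp
qed

lemma reduce_vanishing:
  fixes f :: "('k, 'n::finite) mpoly"
  assumes "\<And>i. v $ i \<in> A" "coeffs_in A f" "f \<in> vanishing v j M"
  shows "reduce h f \<in> vanishing (\<chi> i. h (v $ i)) j M"
  using assms(3) keys_reduce[of "shear v j f"]
  by (auto simp: vanishing_def shear_reduce[OF assms(1,2)])

lemma pairing_reduce:
  assumes "coeffs_in A f" "\<And>u. l u \<in> A"
  shows "pairing (\<lambda>u. h (l u)) (reduce h f) = h (pairing l f)"
proof -
  have "pairing (\<lambda>u. h (l u)) (reduce h f)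
      = (\<Sum>u\<in>Poly_Mapping.keys f. h (Poly_Mapping.lookup f u) * h (l u))"
    by (subst pairing_superset[OF _ keys_reduce]) (simp_all add: lookup_reduce)
  also have "\<dots> = (\<Sum>u\<in>Poly_Mapping.keys f. h (Poly_Mapping.lookup f u * l u))"
    using assms h by (simp add: ring_hom_on_def)
  also have "\<dots> = h (pairing l f)"
    unfolding pairing_def using assms subring_A
    by (intro ring_hom_on_sum[OF h, symmetric]) (auto intro: subring_mult)
  finally show ?thesis .
qed

end

lemma products_reduce:
  fixes h :: "'k::comm_ring_1 \<Rightarrow> 'f::comm_ring_1" and B :: "('k, 'n::finite) mpoly set"
  assumes h: "ring_hom_on A h" and x: "x \<in> products (reduce h ` B) m"
    and B: "\<And>b. b \<in> B \<Longrightarrow> coeffs_in A b"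
  shows "\<exists>y\<in>products B m. coeffs_in A y \<and> x = reduce h y"
  using x
proof (induction m arbitrary: x)
  case 0
  have "coeffs_in A (1 :: ('k, 'n) mpoly)"
    using subring_1[OF subring_coeffs_in[OF subring_A[OF h]]] by blast
  then show ?case
    using 0 reduce_hom[OF h, where 'n = 'n] by (simp add: ring_hom_on_def)
next
  case (Suc m)
  then obtain b x' where x: "x = reduce h b * x'" "b \<in> B" "x' \<in> products (reduce h ` B) m"
    by auto
  from Suc.IH[OF x(3)] obtain y where y: "y \<in> products B m" "coeffs_in A y" "x' = reduce h y"
    by blast
  have "coeffs_in A (b * y)"
    using subring_mult[OF subring_coeffs_in[OF subring_A[OF h]]] B[OF x(2)] y(2) by blast
  moreover have "x = reduce h (b * y)"
    using x y B[OF x(2)] reduce_hom[OF h, where 'n = 'n] by (simp add: ring_hom_on_def)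
  ultimately show ?case using x(2) y(1) by auto
qed

text \<open>A part of degree at most \<open>D\<close> of a product involves only parts of degree at
  most \<open>D\<close> of its factors.\<close>

lemma homogeneous_part_products:
  fixes B :: "('k::field, 'n::finite) mpoly set"
  assumes J: "\<And>x d. x \<in> J \<Longrightarrow> d \<le> D \<Longrightarrow> homogeneous_part d x \<in> linear_span B"
    and x: "x \<in> products J m" and d: "d \<le> D"
  shows "homogeneous_part d x \<in> linear_span (products B m)"
proof -
  interpret vector_space "mpoly_scale :: 'k \<Rightarrow> ('k, 'n) mpoly \<Rightarrow> _"
    by (rule vector_space_mpoly)
  show ?thesis
    using x d
  proof (induction m arbitrary: x d)
    case 0
    have "homogeneous_part d (1 :: ('k, 'n) mpoly) = (if d = 0 then 1 else 0)"
      by (rule homogeneous_part_homogeneous[OF homogeneous_poly_1])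
    then show ?case using 0 by (auto intro: span_base span_zero)
  next
    case (Suc m)
    then obtain a b where x: "x = a * b" "a \<in> J" "b \<in> products J m" by auto
    have "homogeneous_part i a * homogeneous_part (d - i) b \<in> span (products B (Suc m))" if "i \<le> d" for i
      using linear_span_mult[OF J[OF x(2), of i] Suc.IH[OF x(3), of "d - i"]] that Suc.prems(2)
      by simp
    then show ?case
      unfolding x(1) homogeneous_part_mult by (intro span_sum) simp
  qed
qed

text \<open>In positive characteristic the containment holds, so the reduction of \<open>f\<close>
  is a combination of \<open>m\<close>-fold products of the reduced \<open>G u\<close>. The reduced
  functional is 0 on these products but 1 on the reduction of \<open>f\<close>.\<close>

lemma no_counterexample_reducible:
  fixes h :: "'k::field \<Rightarrow> 'f::field" and X :: "(('k ^ 'n::finite) \<times> 'n) set"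
  assumes h: "ring_hom_on A h" and CHAR: "CHAR('f) > 0"
    and C: "counterexample_over A X k m D f G H l"
  shows False
proof -
  have X: "finite X" "\<And>v j i. (v, j) \<in> X \<Longrightarrow> v $ i \<in> A" and m: "m > 0" and n: "CARD('n) > 1"
    and f: "coeffs_in A f" "f \<in> vanishing_on X (m * (CARD('n) - 1 + k))"
      "\<And>u. u \<in> Poly_Mapping.keys f \<Longrightarrow> total_degree u \<le> D"
    and G: "\<And>u. total_degree u \<le> D \<Longrightarrow> coeffs_in A (G u)"
      "\<And>u. total_degree u \<le> D \<Longrightarrow> G u \<in> vanishing_on X (k + 1)"
    and H: "\<And>v j w. (v, j) \<in> X \<Longrightarrow> total_degree w \<le> D \<Longrightarrow> coeffs_in A (H v j w)"
    and GH: "\<And>u. total_degree u \<le> D \<Longrightarrow> mon u = G u + (\<Sum>(v, j)\<in>X. \<Sum>w | total_degree w \<le> D \<and> codegree j w \<le> k.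
        scalar (Poly_Mapping.lookup (shear v j (mon u)) w) * H v j w)"
    and l: "\<And>u. l u \<in> A" "\<And>x. x \<in> products (G ` {u. total_degree u \<le> D}) m \<Longrightarrow> pairing l x = 0"
      "pairing l f = 1"
    using C unfolding counterexample_over_def by (auto simp: split_beta)
  interpret vector_space "mpoly_scale :: 'f \<Rightarrow> ('f, 'n) mpoly \<Rightarrow> _"
    by (rule vector_space_mpoly)
  note A = subring_A[OF h] and red = reduce_hom[OF h, where 'n = 'n]
  define U where "U = {u :: 'n \<Rightarrow>\<^sub>0 nat. total_degree u \<le> D}"
  have U: "finite U" unfolding U_def by (rule finite_total_degree_le)
  let ?L = "\<lambda>j. {w. total_degree w \<le> D \<and> codegree j w \<le> k}"
  define hv where "hv v = (\<chi> i. h (v $ i))" for v :: "'k ^ 'n"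
  define X' where "X' = (\<lambda>(v, j). (hv v, j)) ` X"
  let ?J = "vanishing_on X' (k + 1)"
  define B where "B = reduce h ` G ` U"
  have reduce_vanishing_on: "reduce h g \<in> vanishing_on X' M" if "coeffs_in A g" "g \<in> vanishing_on X M" for g M
    using that reduce_vanishing[OF h X(2)] by (auto simp: X'_def hv_def vanishing_on_def)
  have coeffs_mon: "coeffs_in A (mon u :: ('k, 'n) mpoly)" for u
    using subring_0[OF A] subring_1[OF A] by (simp add: lookup_single when_def)
  \<comment> \<open>The certificate becomes the same certificate at the reduced points, since
    reduction commutes with \<open>shear\<close>.\<close>
  have mon_eq: "mon u = reduce h (G u) + (\<Sum>(v, j)\<in>X. \<Sum>w\<in>?L j.
        scalar (Poly_Mapping.lookup (shear (hv v) j (mon u)) w) * reduce h (H v j w))"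
    if u: "u \<in> U" for u
  proof -
    let ?s = "\<lambda>v j w. scalar (Poly_Mapping.lookup (shear v j (mon u)) w) :: ('k, 'n) mpoly"
    let ?S = "\<lambda>(v, j). \<Sum>w\<in>?L j. ?s v j w * H v j w"
    note BB = subring_coeffs_in[OF A, where 'n = 'n]
    have c: "Poly_Mapping.lookup (shear v j (mon u)) w \<in> A" if "(v, j) \<in> X" for v j w
      using coeffs_in_shear[OF h X(2)[OF that] coeffs_mon] by blast
    have s: "?s v j w \<in> {f. coeffs_in A f}" if "(v, j) \<in> X" for v j w
      using coeffs_in_scalar[OF h c[OF that]] by simp
    have H': "H v j w \<in> {f. coeffs_in A f}" if "(v, j) \<in> X" "w \<in> ?L j" for v j w
      using H that by auto
    have sH: "?s v j w * H v j w \<in> {f. coeffs_in A f}" if "(v, j) \<in> X" "w \<in> ?L j" for v j w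
      using s[OF that(1)] H'[OF that] by (rule subring_mult[OF BB])
    have S: "?S P \<in> {f. coeffs_in A f}" if "P \<in> X" for P
      using that sH by (cases P) (auto simp del: mem_Collect_eq intro!: subring_sum[OF BB])
    have Gu: "G u \<in> {f. coeffs_in A f}" using G(1) u by (simp add: U_def)
    have "mon u = reduce h (G u + sum ?S X)"
      using GH[of u] u reduce_mon[OF h, of u] by (simp add: U_def)
    also have "\<dots> = reduce h (G u) + reduce h (sum ?S X)"
      by (rule ring_hom_on_add[OF red Gu subring_sum[OF BB S]])
    also have "reduce h (sum ?S X) = (\<Sum>P\<in>X. reduce h (?S P))"
      by (rule ring_hom_on_sum[OF red S])
    also have "\<dots> = (\<Sum>(v, j)\<in>X. \<Sum>w\<in>?L j.
        scalar (Poly_Mapping.lookup (shear (hv v) j (mon u)) w) * reduce h (H v j w))"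
    proof (intro sum.cong refl, clarify)
      fix v j assume vj: "(v, j) \<in> X"
      have "reduce h (\<Sum>w\<in>?L j. ?s v j w * H v j w) = (\<Sum>w\<in>?L j. reduce h (?s v j w * H v j w))"
        using sH[OF vj] by (rule ring_hom_on_sum[OF red])
      also have "\<dots> = (\<Sum>w\<in>?L j. reduce h (?s v j w) * reduce h (H v j w))"
        by (intro sum.cong refl ring_hom_on_mult[OF red] s[OF vj] H'[OF vj])
      also have "\<dots> = (\<Sum>w\<in>?L j. scalar (Poly_Mapping.lookup (shear (hv v) j (mon u)) w) * reduce h (H v j w))"
        using shear_reduce[OF h X(2)[OF vj] coeffs_mon, of j u]
        by (simp add: reduce_scalar[OF h] hv_def reduce_mon[OF h] lookup_reduce[OF h])
      finally show "reduce h (\<Sum>w\<in>?L j. ?s v j w * H v j w)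
        = (\<Sum>w\<in>?L j. scalar (Poly_Mapping.lookup (shear (hv v) j (mon u)) w) * reduce h (H v j w))" .
    qed
    finally show ?thesis .
  qed
  \<comment> \<open>Summing \<open>mon_eq\<close> weighted by the coefficients of \<open>g\<close>
    turns the factors in front of \<open>H\<close> into vanishing conditions on \<open>g\<close>,
    which are zero. What remains expresses \<open>g\<close> by the reduced
    \<open>G u\<close>.\<close>
  have low_degree: "g \<in> span B" if g: "g \<in> ?J" "\<And>u. u \<in> Poly_Mapping.keys g \<Longrightarrow> total_degree u \<le> D" for g
  proof -
    let ?g = "Poly_Mapping.lookup g"
    have g_mon: "g = (\<Sum>u\<in>U. scalar (?g u) * mon u)"
      using poly_mapping_eq_sum_single[of U g] U g(2) by (auto simp: U_def mult_single)
    have zero: "(\<Sum>u\<in>U. ?g u * Poly_Mapping.lookup (shear (hv v) j (mon u)) w) = 0"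
      if "(v, j) \<in> X" "w \<in> ?L j" for v j w
    proof -
      have "shear (hv v) j g = (\<Sum>u\<in>U. scalar (?g u) * shear (hv v) j (mon u))"
        by (subst g_mon) (simp add: shear_sum shear_mult shear_scalar)
      then have "Poly_Mapping.lookup (shear (hv v) j g) w
          = (\<Sum>u\<in>U. ?g u * Poly_Mapping.lookup (shear (hv v) j (mon u)) w)"
        by (simp add: lookup_sum)
      moreover have "g \<in> vanishing (hv v) j (k + 1)"
        using that(1) by (intro vanishing_onD[OF g(1)]) (force simp: X'_def)
      then have "Poly_Mapping.lookup (shear (hv v) j g) w = 0"
        using that(2) by (force simp: vanishing_def in_keys_iff)
      ultimately show ?thesis by simp
    qed
    have "(\<Sum>u\<in>U. scalar (?g u) * (\<Sum>(v, j)\<in>X. \<Sum>w\<in>?L j.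
          scalar (Poly_Mapping.lookup (shear (hv v) j (mon u)) w) * reduce h (H v j w)))
        = (\<Sum>(v, j)\<in>X. \<Sum>w\<in>?L j. \<Sum>u\<in>U.
          scalar (?g u * Poly_Mapping.lookup (shear (hv v) j (mon u)) w) * reduce h (H v j w))"
      by (simp add: sum_distrib_left split_beta sum.swap[of _ _ U] mult_single flip: mult.assoc)
    also have "\<dots> = (\<Sum>(v, j)\<in>X. \<Sum>w\<in>?L j.
          scalar (\<Sum>u\<in>U. ?g u * Poly_Mapping.lookup (shear (hv v) j (mon u)) w) * reduce h (H v j w))"
      by (simp add: ring_hom_on_sum[OF ring_hom_on_scalar, simplified] sum_distrib_right)
    also have "\<dots> = 0"
      using zero by (intro sum.neutral ballI) (auto simp: split_beta intro!: sum.neutral)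
    finally have rest: "(\<Sum>u\<in>U. scalar (?g u) * (\<Sum>(v, j)\<in>X. \<Sum>w\<in>?L j.
          scalar (Poly_Mapping.lookup (shear (hv v) j (mon u)) w) * reduce h (H v j w))) = 0" .
    have "g = (\<Sum>u\<in>U. scalar (?g u) * (reduce h (G u) + (\<Sum>(v, j)\<in>X. \<Sum>w\<in>?L j.
          scalar (Poly_Mapping.lookup (shear (hv v) j (mon u)) w) * reduce h (H v j w))))"
      by (rule trans[OF g_mon], rule sum.cong[OF refl], rule arg_cong[where f = "(*) _"], rule mon_eq)
    also have "\<dots> = (\<Sum>u\<in>U. scalar (?g u) * reduce h (G u))"
      unfolding distrib_left sum.distrib rest by simp
    also have "\<dots> \<in> span B"
      by (intro span_sum span_scale span_base) (simp add: B_def)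
    finally show ?thesis .
  qed
  have hom_J: "homogeneous_part d x \<in> span B" if "x \<in> ?J" "d \<le> D" for x d
  proof (rule low_degree)
    show "homogeneous_part d x \<in> ?J"
      using that(1) by (auto simp: vanishing_on_def intro: vanishing_homogeneous_part)
    show "total_degree u \<le> D" if "u \<in> Poly_Mapping.keys (homogeneous_part d x)" for u
      using that \<open>d \<le> D\<close> by (auto simp: in_keys_iff lookup_homogeneous_part split: if_splits)
  qed
  \<comment> \<open>The products have factors of all degrees, whereas \<open>low_degree\<close>
    reaches only degree \<open>D\<close>; hence the restriction to homogeneous parts up to
    \<open>D\<close>.\<close>
  define W where "W = {x :: ('f, 'n) mpoly. \<forall>d\<le>D. homogeneous_part d x \<in> span (products B m)}"
  have add: "homogeneous_part d (a + b) = homogeneous_part d a + homogeneous_part d b" for d and a b :: "('f, 'n) mpoly"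
    by (rule poly_mapping_eqI) (simp add: lookup_homogeneous_part lookup_add)
  have "reduce h f \<in> W"
  proof (rule vanishing_on_subset_products_positive_char[OF CHAR n m])
    show "reduce h f \<in> vanishing_on X' (m * (CARD('n) - 1 + k))"
      using f by (intro reduce_vanishing_on)
    have "homogeneous_part d (0 :: ('f, 'n) mpoly) = 0" for d
      by (simp add: homogeneous_part_def)
    then show "0 \<in> W" by (simp add: W_def span_zero)
    show "a + b \<in> W" if "a \<in> W" "b \<in> W" for a b
      using that by (simp add: W_def add span_add)
    show "products ?J m \<subseteq> W"
      using homogeneous_part_products[of ?J D B, OF hom_J] by (auto simp: W_def)
  qed
  moreover have "reduce h f = (\<Sum>d\<le>D. homogeneous_part d (reduce h f))"
    using f(3) keys_reduce[OF h, of f] by (intro sum_homogeneous_part) auto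
  ultimately have "reduce h f \<in> span (products B m)"
    by (metis (no_types, lifting) W_def atMost_iff mem_Collect_eq span_sum)
  then have "pairing (\<lambda>u. h (l u)) (reduce h f) = 0"
  proof (induction rule: span_induct_alt)
    case base
    show ?case by (simp add: pairing_def)
  next
    case (step c x y)
    have "coeffs_in A b" if "b \<in> G ` U" for b
      using that G(1) by (auto simp: U_def)
    from products_reduce[OF h step(1)[unfolded B_def] this]
    obtain z where "z \<in> products (G ` U) m" "coeffs_in A z" "x = reduce h z" by blast
    then have "pairing (\<lambda>u. h (l u)) x = 0"
      using l(1,2) ring_hom_on_0[OF h] by (simp add: pairing_reduce[OF h] U_def)
    then show ?case using step by (simp add: pairing_add pairing_scalar_mult)
  qed
  moreover have "pairing (\<lambda>u. h (l u)) (reduce h f) = 1"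
    using pairing_reduce[OF h f(1) l(1)] l(3) h by (simp add: ring_hom_on_def)
  ultimately show False by simp
qed

lemma no_counterexample:
  assumes "finite S"
  shows "\<not> has_counterexample TYPE('k::field_char_0 \<times> 'n::finite) S"
proof
  assume "has_counterexample TYPE('k \<times> 'n) S"
  then have "has_counterexample TYPE('k \<times> 'n) (residue_ring TYPE('k \<times> 'n))"
    using assms by (intro residue_ring_counterexample)
  then obtain X :: "(('k ^ 'n) \<times> 'n) set" and k m D f G H l
    where "counterexample_over (residue_ring TYPE('k \<times> 'n)) X k m D f G H l"
    unfolding has_counterexample_def by (elim exE)
  then show False
    by (rule no_counterexample_reducible[OF residue_class_ring_hom CHAR_residue])
qed

subsection \<open>The containment in characteristic zero\<close>

text \<open>A maximal independent subset of \<open>W\<close> stays independent when \<open>x\<close>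
  is added, so the values 1 at \<open>x\<close> and 0 on the subset extend linearly.\<close>

lemma (in vector_space) separating_functional:
  assumes "x \<notin> span W"
  shows "\<exists>g. Vector_Spaces.linear scale (*) g \<and> g x = 1 \<and> (\<forall>w\<in>W. g w = 0)"
proof -
  interpret field: vector_space "(*) :: 'a \<Rightarrow> 'a \<Rightarrow> 'a"
    by unfold_locales (auto simp: algebra_simps)
  interpret pair: vector_space_pair scale "(*) :: 'a \<Rightarrow> 'a \<Rightarrow> 'a" ..
  obtain B where B: "B \<subseteq> W" "independent B" "W \<subseteq> span B"
    by (rule maximal_independent_subset)
  have x: "x \<notin> span B"
    using assms span_mono[OF B(1)] by blast
  then have "independent (insert x B)"
    using B(2) by (rule independent_insertI)
  then obtain g where g: "Vector_Spaces.linear scale (*) g" "\<forall>y\<in>insert x B. g y = (if y = x then 1 else 0)"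
    using pair.linear_independent_extend[of "insert x B" "\<lambda>y. if y = x then 1 else 0"] by blast
  have "x \<notin> B" using x span_base by blast
  then have "g y = 0" if "y \<in> B" for y using g(2) that by auto
  then have "g w = 0" if "w \<in> W" for w
    using pair.linear_eq_0_on_span[OF g(1), of B w] B(3) that by blast
  moreover have "g x = 1" using g(2) by simp
  ultimately show ?thesis using g(1) by blast
qed

lemma finite_products: "finite A \<Longrightarrow> finite (products A m)"
proof (induction m)
  case (Suc m)
  have "products A (Suc m) = (\<lambda>(a, b). a * b) ` (A \<times> products A m)" by auto
  then show ?case using Suc by simp
qed simp

lemma products_mono: "A \<subseteq> B \<Longrightarrow> products A m \<subseteq> products B m"
  by (induction m) auto

text \<open>Ensures that for polynomials of degree at most \<open>D\<close> the conditions with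
  \<open>total_degree w \<le> D\<close> are all the vanishing conditions.\<close>

lemma total_degree_shear:
  assumes "\<And>u. u \<in> Poly_Mapping.keys f \<Longrightarrow> total_degree u \<le> D"
    and w: "w \<in> Poly_Mapping.keys (shear v j f)"
  shows "total_degree w \<le> D"
proof (rule ccontr)
  assume less: "\<not> ?thesis"
  have "homogeneous_part (total_degree w) (shear v j f) = shear v j (homogeneous_part (total_degree w) f)"
    by (rule homogeneous_part_shear)
  also have "homogeneous_part (total_degree w) f = 0"
    using assms(1) less by (intro poly_mapping_eqI) (force simp: lookup_homogeneous_part in_keys_iff)
  finally have "Poly_Mapping.lookup (homogeneous_part (total_degree w) (shear v j f)) w = 0"
    by (simp add: shear_0)
  then show False using w by (simp add: lookup_homogeneous_part in_keys_iff)
qed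

text \<open>If the containment failed, linear algebra on the polynomials of degree at most
  \<open>D\<close> would supply every part of a counterexample, with finitely many field elements
  involved.\<close>

theorem vanishing_on_subset_products:
  fixes X :: "(('k::field_char_0 ^ 'n::finite) \<times> 'n) set"
  assumes X: "finite X" and n: "CARD('n) > 1" and m: "m > 0"
    and f: "f \<in> vanishing_on X (m * (CARD('n) - 1 + k))"
  shows "f \<in> linear_span (products (vanishing_on X (k + 1)) m)"
proof (rule ccontr)
  interpret vector_space "mpoly_scale :: 'k \<Rightarrow> ('k, 'n) mpoly \<Rightarrow> _"
    by (rule vector_space_mpoly)
  assume notin: "f \<notin> span (products (vanishing_on X (k + 1)) m)"
  let ?fs = "\<lambda>c (\<phi> :: ('k ^ 'n) \<times> 'n \<Rightarrow> ('n \<Rightarrow>\<^sub>0 nat) \<Rightarrow> 'k) P w. c * \<phi> P w"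
  interpret fs: vector_space ?fs
    by unfold_locales (auto simp: algebra_simps fun_eq_iff)
  interpret pair: vector_space_pair "mpoly_scale :: 'k \<Rightarrow> ('k, 'n) mpoly \<Rightarrow> _" ?fs ..
  interpret inverse_pair: vector_space_pair ?fs "mpoly_scale :: 'k \<Rightarrow> ('k, 'n) mpoly \<Rightarrow> _" ..
  obtain D where D: "\<And>u. u \<in> Poly_Mapping.keys f \<Longrightarrow> total_degree u \<le> D"
    using total_degree_bound[of f] by blast
  define U where "U = {u :: 'n \<Rightarrow>\<^sub>0 nat. total_degree u \<le> D}"
  have U: "finite U" unfolding U_def by (rule finite_total_degree_le)
  let ?L = "\<lambda>j. {w. total_degree w \<le> D \<and> codegree j w \<le> k}"
  have L: "finite (?L j)" for j :: 'n
    by (rule finite_subset[OF _ U]) (auto simp: U_def)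
  define V where "V = {g :: ('k, 'n) mpoly. Poly_Mapping.keys g \<subseteq> U}"
  have V: "subspace V"
  proof (rule subspaceI)
    show "0 \<in> V" by (simp add: V_def)
    show "x + y \<in> V" if "x \<in> V" "y \<in> V" for x y
      using that keys_add[of x y] unfolding V_def by blast
    show "scalar c * x \<in> V" if "x \<in> V" for c x
      using that unfolding V_def by (auto simp: in_keys_iff)
  qed
  \<comment> \<open>\<open>C\<close> records the coefficients that have to vanish; on
    \<open>V\<close> its kernel consists of the polynomials vanishing to order
    \<open>k + 1\<close>.\<close>
  define C where "C g P w = (if P \<in> X \<and> w \<in> ?L (snd P)
      then Poly_Mapping.lookup (shear (fst P) (snd P) g) w else 0)" for g :: "('k, 'n) mpoly" and P w
  have C: "Vector_Spaces.linear mpoly_scale ?fs C"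
    by unfold_locales (auto simp: C_def fun_eq_iff shear_add shear_mult shear_scalar lookup_add)
  \<comment> \<open>\<open>E\<close> is a generalized inverse of \<open>C\<close>, so subtracting
    \<open>E (C g)\<close> from \<open>g\<close> projects \<open>V\<close> onto the kernel. The
    \<open>G u\<close> are the projected monomials, and \<open>H\<close> lists the values of
    \<open>E\<close> on the unit functions.\<close>
  obtain E where E: "range E \<subseteq> V" "Vector_Spaces.linear ?fs mpoly_scale E" "\<And>g. g \<in> V \<Longrightarrow> C (E (C g)) = C g"
    using pair.linear_exists_right_inverse_on[OF C V] by auto
  define H where "H v j w = E (\<lambda>P w'. if P = (v, j) \<and> w' = w then 1 else 0)" for v j w
  define G where "G u = mon u - E (C (mon u))" for u
  have mon_V: "mon u \<in> V" if "u \<in> U" for u using that by (simp add: V_def)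
  have G: "G u \<in> vanishing_on X (k + 1)" if u: "u \<in> U" for u
  proof (rule vanishing_onI)
    fix v j assume vj: "(v, j) \<in> X"
    have GV: "G u \<in> V"
      using subspace_diff[OF V mon_V[OF u]] E(1) by (auto simp: G_def)
    have deg: "total_degree w \<le> D" if "w \<in> Poly_Mapping.keys (shear v j (G u))" for w
      by (rule total_degree_shear[OF _ that]) (use GV in \<open>auto simp: V_def U_def\<close>)
    have "C (G u) = C (mon u) - C (E (C (mon u)))"
      unfolding G_def by (rule pair.linear_diff[OF C])
    then have "C (G u) = 0" using E(3)[OF mon_V[OF u]] by simp
    then have zero: "C (G u) (v, j) w = 0" for w by simp
    have "k + 1 \<le> codegree j w" if w: "w \<in> Poly_Mapping.keys (shear v j (G u))" for w
    proof (rule ccontr)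
      assume "\<not> ?thesis"
      then have "Poly_Mapping.lookup (shear v j (G u)) w = 0"
        using zero[of w] deg[OF w] vj by (simp add: C_def)
      with w show False by (simp add: in_keys_iff)
    qed
    then show "G u \<in> vanishing v j (k + 1)" by (simp add: vanishing_def)
  qed
  have GH: "mon u = G u + (\<Sum>(v, j)\<in>X. \<Sum>w\<in>?L j.
        scalar (Poly_Mapping.lookup (shear v j (mon u)) w) * H v j w)" for u
  proof -
    let ?c = "\<lambda>P w. Poly_Mapping.lookup (shear (fst P) (snd P) (mon u)) w"
    let ?e = "\<lambda>P w P' w'. if P' = P \<and> w' = w then 1 else 0 :: 'k"
    have "C (mon u) = (\<Sum>P\<in>X. \<Sum>w\<in>?L (snd P). ?fs (?c P w) (?e P w))"
    proof (intro ext)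
      fix P' :: "('k ^ 'n) \<times> 'n" and w'
      have fun_sum: "sum F I P' w' = (\<Sum>i\<in>I. F i P' w')"
        for F :: "'i \<Rightarrow> ('k ^ 'n) \<times> 'n \<Rightarrow> ('n \<Rightarrow>\<^sub>0 nat) \<Rightarrow> 'k" and I
        by (induction I rule: infinite_finite_induct) auto
      have "(\<Sum>P\<in>X. \<Sum>w\<in>?L (snd P). ?fs (?c P w) (?e P w)) P' w'
          = (\<Sum>P\<in>X. \<Sum>w\<in>?L (snd P). ?c P w * (if P' = P \<and> w' = w then 1 else 0))"
        by (simp add: fun_sum)
      also have "\<dots> = (\<Sum>P\<in>X. if P' = P then \<Sum>w\<in>?L (snd P). if w' = w then ?c P w else 0 else 0)"
        by (intro sum.cong refl) (auto intro!: sum.cong)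
      also have "\<dots> = C (mon u) P' w'"
        using X L by (simp add: C_def sum.delta)
      finally show "C (mon u) P' w' = (\<Sum>P\<in>X. \<Sum>w\<in>?L (snd P). ?fs (?c P w) (?e P w)) P' w'" ..
    qed
    then have "E (C (mon u)) = (\<Sum>P\<in>X. \<Sum>w\<in>?L (snd P). scalar (?c P w) * E (?e P w))"
      by (simp add: inverse_pair.linear_sum[OF E(2)] inverse_pair.linear_scale[OF E(2)])
    then show ?thesis
      by (simp add: G_def H_def split_beta)
  qed
  let ?W = "products (G ` U) m"
  have "f \<notin> span ?W"
  proof -
    have "?W \<subseteq> products (vanishing_on X (k + 1)) m"
      using G by (intro products_mono) auto
    then show ?thesis using notin span_mono by blast
  qed
  from separating_functional[OF this]
  obtain g where g: "Vector_Spaces.linear mpoly_scale (*) g" "g f = 1" "\<forall>w\<in>?W. g w = 0"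
    by (elim exE conjE)
  \<comment> \<open>Cutting the functional off outside these finitely many monomials changes neither
    its value on \<open>f\<close> nor those on the products, and leaves finitely many values of
    \<open>l\<close>.\<close>
  define T where "T = Poly_Mapping.keys f \<union> (\<Union>x\<in>?W. Poly_Mapping.keys x)"
  have T: "finite T"
    unfolding T_def using finite_products[OF finite_imageI[OF U, of G], of m] by simp
  define l where "l u = (if u \<in> T then g (mon u) else 0)" for u
  have pairing_l: "pairing l x = g x" if "Poly_Mapping.keys x \<subseteq> T" for x
  proof -
    interpret g: Vector_Spaces.linear mpoly_scale "(*)" g by (rule g(1))
    have "x = (\<Sum>u\<in>Poly_Mapping.keys x. scalar (Poly_Mapping.lookup x u) * mon u)"
      using poly_mapping_eq_sum_single[of _ x, OF _ order_refl] by (simp add: mult_single)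
    then have "g x = g (\<Sum>u\<in>Poly_Mapping.keys x. scalar (Poly_Mapping.lookup x u) * mon u)"
      by (rule arg_cong)
    also have "\<dots> = (\<Sum>u\<in>Poly_Mapping.keys x. Poly_Mapping.lookup x u * g (mon u))"
      unfolding g.sum g.scale ..
    also have "\<dots> = pairing l x"
      using that unfolding pairing_def l_def by (intro sum.cong) auto
    finally show ?thesis ..
  qed
  define cs where "cs x = insert 0 (Poly_Mapping.lookup x ` Poly_Mapping.keys x)" for x :: "('k, 'n) mpoly"
  have cs: "finite (cs x)" "coeffs_in (cs x) x" for x
    by (auto simp: cs_def in_keys_iff)
  define S where "S = (\<Union>(v, j)\<in>X. range (\<lambda>i. v $ i)) \<union> cs f \<union> (\<Union>u\<in>U. cs (G u)) \<union>
      (\<Union>(v, j)\<in>X. \<Union>w\<in>U. cs (H v j w)) \<union> insert 0 (l ` T)"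
  have "finite S"
    unfolding S_def using X U T cs(1) by (auto simp: split_beta)
  have "counterexample_over S X k m D f G H l"
    unfolding counterexample_over_def
  proof (intro conjI)
    show "finite X" "m > 0" "CARD('n) > 1" "f \<in> vanishing_on X (m * (CARD('n) - 1 + k))"
      by fact+
    show "\<forall>(v, j)\<in>X. \<forall>i. v $ i \<in> S"
      unfolding S_def by blast
    show "coeffs_in S f"
      using cs(2)[of f] unfolding S_def by blast
    show "\<forall>u. total_degree u \<le> D \<longrightarrow> coeffs_in S (G u)"
    proof (intro allI impI)
      fix u w :: "'n \<Rightarrow>\<^sub>0 nat" assume "total_degree u \<le> D"
      then have "cs (G u) \<subseteq> S" unfolding S_def U_def by blast
      then show "Poly_Mapping.lookup (G u) w \<in> S" using spec[OF cs(2)] by (rule subsetD)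
    qed
    show "\<forall>(v, j)\<in>X. \<forall>w. total_degree w \<le> D \<longrightarrow> coeffs_in S (H v j w)"
    proof clarify
      fix v j and w u :: "'n \<Rightarrow>\<^sub>0 nat" assume "(v, j) \<in> X" "total_degree w \<le> D"
      then have "cs (H v j w) \<subseteq> S" unfolding S_def U_def by blast
      then show "Poly_Mapping.lookup (H v j w) u \<in> S" using spec[OF cs(2)] by (rule subsetD)
    qed
    show "\<forall>u. l u \<in> S"
      by (auto simp: S_def l_def)
    show "\<forall>u\<in>Poly_Mapping.keys f. total_degree u \<le> D" using D by blast
    show "\<forall>u. total_degree u \<le> D \<longrightarrow> G u \<in> vanishing_on X (k + 1)"
      using G by (simp add: U_def)
    show "\<forall>u. total_degree u \<le> D \<longrightarrow> mon u = G u + (\<Sum>(v, j)\<in>X. \<Sum>w\<in>?L j.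
        scalar (Poly_Mapping.lookup (shear v j (mon u)) w) * H v j w)"
      using GH by blast
    show "\<forall>x\<in>products (G ` {u. total_degree u \<le> D}) m. pairing l x = 0"
      unfolding U_def[symmetric]
    proof
      fix x assume "x \<in> ?W"
      then show "pairing l x = 0"
        using g(3) by (subst pairing_l) (auto simp: T_def)
    qed
    show "pairing l f = 1"
      using g(2) by (subst pairing_l) (auto simp: T_def)
  qed
  then have "has_counterexample TYPE('k \<times> 'n) S"
    unfolding has_counterexample_def by (intro exI)
  with no_counterexample[OF \<open>finite S\<close>] show False by blast
qed

subsection \<open>Ideals of points\<close>

context
  fixes A :: "'r::comm_ring_1 set"
begin

interpretation ideal: module "(*) :: 'r \<Rightarrow> 'r \<Rightarrow> 'r"
  by (rule module_ring_mult)

lemma subspace_ideal_power: "ideal.subspace (ideal_power A n)"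
  by (cases n) (simp_all add: ideal_mult_def ideal.subspace_UNIV)

lemma ideal_power_add: "a \<in> ideal_power A n \<Longrightarrow> b \<in> ideal_power A n \<Longrightarrow> a + b \<in> ideal_power A n"
  by (rule ideal.subspace_add[OF subspace_ideal_power])

lemma ideal_power_sum: "(\<And>i. i \<in> I \<Longrightarrow> f i \<in> ideal_power A n) \<Longrightarrow> sum f I \<in> ideal_power A n"
  by (rule ideal.subspace_sum[OF subspace_ideal_power])

lemma ideal_power_mult_left: "a \<in> ideal_power A n \<Longrightarrow> r * a \<in> ideal_power A n"
  by (rule ideal.subspace_scale[OF subspace_ideal_power])

lemma ideal_power_0_in: "0 \<in> ideal_power A n"
  by (rule ideal.subspace_0[OF subspace_ideal_power])

lemma ideal_power_Suc_mult: "a \<in> A \<Longrightarrow> b \<in> ideal_power A n \<Longrightarrow> a * b \<in> ideal_power A (Suc n)"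
  by (auto simp: ideal_mult_def intro: ideal.span_base)

lemma ideal_power_subset:
  assumes J: "\<And>n. ideal.subspace (J n)" "J 0 = UNIV"
    and mult: "\<And>a b n. a \<in> A \<Longrightarrow> b \<in> J n \<Longrightarrow> a * b \<in> J (Suc n)"
  shows "ideal_power A n \<subseteq> J n"
proof (induction n)
  case 0
  then show ?case using J(2) by simp
next
  case (Suc n)
  show ?case
    unfolding ideal_power.simps ideal_mult_def
    using Suc mult by (intro ideal.span_minimal J(1)) blast
qed

lemma ideal_power_Suc_subset: "ideal_power A (Suc n) \<subseteq> ideal_power A n"
  unfolding ideal_power.simps ideal_mult_def
  by (rule ideal.span_minimal[OF _ subspace_ideal_power]) (auto intro: ideal_power_mult_left)

lemma ideal_power_antimono: "m \<le> n \<Longrightarrow> ideal_power A n \<subseteq> ideal_power A m"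
  using ideal_power_Suc_subset by (rule lift_Suc_antimono_le)

lemma ideal_power_power_mult:
  assumes "a \<in> A" "b \<in> ideal_power A n"
  shows "a ^ k * b \<in> ideal_power A (k + n)"
proof (induction k)
  case (Suc k)
  then have "a * (a ^ k * b) \<in> ideal_power A (Suc (k + n))"
    by (rule ideal_power_Suc_mult[OF assms(1)])
  then show ?case by (simp only: power_Suc mult.assoc add_Suc)
qed (use assms in simp)

lemma ideal_power_prod:
  "(\<And>i. i \<in> I \<Longrightarrow> a i \<in> A) \<Longrightarrow> (\<Prod>i\<in>I. a i ^ k i) \<in> ideal_power A (sum k I)"
  by (induction I rule: infinite_finite_induct) (simp_all add: ideal_power_power_mult)

lemma products_subset_ideal_power: "products A n \<subseteq> ideal_power A n"
proof (induction n)
  case (Suc n)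
  then show ?case using ideal_power_Suc_mult[of _ _ n] by auto
qed simp

end

lemma linear_span_subset_ideal_power: "linear_span (products A m) \<subseteq> ideal_power A m"
  for A :: "('k::field, 'n) mpoly set"
proof -
  interpret vector_space "mpoly_scale :: 'k \<Rightarrow> ('k, 'n) mpoly \<Rightarrow> _"
    by (rule vector_space_mpoly)
  have "subspace (ideal_power A m)"
    by (rule subspaceI) (auto intro: ideal_power_0_in ideal_power_add ideal_power_mult_left)
  then show ?thesis
    by (intro span_minimal products_subset_ideal_power)
qed

text \<open>With one coordinate normalised to 1, the point is cut out by the forms x_i - v_i
  x_j.\<close>

definition represents :: "'k::field ^ 'n::finite \<Rightarrow> 'n \<Rightarrow> ('k ^ 'n) set \<Rightarrow> bool" where
  "represents v j p \<longleftrightarrow> v $ j = 1 \<and> p = {w. \<exists>c. c \<noteq> 0 \<and> w = c *s v}"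

lemma proj_space_represents:
  fixes p :: "('k::field ^ 'n::finite) set"
  assumes "p \<in> proj_space"
  shows "\<exists>v j. represents v j p"
proof -
  obtain w where w: "w \<noteq> 0" "p = proj_rel `` {w}"
    using assms by (auto simp: proj_space_def elim: quotientE)
  then obtain j where j: "w $ j \<noteq> 0"
    by (auto simp: vec_eq_iff)
  define v where "v = inverse (w $ j) *s w"
  have wv: "w = (w $ j) *s v"
    using j by (simp add: v_def vector_smult_assoc)
  have "p = {x. \<exists>c. c \<noteq> 0 \<and> x = c *s w}"
    using w by (auto simp: proj_rel_def vector_mul_eq_0)
  also have "\<dots> = {x. \<exists>c. c \<noteq> 0 \<and> x = c *s v}"
  proof (intro Collect_cong iffI; clarify)
    show "\<exists>c'. c' \<noteq> 0 \<and> c *s w = c' *s v" if "c \<noteq> 0" for c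
      using that j wv by (intro exI[of _ "c * w $ j"]) (metis mult_eq_0_iff vector_smult_assoc)
    show "\<exists>c'. c' \<noteq> 0 \<and> c *s v = c' *s w" if "c \<noteq> 0" for c
      using that j by (intro exI[of _ "c * inverse (w $ j)"]) (simp add: v_def vector_smult_assoc)
  qed
  finally have "represents v j p"
    using j by (simp add: represents_def v_def)
  then show ?thesis by blast
qed

lemma id_ring_hom_on: "ring_hom_on UNIV (\<lambda>c. c)"
  by (simp add: ring_hom_on_def)

lemma poly_eval_ring_hom: "ring_hom_on UNIV (\<lambda>f. poly_eval f v)"
  unfolding poly_eval_eq_mpoly_eval by (rule mpoly_eval_hom'[OF id_ring_hom_on])

lemma poly_eval_simps:
  "poly_eval (f - g) v = poly_eval f v - poly_eval g v"
  "poly_eval (f * g) v = poly_eval f v * poly_eval g v"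
  "poly_eval (f + g) v = poly_eval f v + poly_eval g v"
  "poly_eval (Var i) v = v $ i" "poly_eval (scalar c) v = c"
proof -
  show add: "poly_eval (f + g) v = poly_eval f v + poly_eval g v"
    and "poly_eval (f * g) v = poly_eval f v * poly_eval g v" for f g
    using poly_eval_ring_hom[of v] by (simp_all add: ring_hom_on_def)
  show "poly_eval (f - g) v = poly_eval f v - poly_eval g v"
    using add[of "f - g" g] by simp
  show "poly_eval (Var i) v = v $ i" "poly_eval (scalar c) v = c"
    by (simp_all add: poly_eval_eq_mpoly_eval)
qed

text \<open>At the unit vector e_j the form substituted for x_i takes the value v_i; for
  \<open>i = j\<close> this is where \<open>v $ j = 1\<close> enters.\<close>

lemma poly_eval_shear:
  assumes "v $ j = 1"
  shows "poly_eval (shear v j f) (axis j 1) = poly_eval f v"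
proof -
  have "poly_eval (shear v j f) (axis j 1) = mpoly_eval (\<lambda>c. poly_eval (scalar c) (axis j 1))
      (\<lambda>i. poly_eval (if i = j then Var j else Var i + scalar (v $ i) * Var j) (axis j 1)) f"
    unfolding shear_def by (rule mpoly_eval_comp[OF poly_eval_ring_hom]) simp_all
  also have "(\<lambda>i. poly_eval (if i = j then Var j else Var i + scalar (v $ i) * Var j) (axis j 1)) = (\<lambda>i. v $ i)"
    using assms by (auto simp: poly_eval_simps axis_def)
  finally show ?thesis
    by (simp add: poly_eval_simps) (simp add: poly_eval_eq_mpoly_eval)
qed

text \<open>
  Evaluation at the point \<open>e_j\<close> extracts the coefficient of the only monomial of the given degree
  that involves no variable other than \<open>x_j\<close>.
\<close>

lemma homogeneous_in_vanishing:
  fixes v :: "'k::comm_ring_1 ^ 'n::finite"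
  assumes v: "v $ j = 1" and f: "homogeneous_poly d f" "poly_eval f v = 0"
  shows "f \<in> vanishing v j 1"
proof -
  let ?g = "shear v j f"
  have hom: "homogeneous_poly d ?g"
    using homogeneous_part_homogeneous[OF f(1), of d] homogeneous_part_shear[of d v j f]
      homogeneous_poly_homogeneous_part[of d ?g] by simp
  have "1 \<le> codegree j w" if w: "w \<in> Poly_Mapping.keys ?g" for w
  proof (rule ccontr)
    assume "\<not> ?thesis"
    then have "codegree j w = 0" by simp
    then have w0: "\<And>i. i \<noteq> j \<Longrightarrow> Poly_Mapping.lookup w i = 0"
      by (simp add: codegree_def)
    have deg: "total_degree u = Poly_Mapping.lookup u j + codegree j u" for u
      by (simp add: total_degree_def codegree_def sum.remove[of UNIV j])
    have prod: "(\<Prod>i\<in>UNIV. (axis j 1 $ i) ^ Poly_Mapping.lookup u i) = (if u = w then 1 else 0 :: 'k)"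
      if u: "u \<in> Poly_Mapping.keys ?g" for u
    proof (cases "codegree j u = 0")
      case True
      then have u0: "\<And>i. i \<noteq> j \<Longrightarrow> Poly_Mapping.lookup u i = 0"
        by (simp add: codegree_def)
      have "total_degree u = total_degree w"
        using hom u w by (simp add: homogeneous_poly_iff in_keys_iff)
      then have "Poly_Mapping.lookup u j = Poly_Mapping.lookup w j"
        using u0 w0 by (simp add: deg codegree_def)
      then have "u = w"
        using u0 w0 by (intro poly_mapping_eqI) metis
      moreover have "(\<Prod>i\<in>UNIV. (axis j 1 $ i) ^ Poly_Mapping.lookup u i) = (1 :: 'k)"
        using u0 by (intro prod.neutral) (auto simp: axis_def)
      ultimately show ?thesis by simp
    next
      case False
      then obtain i where "i \<noteq> j" "Poly_Mapping.lookup u i \<noteq> 0"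
        by (auto simp: codegree_def)
      then have "(axis j 1 $ i :: 'k) ^ Poly_Mapping.lookup u i = 0"
        by (simp add: axis_def power_0_left)
      then have "(\<Prod>i\<in>UNIV. (axis j 1 $ i) ^ Poly_Mapping.lookup u i) = (0 :: 'k)"
        by (intro prod_zero finite) blast
      moreover have "u \<noteq> w" using \<open>i \<noteq> j\<close> \<open>Poly_Mapping.lookup u i \<noteq> 0\<close> w0 by auto
      ultimately show ?thesis by simp
    qed
    have "poly_eval ?g (axis j 1) = (\<Sum>u\<in>Poly_Mapping.keys ?g. if u = w then Poly_Mapping.lookup ?g u else 0)"
      unfolding poly_eval_def by (intro sum.cong refl) (simp add: prod)
    then have "poly_eval ?g (axis j 1) = Poly_Mapping.lookup ?g w"
      using w by simp
    then show False
      using f(2) w poly_eval_shear[of v j f, OF v] by (simp add: in_keys_iff)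
  qed
  then show ?thesis by (simp add: vanishing_def)
qed

definition linear_form :: "'k::comm_ring_1 ^ 'n::finite \<Rightarrow> 'n \<Rightarrow> 'n \<Rightarrow> ('k, 'n) mpoly" where
  "linear_form v j i = Var i - scalar (v $ i) * Var j"

lemma poly_eval_linear_form: "poly_eval (linear_form v j i) w = w $ i - v $ i * w $ j"
  by (simp add: linear_form_def poly_eval_simps)

lemma linear_form_in_point_ideal:
  fixes v :: "'k::field ^ 'n::finite"
  assumes "represents v j p"
  shows "linear_form v j i \<in> point_ideal p"
proof -
  interpret ideal: module "(*) :: ('k, 'n) mpoly \<Rightarrow> _"
    by (rule module_ring_mult)
  have "homogeneous_poly (Suc 0) (Var i + scalar (- (v $ i)) * Var j)"
    by (intro homogeneous_poly_add homogeneous_poly_scalar_mult homogeneous_poly_Var)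
  then have "homogeneous_poly (Suc 0) (linear_form v j i)"
    by (simp add: linear_form_def single_uminus)
  moreover have "poly_eval (linear_form v j i) w = 0" if "w \<in> p" for w
    using that assms by (auto simp: represents_def poly_eval_linear_form)
  ultimately show ?thesis
    unfolding point_ideal_def by (intro ideal.span_base) blast
qed

text \<open>One inclusion is multiplicativity of vanishing orders. For the other, the inverse of
  \<open>shear v j\<close> turns a monomial into a power of x_j times as many linear forms of the
  point as its codegree.\<close>

lemma point_ideal_power:
  fixes v :: "'k::field ^ 'n::finite"
  assumes v: "represents v j p"
  shows "ideal_power (point_ideal p) n = vanishing v j n"
proof
  interpret ideal: module "(*) :: ('k, 'n) mpoly \<Rightarrow> _"
    by (rule module_ring_mult)
  have sub: "ideal.subspace (vanishing v j M)" for M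
    by (rule ideal.subspaceI) (auto intro: vanishing_0 vanishing_add vanishing_mult_left)
  have "v $ j = 1" "v \<in> p"
    using v by (auto simp: represents_def intro!: exI[of _ 1])
  then have "point_ideal p \<subseteq> vanishing v j 1"
    unfolding point_ideal_def
    by (intro ideal.span_minimal sub) (blast intro: homogeneous_in_vanishing)
  then show "ideal_power (point_ideal p) n \<subseteq> vanishing v j n"
    using vanishing_mult[of _ v j 1]
    by (intro ideal_power_subset sub vanishing_UNIV) auto
  show "vanishing v j n \<subseteq> ideal_power (point_ideal p) n"
  proof
    fix f assume f: "f \<in> vanishing v j n"
    let ?s = "shear (- v) j" and ?g = "shear v j f"
    have s_Var: "?s (Var i) = (if i = j then Var j else linear_form v j i)" for i
      by (simp add: shear_Var linear_form_def single_uminus)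
    have "f = ?s ?g" by (simp add: shear_shear_uminus)
    also have "\<dots> = ?s (\<Sum>u\<in>Poly_Mapping.keys ?g. scalar (Poly_Mapping.lookup ?g u) * mon u)"
      using poly_mapping_eq_sum_single[of _ ?g, OF _ order_refl] by (simp add: mult_single)
    also have "\<dots> = (\<Sum>u\<in>Poly_Mapping.keys ?g. scalar (Poly_Mapping.lookup ?g u) * ?s (mon u))"
      by (simp add: shear_sum shear_mult shear_scalar)
    also have "\<dots> \<in> ideal_power (point_ideal p) n"
    proof (intro ideal_power_sum ideal_power_mult_left)
      fix u assume u: "u \<in> Poly_Mapping.keys ?g"
      have "?s (mon u) = (\<Prod>i\<in>UNIV. ?s (Var i) ^ Poly_Mapping.lookup u i)"
        by (subst mon_eq_prod_Var) (simp add: shear_prod shear_power)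
      also have "\<dots> = Var j ^ Poly_Mapping.lookup u j *
          (\<Prod>i\<in>UNIV - {j}. linear_form v j i ^ Poly_Mapping.lookup u i)"
        by (simp add: prod.remove[of UNIV j] s_Var)
      also have "\<dots> \<in> ideal_power (point_ideal p) (codegree j u)"
        unfolding codegree_def
        by (intro ideal_power_mult_left ideal_power_prod linear_form_in_point_ideal v)
      finally show "?s (mon u) \<in> ideal_power (point_ideal p) n"
        using ideal_power_antimono[of n "codegree j u"] f u by (auto simp: vanishing_def)
    qed
    finally show "f \<in> ideal_power (point_ideal p) n" .
  qed
qed

lemma fat_points_ideal_power_containment:
  fixes X :: "('k::field_char_0 ^ 'n::finite) set set"
  assumes X: "X \<subseteq> proj_space" "finite X" and n: "CARD('n) > 1" and m: "m > 0" and t: "t > 0"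
    and M: "m * (CARD('n) - 1 + (t - 1)) \<le> M"
  shows "fat_points_ideal X (\<lambda>_. M) \<subseteq> ideal_power (fat_points_ideal X (\<lambda>_. t)) m"
proof -
  have "\<forall>p\<in>X. \<exists>P. represents (fst P) (snd P) p"
    using X(1) proj_space_represents by fastforce
  then obtain P where P: "\<forall>p\<in>X. represents (fst (P p)) (snd (P p)) p"
    by (rule bchoice[THEN exE])
  have fat: "fat_points_ideal X (\<lambda>_. a) = vanishing_on (P ` X) a" for a
  proof -
    have "ideal_power (point_ideal p) a = vanishing (fst (P p)) (snd (P p)) a" if "p \<in> X" for p
      using P that by (intro point_ideal_power) blast
    then show ?thesis
      by (simp add: fat_points_ideal_def vanishing_on_def split_beta)
  qed
  have "vanishing_on (P ` X) M \<subseteq> vanishing_on (P ` X) (m * (CARD('n) - 1 + (t - 1)))"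
    using vanishing_antimono[OF M] by (fastforce simp: vanishing_on_def)
  also have "\<dots> \<subseteq> linear_span (products (vanishing_on (P ` X) (t - 1 + 1)) m)"
    using vanishing_on_subset_products[OF finite_imageI[OF X(2)] n m] by blast
  also have "\<dots> \<subseteq> ideal_power (vanishing_on (P ` X) (t - 1 + 1)) m"
    by (rule linear_span_subset_ideal_power)
  finally show ?thesis
    using t by (simp add: fat)
qed

subsection \<open>A lower bound for the resurgence\<close>

text \<open>The elements with image divisible by \<open>d ^ n\<close> form an ideal, and multiplying
  by an element of \<open>A\<close> raises \<open>n\<close> by one.\<close>

lemma dvd_hom_ideal_power:
  fixes \<psi> :: "'r::comm_ring_1 \<Rightarrow> 's::comm_ring_1"
  assumes \<psi>: "ring_hom_on UNIV \<psi>" and A: "\<And>a. a \<in> A \<Longrightarrow> d dvd \<psi> a" and a: "a \<in> ideal_power A n"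
  shows "d ^ n dvd \<psi> a"
proof -
  interpret ideal: module "(*) :: 'r \<Rightarrow> 'r \<Rightarrow> 'r"
    by (rule module_ring_mult)
  have hom: "\<psi> (x + y) = \<psi> x + \<psi> y" "\<psi> (x * y) = \<psi> x * \<psi> y" for x y
    using \<psi> by (simp_all add: ring_hom_on_def)
  have "ideal_power A n \<subseteq> {a. d ^ n dvd \<psi> a}"
  proof (rule ideal_power_subset)
    show "ideal.subspace {a. d ^ n dvd \<psi> a}" for n
      by (rule ideal.subspaceI) (auto simp: hom ring_hom_on_0[OF \<psi>])
    show "a * b \<in> {a. d ^ Suc n dvd \<psi> a}" if "a \<in> A" "b \<in> {a. d ^ n dvd \<psi> a}" for a b n
      using that A by (auto simp: hom intro: mult_dvd_mono)
  qed simp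
  then show ?thesis using a by blast
qed

lemma dvd_hom_ideal_gen:
  fixes \<psi> :: "'r::comm_ring_1 \<Rightarrow> 's::comm_ring_1"
  assumes \<psi>: "ring_hom_on UNIV \<psi>" and A: "\<And>a. a \<in> A \<Longrightarrow> d dvd \<psi> a" and a: "a \<in> ideal_gen A"
  shows "d dvd \<psi> a"
proof -
  interpret ideal: module "(*) :: 'r \<Rightarrow> 'r \<Rightarrow> 'r"
    by (rule module_ring_mult)
  have hom: "\<psi> (x + y) = \<psi> x + \<psi> y" "\<psi> (x * y) = \<psi> x * \<psi> y" for x y
    using \<psi> by (simp_all add: ring_hom_on_def)
  have "ideal_gen A \<subseteq> {a. d dvd \<psi> a}"
  proof (rule ideal.span_minimal)
    show "ideal.subspace {a. d dvd \<psi> a}"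
      by (rule ideal.subspaceI) (auto simp: hom ring_hom_on_0[OF \<psi>])
  qed (use A in blast)
  then show ?thesis using a by blast
qed

text \<open>
  Restricting polynomials to a line through the representative of one of the points shows that
  powers of a product of linear forms vanish at this point to no higher order than required.
\<close>

lemma fat_points_ideal_not_subset:
  fixes X :: "('k::field ^ 'n::finite) set set"
  assumes X: "X \<subseteq> proj_space" "finite X" "p0 \<in> X" and n: "CARD('n) > 1" and t: "t > 0"
  shows "\<not> fat_points_ideal X (\<lambda>_. t * m) \<subseteq> ideal_power (fat_points_ideal X (\<lambda>_. t)) (m + 1)"
proof
  assume sub: "fat_points_ideal X (\<lambda>_. t * m) \<subseteq> ideal_power (fat_points_ideal X (\<lambda>_. t)) (m + 1)"
  obtain v j where v: "represents v j p0"
    using proj_space_represents X by blast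
  then have vj: "v $ j = 1" "v \<in> p0"
    by (auto simp: represents_def intro!: exI[of _ 1])
  \<comment> \<open>Moving from \<open>v\<close> in the direction \<open>i0\<close> keeps coordinate
    \<open>j\<close> equal to 1, so \<open>linear_form v j i0\<close> restricts to the parameter of
    the line.\<close>
  obtain i0 where i0: "i0 \<noteq> j"
    using n by (metis (full_types) UNIV_eq_I card_1_singleton_iff insertI1 less_irrefl One_nat_def singleton_iff)
  define \<psi> :: "('k, 'n) mpoly \<Rightarrow> 'k poly" where
    "\<psi> = mpoly_eval (\<lambda>c. [:c:]) (\<lambda>i. if i = i0 then [:v $ i, 1:] else [:v $ i:])"
  have \<psi>: "ring_hom_on UNIV \<psi>"
    unfolding \<psi>_def by (rule mpoly_eval_hom') (simp add: ring_hom_on_def one_pCons)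
  have poly_\<psi>: "poly (\<psi> f) 0 = poly_eval f v" for f
  proof -
    have "ring_hom_on UNIV (\<lambda>q :: 'k poly. poly q 0)" by (simp add: ring_hom_on_def)
    then have "poly (\<psi> f) 0 = mpoly_eval (\<lambda>c. poly [:c:] 0) (\<lambda>i. poly (if i = i0 then [:v $ i, 1:] else [:v $ i:]) 0) f"
      unfolding \<psi>_def by (rule mpoly_eval_comp) simp_all
    also have "(\<lambda>i. poly (if i = i0 then [:v $ i, 1:] else [:v $ i:]) 0) = (\<lambda>i. v $ i)"
      by auto
    finally show ?thesis by (simp add: poly_eval_eq_mpoly_eval)
  qed
  let ?x = "[:0, 1:] :: 'k poly"
  have x_dvd: "?x dvd q \<longleftrightarrow> poly q 0 = 0" for q
    using poly_eq_0_iff_dvd[of q 0] by simp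
  have "?x dvd \<psi> f" if "f \<in> point_ideal p0" for f
    using that unfolding point_ideal_def
    by (rule dvd_hom_ideal_gen[OF \<psi>, rotated]) (auto simp: x_dvd poly_\<psi> vj)
  then have "?x ^ t dvd \<psi> f" if "f \<in> ideal_power (point_ideal p0) t" for f
    using that by (rule dvd_hom_ideal_power[OF \<psi>])
  then have "?x ^ t dvd \<psi> f" if "f \<in> fat_points_ideal X (\<lambda>_. t)" for f
    using that X(3) by (auto simp: fat_points_ideal_def)
  then have dvd: "(?x ^ t) ^ (m + 1) dvd \<psi> f" if "f \<in> ideal_power (fat_points_ideal X (\<lambda>_. t)) (m + 1)" for f
    using that by (rule dvd_hom_ideal_power[OF \<psi>])
  \<comment> \<open>Otherwise all linear forms of \<open>p\<close> vanish at \<open>v\<close>, so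
    that \<open>v\<close> is a multiple of \<open>w\<close> and the two points coincide.\<close>
  have "\<exists>f. f \<in> point_ideal p \<and> poly_eval f v \<noteq> 0" if p: "p \<in> X - {p0}" for p
  proof (rule ccontr)
    assume no: "\<not> ?thesis"
    obtain w k where w: "represents w k p"
      using proj_space_represents X(1) p by blast
    have "poly_eval (linear_form w k i) v = 0" for i
      using no linear_form_in_point_ideal[OF w] by blast
    then have "v $ i = v $ k * w $ i" for i
      unfolding poly_eval_linear_form by (metis eq_iff_diff_eq_0 mult.commute)
    then have vw: "v = (v $ k) *s w"
      unfolding vec_eq_iff vector_smult_component by blast
    then have "v $ k \<noteq> 0" using vj(1) by (metis mult_zero_left vector_smult_component zero_neq_one)
    have "{x. \<exists>c. c \<noteq> 0 \<and> x = c *s v} = {x. \<exists>c. c \<noteq> 0 \<and> x = c *s w}"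
    proof (intro Collect_cong iffI; clarify)
      show "\<exists>c'. c' \<noteq> 0 \<and> c *s v = c' *s w" if "c \<noteq> 0" for c
        using that \<open>v $ k \<noteq> 0\<close> vw by (intro exI[of _ "c * v $ k"]) (metis mult_eq_0_iff vector_smult_assoc)
      show "\<exists>c'. c' \<noteq> 0 \<and> c *s w = c' *s v" if "c \<noteq> 0" for c
      proof (intro exI[of _ "c * inverse (v $ k)"] conjI)
        have "(c * inverse (v $ k)) *s v = (c * inverse (v $ k)) *s ((v $ k) *s w)"
          using vw by (rule arg_cong)
        then show "c *s w = (c * inverse (v $ k)) *s v"
          using \<open>v $ k \<noteq> 0\<close> by (simp add: vector_smult_assoc)
      qed (use that \<open>v $ k \<noteq> 0\<close> in simp)
    qed
    then have "p = p0" using v w by (simp add: represents_def)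
    with p show False by simp
  qed
  then obtain L where L: "\<And>p. p \<in> X - {p0} \<Longrightarrow> L p \<in> point_ideal p \<and> poly_eval (L p) v \<noteq> 0"
    by metis
  define g where "g = (\<Prod>p\<in>X - {p0}. L p)"
  \<comment> \<open>Along the line \<open>f\<close> has order exactly \<open>t * m\<close> at
    \<open>v\<close>, as \<open>g\<close> does not vanish there; membership in the ordinary power
    would force order \<open>t * (m + 1)\<close>.\<close>
  define f where "f = (linear_form v j i0 * g) ^ (t * m)"
  have power_in: "h ^ (t * m) * r \<in> ideal_power (point_ideal p) (t * m)" if "h \<in> point_ideal p" for h r and p :: "('k ^ 'n) set"
    using ideal_power_power_mult[of h "point_ideal p" r 0 "t * m"] that by simp
  have "f \<in> fat_points_ideal X (\<lambda>_. t * m)"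
    unfolding fat_points_ideal_def
  proof
    fix p assume p: "p \<in> X"
    show "f \<in> ideal_power (point_ideal p) (t * m)"
    proof (cases "p = p0")
      case True
      then show ?thesis
        using power_in[OF linear_form_in_point_ideal[OF v]] by (simp add: f_def power_mult_distrib)
    next
      case False
      then have "g = L p * (\<Prod>q\<in>X - {p0} - {p}. L q)"
        unfolding g_def using p X(2) by (intro prod.remove) auto
      then have "f = L p ^ (t * m) * (linear_form v j i0 * (\<Prod>q\<in>X - {p0} - {p}. L q)) ^ (t * m)"
        by (simp add: f_def power_mult_distrib mult_ac)
      then show ?thesis using power_in L p False by auto
    qed
  qed
  then have "(?x ^ t) ^ (m + 1) dvd \<psi> f"
    using sub dvd by blast
  moreover have "\<psi> f = ?x ^ (t * m) * \<psi> g ^ (t * m)"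
  proof -
    have "\<psi> (linear_form v j i0) + \<psi> (scalar (v $ i0) * Var j) = \<psi> (Var i0)"
      using ring_hom_on_add[OF \<psi>, of "linear_form v j i0" "scalar (v $ i0) * Var j"]
      by (simp add: linear_form_def)
    moreover have "\<psi> (scalar (v $ i0) * Var j) = [:v $ i0:]"
      using ring_hom_on_mult[OF \<psi>, of "scalar (v $ i0)" "Var j"] i0 vj
      by (simp add: \<psi>_def one_pCons)
    moreover have "\<psi> (Var i0) = [:v $ i0, 1:]"
      by (simp add: \<psi>_def one_pCons)
    ultimately have "\<psi> (linear_form v j i0) = ?x"
      by (simp add: eq_diff_eq[symmetric])
    then show ?thesis
      by (simp add: f_def ring_hom_on_power[OF \<psi>] ring_hom_on_mult[OF \<psi>] power_mult_distrib)
  qed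
  ultimately have "?x ^ (t * m) * ?x ^ t dvd ?x ^ (t * m) * \<psi> g ^ (t * m)"
    by (simp add: power_add power_mult mult.commute flip: power_mult)
  then have "?x ^ t dvd \<psi> g ^ (t * m)"
    by simp
  then have "?x dvd \<psi> g ^ (t * m)"
    using t by (meson dvd_power dvd_trans)
  then have "poly_eval g v = 0"
    by (simp add: x_dvd poly_\<psi>)
  moreover have "poly_eval g v = (\<Prod>p\<in>X - {p0}. poly_eval (L p) v)"
    unfolding g_def by (rule ring_hom_on_prod[OF poly_eval_ring_hom]) simp
  ultimately show False
    using L X(2) by auto
qed

theorem proposition2p1:
  fixes X :: "('k::field_char_0 ^ 'n::finite) set set" and N s :: nat
  assumes "CARD('n) = N + 1" and "N \<ge> 1"
    and "X \<subseteq> proj_space" and "finite X" and "card X = s" and "s \<ge> 1"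
  shows "(\<forall>m\<ge>1. \<forall>t\<ge>2. symbolic_power X (\<lambda>_. t) (N * m - N + 1)
              \<subseteq> ideal_power (fat_points_ideal X (\<lambda>_. t)) m)
       \<and> (\<forall>t\<ge>1. resurgence X (\<lambda>_. t) \<le> ereal ((real t + real N - 1) / real t))
       \<and> (\<lambda>t. resurgence X (\<lambda>_. t)) \<longlonglongrightarrow> 1"
proof (intro conjI)
  have n: "CARD('n) > 1" using assms by simp
  have contain: "symbolic_power X (\<lambda>_. t) M \<subseteq> ideal_power (fat_points_ideal X (\<lambda>_. t)) m"
    if "m > 0" "t > 0" "m * (N + (t - 1)) \<le> t * M" for m t M
    unfolding symbolic_power_def
    using fat_points_ideal_power_containment[OF assms(3,4) n that(1,2)] that(3) assms(1) by simp
  show "\<forall>m\<ge>1. \<forall>t\<ge>2. symbolic_power X (\<lambda>_. t) (N * m - N + 1)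
      \<subseteq> ideal_power (fat_points_ideal X (\<lambda>_. t)) m"
  proof (intro allI impI)
    fix m t :: nat assume m: "1 \<le> m" and t: "2 \<le> t"
    show "symbolic_power X (\<lambda>_. t) (N * m - N + 1) \<subseteq> ideal_power (fat_points_ideal X (\<lambda>_. t)) m"
    proof (cases "m = 1")
      \<comment> \<open>Here \<open>contain\<close> does not apply when \<open>N > 1\<close>, as
        \<open>N + (t - 1)\<close> exceeds \<open>t\<close>; but the symbolic exponent is 1, and the
        claim compares the ideal with its first power.\<close>
      case True
      have "a \<in> ideal_power A 1" if "a \<in> A" for a and A :: "('k, 'n) mpoly set"
        using ideal_power_Suc_mult[OF that, of 1 0] by simp
      then show ?thesis using True by (auto simp: symbolic_power_def)
    next
      case False
      \<comment> \<open>The shifts free the difference of the two exponents from subtraction: (N -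
        1) ((m - 1) (t - 1) - 1) becomes \<open>N' * (m' * t' + m' + t')\<close>, visibly
        nonnegative.\<close>
      obtain N' m' t' where eq: "N = N' + 1" "m = m' + 2" "t = t' + 2"
        using assms(2) m t False by (metis add.commute le_add_diff_inverse le_neq_implies_less Suc_leI One_nat_def Suc_1)
      have "t * (N * m - N + 1) = m * (N + (t - 1)) + N' * (m' * t' + m' + t')"
        by (simp add: eq algebra_simps)
      then show ?thesis using m t by (intro contain) simp_all
    qed
  qed
  have upper: "resurgence X (\<lambda>_. t) \<le> ereal ((real t + real N - 1) / real t)" if t: "1 \<le> t" for t
    unfolding resurgence_def
  proof (rule Sup_least)
    fix x
    assume "x \<in> {ereal (real m / real r) | m r. m \<ge> 1 \<and> r \<ge> 1 \<and>
      \<not> symbolic_power X (\<lambda>_. t) m \<subseteq> ideal_power (fat_points_ideal X (\<lambda>_. t)) r}"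
    then obtain m r where x: "x = ereal (real m / real r)" and mr: "1 \<le> m" "1 \<le> r" "\<not> symbolic_power X (\<lambda>_. t) m \<subseteq> ideal_power (fat_points_ideal X (\<lambda>_. t)) r"
      by (elim CollectE exE conjE)
    then have "t * m < r * (N + (t - 1))"
      using contain[of r t m] t by fastforce
    then have "real (t * m) \<le> real (r * (N + (t - 1)))"
      by (simp only: of_nat_le_iff less_imp_le)
    moreover have "real (N + (t - 1)) = real t + real N - 1"
      using t by simp
    ultimately have "real t * real m \<le> real r * (real t + real N - 1)"
      by (simp only: of_nat_mult)
    then show "x \<le> ereal ((real t + real N - 1) / real t)"
      using mr t by (simp add: x field_simps)
  qed
  then show "\<forall>t\<ge>1. resurgence X (\<lambda>_. t) \<le> ereal ((real t + real N - 1) / real t)"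
    by blast
  obtain p0 where p0: "p0 \<in> X"
    using assms(5,6) by fastforce
  \<comment> \<open>Each ratio \<open>m / (m + 1)\<close> with \<open>m \<ge> 1\<close> comes from a
    failing containment, so the supremum is at least their limit.\<close>
  have lower: "1 \<le> resurgence X (\<lambda>_. t)" if t: "1 \<le> t" for t
  proof (rule LIMSEQ_le_const2)
    have "(\<lambda>m. real m / real (Suc m)) \<longlonglongrightarrow> 1"
      by (rule LIMSEQ_n_over_Suc_n)
    then show "(\<lambda>m. ereal (real m / real (Suc m))) \<longlonglongrightarrow> 1"
      by (simp add: one_ereal_def)
    have "ereal (real m / real (Suc m)) \<le> resurgence X (\<lambda>_. t)" if "m \<ge> 1" for m
      unfolding resurgence_def
      using fat_points_ideal_not_subset[OF assms(3,4) p0 n, of t m] t that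
      by (intro Sup_upper CollectI exI[of _ m] exI[of _ "Suc m"]) (simp add: symbolic_power_def)
    then show "\<exists>M. \<forall>m\<ge>M. ereal (real m / real (Suc m)) \<le> resurgence X (\<lambda>_. t)"
      by blast
  qed
  have "(\<lambda>t. 1 + (real N - 1) / real t) \<longlonglongrightarrow> 1 + 0"
    by (intro tendsto_add tendsto_const lim_const_over_n)
  then have "(\<lambda>t. ereal (1 + (real N - 1) / real t)) \<longlonglongrightarrow> 1"
    by (simp add: one_ereal_def)
  moreover have "\<forall>\<^sub>F t in sequentially. ereal (1 + (real N - 1) / real t) = ereal ((real t + real N - 1) / real t)"
    using eventually_ge_at_top[of 1] by eventually_elim (simp add: field_simps)
  ultimately have lim: "(\<lambda>t. ereal ((real t + real N - 1) / real t)) \<longlonglongrightarrow> 1"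
    by (rule Lim_transform_eventually)
  show "(\<lambda>t. resurgence X (\<lambda>_. t)) \<longlonglongrightarrow> 1"
    by (rule tendsto_sandwich[OF _ _ tendsto_const lim])
       (use eventually_ge_at_top[of 1] in eventually_elim, use lower upper in blast)+
qed

end
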